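(* Let $\alpha$ be an integer with $\alpha\notin\{0,1,2\}$, let $p$ be a prime factor of $\alpha-1$, let $m=v_p(\alpha-1)$, and let $J$ be the Sylow $p$-subgroup of the Macdonald group $G(\alpha)$. Suppose that either $p>3$, or $p=3$ and ($m>1$ or $(\alpha-1)/3\equiv 1\bmod 3$). Then $Z(J)=J^{p^{2m}}$; $Z_3(J)=J^{p^{m}}$ is abelian of order $p^{4m}$ with presentation $$\langle X,Y,Z\mid XY=YX,\ YZ=ZY,\ XZ=ZX,\ X^{p^{2m}}=1,\ X^{p^{m}}Y^{p^{m}}=1,\ Z^{p^{m}}=1\rangle;$$ $J/Z_3(J)\cong\mathrm{Heis}(\mathbb{Z}/p^{m}\mathbb{Z})$; and $J$ has exponent $p^{3m}$.
   Context: For elements $a,b$ of a group, $[a,b]=a^{-1}b^{-1}ab$ and $b^a=a^{-1}ba$. For a group $T$, $Z_0(T)=1$ and $Z_{i+1}(T)/Z_i(T)$ is the center of $T/Z_i(T)$; for $n\in\mathbb{Z}$, $T^n$ denotes the subgroup of $T$ generated by all $t^n$, $t\in T$. $\mathrm{Heis}(R)$ is the Heisenberg group over the ring $R$ (upper unitriangular $3\times 3$ matrices over $R$). The Macdonald group is $G(\alpha)=\langle A,B\mid A^{[A,B]}=A^\alpha,\ B^{[B,A]}=B^\alpha\rangle$; for $\alpha\notin\{0,1,2\}$ it is finite and nilpotent, so it has a unique Sylow $p$-subgroup. $v_p$ denotes the $p$-adic valuation. *)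

theory Defs
  imports "HOL-Algebra.Generated_Groups" "HOL-Number_Theory.Residues"
begin

section \<open>Group presentations\<close>

text \<open>A letter \<open>(x, True)\<close> stands for the generator \<open>x\<close> and \<open>(x, False)\<close> for its formal inverse.
  The free group consists of the classes of words under insertion and deletion of
  \<open>x x\<inverse>\<close> and \<open>x\<inverse> x\<close>.\<close>

type_synonym 'g word = "('g \<times> bool) list"

inductive free_eq :: "'g word \<Rightarrow> 'g word \<Rightarrow> bool" where
  refl: "free_eq u u"
| sym: "free_eq u v \<Longrightarrow> free_eq v u"
| trans: "free_eq u v \<Longrightarrow> free_eq v w \<Longrightarrow> free_eq u w"
| cancel: "free_eq (u @ [(x, b), (x, \<not> b)] @ v) (u @ v)"

definition word_class :: "'g word \<Rightarrow> 'g word set" where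
  "word_class u = {w. free_eq u w}"

definition free_group :: "'g word set monoid" where
  "free_group =
     \<lparr>carrier = range word_class,
      monoid.mult = (\<lambda>P Q. {w. \<exists>u\<in>P. \<exists>v\<in>Q. free_eq (u @ v) w}),
      one = word_class []\<rparr>"

lemma free_eq_append:
  assumes "free_eq u u'" "free_eq v v'"
  shows "free_eq (u @ v) (u' @ v')"
proof -
  have l: "free_eq (c @ u) (c @ v)" if "free_eq u v" for c u v :: "'a word"
    using that
  proof induction
    case (cancel u x b v)
    show ?case using free_eq.cancel[of "c @ u" x b v] by simp
  qed (blast intro: free_eq.intros)+
  have r: "free_eq (u @ c) (v @ c)" if "free_eq u v" for c u v :: "'a word"
    using that
  proof induction
    case (cancel u x b v)
    show ?case using free_eq.cancel[of u x b "v @ c"] by simp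
  qed (blast intro: free_eq.intros)+
  show ?thesis using l[OF assms(2), of u] r[OF assms(1), of v'] by (blast intro: free_eq.trans)
qed

lemma word_class_eq_iff: "word_class u = word_class v \<longleftrightarrow> free_eq u v"
  unfolding word_class_def by (blast intro: free_eq.intros)

lemma free_group_mult:
  "word_class u \<otimes>\<^bsub>free_group\<^esub> word_class v = word_class (u @ v)"
  unfolding free_group_def word_class_def
  by (auto intro: free_eq.intros free_eq_append)

lemma free_eq_inverse: "free_eq (rev (map (\<lambda>(x, b). (x, \<not> b)) u) @ u) []"
proof (induction u)
  case Nil
  show ?case by (simp add: free_eq.refl)
next
  case (Cons a u)
  obtain x b where a: "a = (x, b)" by force
  show ?case
    using free_eq.cancel[of "rev (map (\<lambda>(x, b). (x, \<not> b)) u)" x "\<not> b" u] Cons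
    by (auto simp: a intro: free_eq.trans)
qed

lemma group_free_group: "group (free_group :: 'g word set monoid)" (is "group ?F")
proof (rule groupI)
  show "\<one>\<^bsub>?F\<^esub> \<in> carrier ?F" by (simp add: free_group_def)
next
  fix P Q :: "'g word set" assume "P \<in> carrier ?F" "Q \<in> carrier ?F"
  then obtain u v where "P = word_class u" "Q = word_class v" by (auto simp: free_group_def)
  then show "P \<otimes>\<^bsub>?F\<^esub> Q \<in> carrier ?F"
    by (simp add: free_group_mult) (simp add: free_group_def)
next
  fix P Q S :: "'g word set"
  assume "P \<in> carrier ?F" "Q \<in> carrier ?F" "S \<in> carrier ?F"
  then obtain u v w where "P = word_class u" "Q = word_class v" "S = word_class w"
    by (auto simp: free_group_def)
  then show "P \<otimes>\<^bsub>?F\<^esub> Q \<otimes>\<^bsub>?F\<^esub> S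
      = P \<otimes>\<^bsub>?F\<^esub> (Q \<otimes>\<^bsub>?F\<^esub> S)"
    by (simp add: free_group_mult)
next
  fix P :: "'g word set" assume "P \<in> carrier ?F"
  then obtain u where P: "P = word_class u" by (auto simp: free_group_def)
  have one: "\<one>\<^bsub>?F\<^esub> = word_class []" by (simp add: free_group_def)
  show "\<one>\<^bsub>?F\<^esub> \<otimes>\<^bsub>?F\<^esub> P = P"
    by (simp add: one P free_group_mult)
  have "word_class (rev (map (\<lambda>(x, b). (x, \<not> b)) u)) \<otimes>\<^bsub>?F\<^esub> P
      = \<one>\<^bsub>?F\<^esub>"
    by (simp add: one P free_group_mult word_class_eq_iff free_eq_inverse)
  then show "\<exists>Q\<in>carrier ?F. Q \<otimes>\<^bsub>?F\<^esub> P = \<one>\<^bsub>?F\<^esub>"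
    by (auto simp: free_group_def)
qed

definition free_gen :: "'g \<Rightarrow> 'g word set" where
  "free_gen x = word_class [(x, True)]"

definition normal_closure :: "('a, 'b) monoid_scheme \<Rightarrow> 'a set \<Rightarrow> 'a set" where
  "normal_closure G S = \<Inter>{N. N \<lhd> G \<and> S \<subseteq> N}"

lemma (in group) normal_normal_closure:
  assumes "S \<subseteq> carrier G"
  shows "normal_closure G S \<lhd> G"
proof -
  have "carrier G \<lhd> G"
    by (rule normalI[OF subgroup_self]) (simp add: coset_join2 coset_join3 subgroup_self)
  with assms have ne: "{N. N \<lhd> G \<and> S \<subseteq> N} \<noteq> {}" by blast
  have "subgroup (normal_closure G S) G"
    unfolding normal_closure_def
    by (rule subgroups_Inter) (use ne in \<open>auto intro: normal_imp_subgroup\<close>)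
  moreover have "x \<otimes> h \<otimes> inv x \<in> normal_closure G S"
    if "x \<in> carrier G" "h \<in> normal_closure G S" for x h
    using that by (auto simp: normal_closure_def normal_inv_iff)
  ultimately show ?thesis by (simp add: normal_inv_iff)
qed

text \<open>The generators are all elements of the type \<open>'g\<close>; a pair \<open>(u, v)\<close> is the relation \<open>u = v\<close>.\<close>

definition presented_group :: "('g word set \<times> 'g word set) set \<Rightarrow> 'g word set set monoid" where
  "presented_group rels =
     free_group Mod
       normal_closure free_group {u \<otimes>\<^bsub>free_group\<^esub> inv\<^bsub>free_group\<^esub> v | u v. (u, v) \<in> rels}"

lemma group_presented_group:
  assumes "rels \<subseteq> carrier free_group \<times> carrier free_group"
  shows "group (presented_group rels)"
proof -
  interpret F: group free_group by (rule group_free_group)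
  show ?thesis
    unfolding presented_group_def
    by (intro normal.factorgroup_is_group F.normal_normal_closure) (use assms in auto)
qed


section \<open>Commutators, conjugates and the Macdonald group\<close>

definition commutator :: "('a, 'b) monoid_scheme \<Rightarrow> 'a \<Rightarrow> 'a \<Rightarrow> 'a" where
  "commutator G a b = inv\<^bsub>G\<^esub> a \<otimes>\<^bsub>G\<^esub> inv\<^bsub>G\<^esub> b \<otimes>\<^bsub>G\<^esub> a \<otimes>\<^bsub>G\<^esub> b"

definition conjugate_by :: "('a, 'b) monoid_scheme \<Rightarrow> 'a \<Rightarrow> 'a \<Rightarrow> 'a" where
  "conjugate_by G b a = inv\<^bsub>G\<^esub> a \<otimes>\<^bsub>G\<^esub> b \<otimes>\<^bsub>G\<^esub> a"

datatype macdonald_gen = gen_A | gen_B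

definition macdonald_group :: "int \<Rightarrow> macdonald_gen word set set monoid" where
  "macdonald_group \<alpha> =
     (let F = free_group; A = free_gen gen_A; B = free_gen gen_B in
      presented_group
        {(conjugate_by F A (commutator F A B), A [^]\<^bsub>F\<^esub> \<alpha>),
         (conjugate_by F B (commutator F B A), B [^]\<^bsub>F\<^esub> \<alpha>)})"


section \<open>Subgroups of a group\<close>

definition p_subgroup :: "nat \<Rightarrow> ('a, 'b) monoid_scheme \<Rightarrow> 'a set \<Rightarrow> bool" where
  "p_subgroup p G H \<longleftrightarrow> subgroup H G \<and> (\<forall>x\<in>H. \<exists>k. group.ord G x = p ^ k)"

text \<open>A Sylow subgroup is a maximal \<open>p\<close>-subgroup. In this form the notion, and the existence
  of such subgroups, does not depend on the finiteness of \<open>G\<close>.\<close>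

definition sylow_subgroup :: "nat \<Rightarrow> ('a, 'b) monoid_scheme \<Rightarrow> 'a set \<Rightarrow> bool" where
  "sylow_subgroup p G P \<longleftrightarrow>
     p_subgroup p G P \<and> (\<forall>Q. p_subgroup p G Q \<and> P \<subseteq> Q \<longrightarrow> Q = P)"

definition center :: "('a, 'b) monoid_scheme \<Rightarrow> 'a set" where
  "center G = {z \<in> carrier G. \<forall>x\<in>carrier G. z \<otimes>\<^bsub>G\<^esub> x = x \<otimes>\<^bsub>G\<^esub> z}"

fun upper_central :: "('a, 'b) monoid_scheme \<Rightarrow> nat \<Rightarrow> 'a set" where
  "upper_central G 0 = {\<one>\<^bsub>G\<^esub>}"
| "upper_central G (Suc i) =
     {x \<in> carrier G. upper_central G i #>\<^bsub>G\<^esub> x \<in> center (G Mod upper_central G i)}"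

definition power_subgroup :: "('a, 'b) monoid_scheme \<Rightarrow> int \<Rightarrow> 'a set" where
  "power_subgroup G n = generate G {t [^]\<^bsub>G\<^esub> n | t. t \<in> carrier G}"

text \<open>The value is \<open>0\<close> if there is no common finite exponent.\<close>

definition group_exponent :: "('a, 'b) monoid_scheme \<Rightarrow> nat" where
  "group_exponent G = Lcm (group.ord G ` carrier G)"


section \<open>The Heisenberg group\<close>

text \<open>Matrices are functions on index pairs, extensional outside \<open>{..<3} \<times> {..<3}\<close>.\<close>

definition heisenberg_group :: "('r, 'b) ring_scheme \<Rightarrow> (nat \<times> nat \<Rightarrow> 'r) monoid" where
  "heisenberg_group R =
     \<lparr>carrier = {M \<in> {..<3} \<times> {..<3} \<rightarrow>\<^sub>E carrier R.
                  (\<forall>i<3. M (i, i) = \<one>\<^bsub>R\<^esub>) \<and> (\<forall>i<3. \<forall>j<i. M (i, j) = \<zero>\<^bsub>R\<^esub>)},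
      monoid.mult = (\<lambda>M N. \<lambda>(i, j) \<in> {..<3} \<times> {..<3}.
                       \<Oplus>\<^bsub>R\<^esub>k\<in>{..<3}. M (i, k) \<otimes>\<^bsub>R\<^esub> N (k, j)),
      one = (\<lambda>(i, j) \<in> {..<3} \<times> {..<3}. if i = j then \<one>\<^bsub>R\<^esub> else \<zero>\<^bsub>R\<^esub>)\<rparr>"


section \<open>A presented abelian group\<close>

datatype xyz_gen = gen_X | gen_Y | gen_Z

definition abelian_xyz_group :: "nat \<Rightarrow> nat \<Rightarrow> xyz_gen word set set monoid" where
  "abelian_xyz_group p m =
     (let F = free_group; x = free_gen gen_X; y = free_gen gen_Y; z = free_gen gen_Z in
      presented_group
        {(x \<otimes>\<^bsub>F\<^esub> y, y \<otimes>\<^bsub>F\<^esub> x),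
         (y \<otimes>\<^bsub>F\<^esub> z, z \<otimes>\<^bsub>F\<^esub> y),
         (x \<otimes>\<^bsub>F\<^esub> z, z \<otimes>\<^bsub>F\<^esub> x),
         (x [^]\<^bsub>F\<^esub> (p ^ (2 * m)), \<one>\<^bsub>F\<^esub>),
         (x [^]\<^bsub>F\<^esub> (p ^ m) \<otimes>\<^bsub>F\<^esub> y [^]\<^bsub>F\<^esub> (p ^ m), \<one>\<^bsub>F\<^esub>),
         (z [^]\<^bsub>F\<^esub> (p ^ m), \<one>\<^bsub>F\<^esub>)})"

end

theory Submission
  imports Defs "HOL-Algebra.Bij" "HOL-Number_Theory.Pocklington"
begin

text \<open>Put \<open>D = [B, A]\<close>. The relations of the Macdonald group read \<open>D A = A\<^sup>\<alpha> D\<close>, \<open>B D = D B\<^sup>\<alpha>\<close> and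
  \<open>B A = A B D\<close>, so once \<open>A\<close> and \<open>B\<close> have finite order, every element is of the form
  \<open>A\<^sup>i D\<^sup>k B\<^sup>j\<close>. Moving powers of \<open>A\<close> and \<open>B\<close> past each other in two ways shows that the orders
  are finite. The group is then nilpotent, so it is the product of its primary parts, which are
  generated by powers of \<open>A\<close> and \<open>B\<close> and satisfy the same relations with \<open>\<alpha>\<close> replaced by a
  positive integer \<open>a\<close> congruent to it modulo the orders.

  In the \<open>p\<close>-part, with \<open>q = p\<^sup>m\<close>, the \<open>p\<close>-adic valuation of the exponent found above gives
  \<open>A\<^bsup>q\<^sup>3\<^esup> = 1\<close>, \<open>A\<^bsup>q\<^sup>2\<^esup> B\<^bsup>q\<^sup>2\<^esup> = 1\<close> and \<open>D\<^bsup>q\<^sup>2\<^esup> = 1\<close>; the condition for \<open>p = 3\<close> enters here.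
  These relations are the only ones between normal forms, because right multiplication on triples
  \<open>(i, k, j)\<close> modulo them defines permutations which satisfy the Macdonald relations. Everything
  else is read off from congruences between the exponents of normal forms: \<open>Z\<^sub>3(J)\<close>
  consists of the normal forms all of whose exponents are divisible by \<open>q\<close>, and \<open>Z(J)\<close> of the powers
  of \<open>A\<^bsup>q\<^sup>2\<^esup>\<close>.\<close>


section \<open>Iterated geometric sums\<close>

text \<open>Finiteness hangs on one integer, \<open>excess\<close>. Comparing the two ways gives x =
  A^(excess * \<alpha>^(n+1)) = B^(-excess) with n = |\<alpha>|. This x commutes with A and B, hence
  with their commutator D, whereas D x = x^\<alpha> D; so x^(\<alpha>-1) = 1, and the orders divide
  (\<alpha>-1) * excess * \<alpha>^(n+1).

  In the p-part, with e = a - 1, twice the excess is e^2 (1 - 2 C(a+1, 3)) modulo q^3. The bracket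
  is prime to p under the assumption on p = 3, and then the three factors have valuations m, 2m and
  0, which is where q^3 comes from.

  A presentation yields only upper bounds of this kind. That nothing collapses further needs a
  concrete group, and checking that the permutations satisfy the relations is the laborious part: a
  - 1 is not invertible modulo p, so the sums a + ... + a^n are expanded in powers of e up to e^2,
  and the denominator 6 of the binomials is not prime to p when p = 3.\<close>

primrec geo :: "nat \<Rightarrow> nat \<Rightarrow> nat" where
  "geo a 0 = 0"
| "geo a (Suc n) = a * (1 + geo a n)"

lemma geo_add: "geo a (x + y) = geo a x + a ^ x * geo a y"
  by (induction x) (auto simp: algebra_simps)

lemma geo_mult_pred: "(int a - 1) * int (geo a n) = int a * (int a ^ n - 1)"
  by (induction n) (auto simp: algebra_simps)

text \<open>The iterates of \<open>geo a\<close> and their partial sums describe the right action of powers of the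
  first generator on normal forms.\<close>

definition geo_iter :: "nat \<Rightarrow> nat \<Rightarrow> nat \<Rightarrow> nat" where "geo_iter a l y = (geo a ^^ l) y"

definition geo_iter_sum :: "nat \<Rightarrow> nat \<Rightarrow> nat \<Rightarrow> nat" where
  "geo_iter_sum a n y = (\<Sum>l<n. geo_iter a l y)"

lemma geo_iter_0 [simp]: "geo_iter a 0 y = y"
  and geo_iter_Suc: "geo_iter a (Suc l) y = geo a (geo_iter a l y)"
  by (auto simp: geo_iter_def)

lemma geo_iter_sum_0 [simp]: "geo_iter_sum a 0 y = 0"
  and geo_iter_sum_Suc: "geo_iter_sum a (Suc l) y = geo_iter_sum a l y + geo_iter a l y"
  by (auto simp: geo_iter_sum_def)

section \<open>Binomial expansions of powers and geometric sums\<close>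

lemma two_choose_two: "2 * int (n choose 2) = int n * (int n - 1)"
  by (induction n) (auto simp: numeral_2_eq_2 algebra_simps)

lemma six_choose_three: "6 * int (n choose 3) = int n * (int n - 1) * (int n - 2)"
proof (induction n)
  case (Suc n)
  have "6 * int (Suc n choose 3) = 6 * int (n choose 3) + 3 * (2 * int (n choose 2))"
    by (simp add: numeral_3_eq_3 numeral_2_eq_2)
  with Suc show ?case by (simp add: two_choose_two algebra_simps)
qed simp

lemma sum_id_choose: "(\<Sum>l<n. int l) = int (n choose 2)"
  by (induction n) (auto simp: numeral_2_eq_2)

lemma sum_choose_two: "(\<Sum>l<n. int (l choose 2)) = int (n choose 3)"
  by (induction n) (auto simp: numeral_2_eq_2 numeral_3_eq_3)

text \<open>Binomial theorem for (1 + (a - 1))^n, cut off before the cube. In the induction the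
  error of a step is exactly C(n, 2) (a - 1)^3.\<close>

lemma power_expansion:
  "[int a ^ n = 1 + int n * (int a - 1) + int (n choose 2) * (int a - 1)^2] (mod (int a - 1)^3)"
proof (induction n)
  case (Suc n)
  have "[int a * int a ^ n = int a * (1 + int n * (int a - 1) + int (n choose 2) * (int a - 1)^2)]
    (mod (int a - 1)^3)"
    by (intro cong_mult cong_refl Suc)
  also have "[int a * (1 + int n * (int a - 1) + int (n choose 2) * (int a - 1)^2)
      = 1 + int (Suc n) * (int a - 1) + int (Suc n choose 2) * (int a - 1)^2] (mod (int a - 1)^3)"
    unfolding cong_iff_dvd_diff
    by (rule dvdI[of _ _ "int (n choose 2)"]) (simp add: numeral_2_eq_2 numeral_3_eq_3 algebra_simps)
  finally show ?case by simp
qed (simp add: numeral_2_eq_2)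

text \<open>Summing the expansion of a^l over l = 1, ..., n raises both entries of each binomial
  coefficient, by the hockey-stick identity. The error of an induction step is exactly C(n + 1, 3)
  (a - 1)^3.\<close>

lemma geo_expansion:
  "[int (geo a n) = int n + int (Suc n choose 2) * (int a - 1) + int (Suc n choose 3) * (int a - 1)^2]
    (mod (int a - 1)^3)"
proof (induction n)
  case (Suc n)
  have "[int a * (1 + int (geo a n)) =
     int a * (1 + (int n + int (Suc n choose 2) * (int a - 1) + int (Suc n choose 3) * (int a - 1)^2))]
    (mod (int a - 1)^3)"
    by (intro cong_mult cong_add cong_refl Suc)
  also have "[int a * (1 + (int n + int (Suc n choose 2) * (int a - 1) + int (Suc n choose 3) * (int a - 1)^2))
      = int (Suc n) + int (Suc (Suc n) choose 2) * (int a - 1)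
        + int (Suc (Suc n) choose 3) * (int a - 1)^2] (mod (int a - 1)^3)"
    unfolding cong_iff_dvd_diff
    by (rule dvdI[of _ _ "int (Suc n choose 3)"])
      (simp add: numeral_2_eq_2 numeral_3_eq_3 algebra_simps)
  finally show ?case by (simp only: geo.simps of_nat_mult of_nat_add of_nat_1)
qed (simp add: numeral_2_eq_2 numeral_3_eq_3)

text \<open>The arithmetic shared by the permutation model and the p-part. The exact valuation of
  \<open>e\<close> enters later, where orders and centralizers are determined.\<close>

locale mac_arith =
  fixes p m a :: nat and q e :: int
  assumes p: "prime p" "p > 2" and m: "m > 0" and a: "a > 0"
    and q_def: "q = int p ^ m" and e_def: "e = int a - 1" and q_dvd_e: "q dvd e"
begin

lemma int_a: "int a = 1 + e" by (simp add: e_def)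

lemma q_pos: "q > 0" and q_gt2: "q > 2"
proof -
  show "q > 0" unfolding q_def using p by (simp add: prime_gt_0_nat)
  have "int p ^ 1 \<le> int p ^ m" using p m by (intro power_increasing) auto
  moreover have "int p ^ 1 > 2" using p by simp
  ultimately show "q > 2" unfolding q_def by linarith
qed

lemma coprime_two: "coprime 2 (q ^ k)"
proof -
  have "coprime 2 p" using p by (intro primes_coprime) auto
  then show ?thesis unfolding q_def
    by (metis coprime_int_iff coprime_power_right_iff of_nat_numeral)
qed

lemma cancel_two: "[2 * x = 2 * y] (mod q ^ k) \<Longrightarrow> [x = y] (mod q ^ k)"
  using cong_mult_lcancel[OF coprime_two[of k], of x y] by simp

lemma cancel_two1: "[2 * x = 2 * y] (mod q) \<Longrightarrow> [x = y] (mod q)"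
  using cancel_two[of x y 1] by simp

text \<open>A modulus that makes division by six harmless even when \<open>p = 3\<close>.\<close>

definition r :: int where "r = (if p = 3 then 3 * q else q)"

text \<open>For p = 3 the factor 3 of the 6 is cancelled against the extra 3 in the modulus; for
  other p it is a unit. The factor 2 is always a unit because p is odd.\<close>

lemma cancel_six:
  assumes "[6 * x = 6 * y] (mod r)"
  shows "[x = y] (mod q)"
proof (cases "p = 3")
  case True
  have "6 * x - 6 * y = 3 * (2 * x - 2 * y)" by simp
  then have "3 * q dvd 3 * (2 * x - 2 * y)"
    using assms True unfolding r_def cong_iff_dvd_diff by simp
  then have "[2 * x = 2 * y] (mod q)" unfolding cong_iff_dvd_diff by (subst (asm) dvd_mult_cancel_left) simp
  then show ?thesis by (rule cancel_two1)
next
  case False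
  have "coprime 3 p" using p False by (intro primes_coprime) auto
  then have "coprime 3 q" unfolding q_def
    by (metis coprime_int_iff coprime_power_right_iff of_nat_numeral)
  moreover have "[3 * (2 * x) = 3 * (2 * y)] (mod q)" using assms False by (simp add: r_def)
  ultimately have "[2 * x = 2 * y] (mod q)" using cong_mult_lcancel by blast
  then show ?thesis by (rule cancel_two1)
qed

lemma r_dvd_q2: "r dvd q ^ 2"
proof (cases "p = 3")
  case True
  then have "3 dvd q" using m by (simp add: q_def)
  then show ?thesis using True unfolding r_def power2_eq_square by simp
next
  case False
  then show ?thesis by (simp add: r_def power2_eq_square)
qed

lemma r_dvd_3q: "r dvd 3 * q" by (simp add: r_def)

lemma q2_dvd_e2: "q ^ 2 dvd e ^ 2" and q3_dvd_e3: "q ^ 3 dvd e ^ 3"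
  using q_dvd_e by (auto intro: dvd_power_same)

text \<open>A factor \<open>e\<close> buys a factor q of the modulus: in a congruence modulo q^3 the
  coefficient of e is needed modulo q^2 and that of e^2 modulo q.\<close>

lemma cong_e: "[x = y] (mod q ^ k) \<Longrightarrow> [e * x = e * y] (mod q ^ Suc k)"
  using q_dvd_e by (simp add: cong_iff_dvd_diff flip: right_diff_distrib) (rule mult_dvd_mono)

lemma cong_q2I: "[x = y] (mod q ^ 3) \<Longrightarrow> [x = y] (mod q ^ 2)"
  by (rule cong_dvd_modulus) (auto intro: le_imp_power_dvd)

lemma cong_q2D: "[x = y] (mod q ^ 2) \<Longrightarrow> [x = y] (mod q)"
  by (rule cong_dvd_modulus) (auto simp: power2_eq_square)

lemma cong_e2: "[x = y] (mod q) \<Longrightarrow> [e^2 * x = e^2 * y] (mod q ^ 3)"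
  using cong_e[OF cong_e[of x y 1]] by (simp add: power2_eq_square power3_eq_cube mult.assoc numeral_3_eq_3)

lemma power_cong: "[int a ^ n = 1 + int n * e + int (n choose 2) * e^2] (mod q ^ 3)"
  using power_expansion[of a n] q3_dvd_e3 by (auto simp flip: e_def intro: cong_dvd_modulus)

lemma geo_cong:
  "[int (geo a n) = int n + int (Suc n choose 2) * e + int (Suc n choose 3) * e^2] (mod q ^ 3)"
  using geo_expansion[of a n] q3_dvd_e3 by (auto simp flip: e_def intro: cong_dvd_modulus)

lemma geo_cong2: "[int (geo a n) = int n + int (Suc n choose 2) * e] (mod q ^ 2)"
proof -
  have "[int (Suc n choose 3) * e^2 = 0] (mod q^2)"
    using q2_dvd_e2 by (simp add: cong_0_iff)
  from cong_add[OF cong_refl this, of "int n + int (Suc n choose 2) * e"]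
  have "[int n + int (Suc n choose 2) * e + int (Suc n choose 3) * e^2 =
     int n + int (Suc n choose 2) * e] (mod q^2)" by simp
  with cong_q2I[OF geo_cong[of n]] show ?thesis by (rule cong_trans)
qed

section \<open>Iterates of the geometric sum modulo powers of q\<close>

abbreviation it :: "nat \<Rightarrow> nat \<Rightarrow> nat" where "it \<equiv> geo_iter a"

abbreviation its :: "nat \<Rightarrow> nat \<Rightarrow> nat" where "its \<equiv> geo_iter_sum a"

lemma two_C: "2 * int (Suc y choose 2) = int y * (int y + 1)"
  using two_choose_two[of "Suc y"] by (simp add: algebra_simps)

lemma six_C: "6 * int (Suc y choose 3) = (int y + 1) * int y * (int y - 1)"
  using six_choose_three[of "Suc y"] by (simp add: algebra_simps)

lemma C2_cong:
  assumes "[int y = int y'] (mod q ^ k)"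
  shows "[int (Suc y choose 2) = int (Suc y' choose 2)] (mod q ^ k)"
proof (rule cancel_two)
  show "[2 * int (Suc y choose 2) = 2 * int (Suc y' choose 2)] (mod q ^ k)"
    unfolding two_C by (intro cong_mult cong_add cong_refl assms)
qed

text \<open>To first order \<open>geo a y\<close> is y + e C(y + 1, 2). Every iterate is congruent
  to y modulo q, so each of the l steps adds the same increment modulo q^2.\<close>

lemma it_cong2: "[int (it l y) = int y + int l * (e * int (Suc y choose 2))] (mod q ^ 2)"
proof (induction l)
  case (Suc l)
  define c where "c = int (Suc y choose 2)"
  have IH: "[int (it l y) = int y + int l * (e * c)] (mod q ^ 2)" using Suc by (simp add: c_def)
  have "[int y + int l * (e * c) = int y + 0] (mod q)"
    using q_dvd_e by (intro cong_add cong_refl) (simp add: cong_0_iff)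
  from cong_trans[OF cong_q2D[OF IH] this] have "[int (it l y) = int y] (mod q)" by simp
  then have "[int (Suc (it l y) choose 2) = c] (mod q)"
    using C2_cong[of "it l y" y 1] by (simp add: c_def)
  then have "[e * int (Suc (it l y) choose 2) = e * c] (mod q^2)"
    using cong_e[of _ _ 1] by (simp add: numeral_2_eq_2)
  then have "[int (it l y) + e * int (Suc (it l y) choose 2) = int y + int l * (e * c) + e * c] (mod q^2)"
    by (intro cong_add IH)
  moreover have "[int (it (Suc l) y) = int (it l y) + e * int (Suc (it l y) choose 2)] (mod q^2)"
    using geo_cong2[of "it l y"] by (simp add: geo_iter_Suc mult.commute)
  ultimately have "[int (it (Suc l) y) = int y + int l * (e * c) + e * c] (mod q^2)"
    by (rule cong_trans[rotated])
  then show ?case by (simp add: c_def algebra_simps)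
qed simp

lemma it_cong1: "[int (it l y) = int y] (mod q)"
proof -
  have "[int y + int l * (e * int (Suc y choose 2)) = int y + 0] (mod q)"
    using q_dvd_e by (intro cong_add cong_refl) (simp add: cong_0_iff)
  from cong_trans[OF cong_q2D[OF it_cong2[of l y]] this] show ?thesis by simp
qed

lemma its_cong2:
  "[int (its n y) = int n * int y + int (n choose 2) * (e * int (Suc y choose 2))] (mod q ^ 2)"
proof -
  have "[(\<Sum>l<n. int (it l y)) = (\<Sum>l<n. int y + int l * (e * int (Suc y choose 2)))] (mod q^2)"
    by (intro cong_sum it_cong2)
  also have "(\<Sum>l<n. int y + int l * (e * int (Suc y choose 2)))
      = int n * int y + int (n choose 2) * (e * int (Suc y choose 2))"
    by (simp add: sum.distrib sum_id_choose flip: sum_distrib_right)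
  finally show ?thesis by (simp add: geo_iter_sum_def)
qed

lemma its_cong1: "[int (its n y) = int n * int y] (mod q)"
proof -
  have "[int n * int y + int (n choose 2) * (e * int (Suc y choose 2)) = int n * int y + 0] (mod q)"
    using q_dvd_e by (intro cong_add cong_refl) (simp add: cong_0_iff)
  from cong_trans[OF cong_q2D[OF its_cong2[of n y]] this] show ?thesis by simp
qed

text \<open>The assumption holds for n = a, n = q and n = q^3. It makes e C(n, 2) vanish modulo q^2,
  which removes the terms that grow with the number of iterations squared.\<close>

context
  fixes n :: nat
  assumes qn: "q dvd int (n choose 2)"
begin

lemma e_choose: "q^2 dvd e * int (n choose 2)"
  using q_dvd_e qn by (simp add: power2_eq_square mult_dvd_mono)

lemma its_cong2': "[int (its n y) = int n * int y] (mod q ^ 2)"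
proof -
  have "[int n * int y + int (n choose 2) * (e * int (Suc y choose 2)) = int n * int y + 0] (mod q^2)"
    using dvd_mult2[OF e_choose, of "int (Suc y choose 2)"]
    by (intro cong_add cong_refl) (simp add: cong_0_iff mult_ac)
  from cong_trans[OF its_cong2[of n y] this] show ?thesis by simp
qed

text \<open>The deviations \<open>\<delta> l\<close> of the iterates from y are divisible by q, and
  their sum over l < n is e C(n, 2) c modulo q^2, that is 0. So in the sum of all increments the
  binomials of the iterates may be replaced by those of y.\<close>

lemma it_cong3:
  "[int (it n y) = int y + int n * (e * int (Suc y choose 2)) + int n * (e^2 * int (Suc y choose 3))]
    (mod q ^ 3)"
proof -
  define \<delta> where "\<delta> l = int (it l y) - int y" for l
  define c where "c = int (Suc y choose 2)"
  have it: "int (it l y) = int y + \<delta> l" for l by (simp add: \<delta>_def)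
  have \<delta>2: "[\<delta> l = int l * (e * c)] (mod q^2)" for l
    using cong_diff[OF it_cong2[of l y] cong_refl[of "int y"]] by (simp add: \<delta>_def c_def)
  have \<delta>1: "q dvd \<delta> l" for l
    using it_cong1[of l y] by (simp add: \<delta>_def cong_iff_dvd_diff)
  have \<delta>\<delta>: "q^2 dvd (\<delta> l)^2" for l using \<delta>1 by (rule dvd_power_same)
  have "[(\<Sum>l<n. \<delta> l) = (\<Sum>l<n. int l * (e * c))] (mod q^2)" by (intro cong_sum \<delta>2)
  also have "(\<Sum>l<n. int l * (e * c)) = e * int (n choose 2) * c"
    by (simp add: sum_id_choose flip: sum_distrib_right)
  also have "[e * int (n choose 2) * c = 0] (mod q^2)"
    using e_choose by (simp add: cong_0_iff)
  finally have sum\<delta>: "q^2 dvd (\<Sum>l<n. \<delta> l)" by (simp add: cong_0_iff)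
  have sum\<delta>2: "q^2 dvd (\<Sum>l<n. (\<delta> l)^2)" by (intro dvd_sum \<delta>\<delta>)
  have sum\<delta>3: "q^2 dvd (\<Sum>l<n. (\<delta> l)^3)"
    by (intro dvd_sum dvd_trans[OF \<delta>\<delta> le_imp_power_dvd]) simp
  have A: "[(\<Sum>l<n. int (Suc (it l y) choose 2)) = int n * c] (mod q^2)"
  proof (rule cancel_two)
    have "2 * (\<Sum>l<n. int (Suc (it l y) choose 2)) = (\<Sum>l<n. 2 * c + \<delta> l * (2 * int y + 1) + (\<delta> l)^2)"
      unfolding sum_distrib_left c_def two_C it
      by (intro sum.cong HOL.refl) (simp add: algebra_simps power2_eq_square)
    also have "\<dots> = 2 * (int n * c) + ((\<Sum>l<n. \<delta> l) * (2 * int y + 1) + (\<Sum>l<n. (\<delta> l)^2))"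
      by (simp add: sum.distrib sum_distrib_right)
    finally have "2 * (\<Sum>l<n. int (Suc (it l y) choose 2)) - 2 * (int n * c) =
      (\<Sum>l<n. \<delta> l) * (2 * int y + 1) + (\<Sum>l<n. (\<delta> l)^2)" by simp
    then show "[2 * (\<Sum>l<n. int (Suc (it l y) choose 2)) = 2 * (int n * c)] (mod q^2)"
      unfolding cong_iff_dvd_diff using sum\<delta> sum\<delta>2 by simp
  qed
  have B: "[(\<Sum>l<n. int (Suc (it l y) choose 3)) = int n * int (Suc y choose 3)] (mod q)"
  proof (rule cancel_six)
    \<comment> \<open>The summand is a cubic polynomial in \<open>\<delta> l\<close>. The sums of
      its first three powers vanish modulo q^2, a multiple of \<open>r\<close>, so the 6 can be
      cancelled even for p = 3.\<close>
    have "6 * (\<Sum>l<n. int (Suc (it l y) choose 3)) =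
        (\<Sum>l<n. 6 * int (Suc y choose 3) + \<delta> l * (3 * int y^2 - 1) + (\<delta> l)^2 * (3 * int y) + (\<delta> l)^3)"
      unfolding sum_distrib_left six_C it
      by (intro sum.cong HOL.refl) (simp add: algebra_simps power2_eq_square power3_eq_cube)
    also have "\<dots> = 6 * (int n * int (Suc y choose 3)) + ((\<Sum>l<n. \<delta> l) * (3 * int y^2 - 1)
       + (\<Sum>l<n. (\<delta> l)^2) * (3 * int y) + (\<Sum>l<n. (\<delta> l)^3))"
      by (simp add: sum.distrib sum_distrib_right)
    finally have "6 * (\<Sum>l<n. int (Suc (it l y) choose 3)) - 6 * (int n * int (Suc y choose 3)) =
      (\<Sum>l<n. \<delta> l) * (3 * int y^2 - 1) + (\<Sum>l<n. (\<delta> l)^2) * (3 * int y) + (\<Sum>l<n. (\<delta> l)^3)" by simp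
    then have "q^2 dvd 6 * (\<Sum>l<n. int (Suc (it l y) choose 3)) - 6 * (int n * int (Suc y choose 3))"
      using sum\<delta> sum\<delta>2 sum\<delta>3 by simp
    with r_dvd_q2 show "[6 * (\<Sum>l<n. int (Suc (it l y) choose 3)) = 6 * (int n * int (Suc y choose 3))] (mod r)"
      unfolding cong_iff_dvd_diff by (rule dvd_trans)
  qed
  have step: "[int (it k y) = int y + (\<Sum>l<k. e * int (Suc (it l y) choose 2))
      + (\<Sum>l<k. e^2 * int (Suc (it l y) choose 3))] (mod q^3)" for k
  proof (induction k)
    case (Suc k)
    have "[int (it (Suc k) y) = int (it k y) + e * int (Suc (it k y) choose 2)
      + e^2 * int (Suc (it k y) choose 3)] (mod q^3)"
      using geo_cong[of "it k y"] by (simp add: geo_iter_Suc mult.commute)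
    also have "[int (it k y) + e * int (Suc (it k y) choose 2) + e^2 * int (Suc (it k y) choose 3)
      = (int y + (\<Sum>l<k. e * int (Suc (it l y) choose 2)) + (\<Sum>l<k. e^2 * int (Suc (it l y) choose 3)))
        + e * int (Suc (it k y) choose 2) + e^2 * int (Suc (it k y) choose 3)] (mod q^3)"
      by (intro cong_add cong_refl Suc)
    finally show ?case by (simp add: algebra_simps)
  qed simp
  have "[int (it n y) = int y + e * (\<Sum>l<n. int (Suc (it l y) choose 2))
      + e^2 * (\<Sum>l<n. int (Suc (it l y) choose 3))] (mod q^3)"
    using step[of n] by (simp add: sum_distrib_left)
  also have "[int y + e * (\<Sum>l<n. int (Suc (it l y) choose 2))
      + e^2 * (\<Sum>l<n. int (Suc (it l y) choose 3)) =
      int y + e * (int n * c) + e^2 * (int n * int (Suc y choose 3))] (mod q^3)"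
    using cong_e[OF A] cong_e2[OF B] by (intro cong_add cong_refl) (auto simp: numeral_3_eq_3 numeral_2_eq_2)
  finally show ?thesis by (simp add: c_def algebra_simps)
qed

text \<open>In a^s = 1 + s e + C(s, 2) e^2 the partial sums s = \<open>its l y\<close> are needed
  modulo q^2 in the linear term and only modulo q in the quadratic one, where s may be replaced by l
  y.\<close>

lemma sum_power_its_cong:
  "[(\<Sum>l<n. int a ^ its l y) = int n + e * int y * int (n choose 2)
     + e^2 * (int (n choose 3) * (int (Suc y choose 2) + int y^2))] (mod q ^ 3)"
proof -
  define c where "c = int (Suc y choose 2)"
  have A: "[e * int (its l y) = e * (int l * int y) + e^2 * (int (l choose 2) * c)] (mod q^3)" for l
    using cong_e[OF its_cong2[of l y]]
    by (simp add: c_def algebra_simps power2_eq_square numeral_3_eq_3)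
  have B: "[e^2 * int (its l y choose 2) = e^2 * int ((l * y) choose 2)] (mod q^3)" for l
  proof (rule cong_e2, rule cancel_two1)
    have "[int (its l y) = int (l * y)] (mod q)" using its_cong1[of l y] by simp
    then show "[2 * int (its l y choose 2) = 2 * int ((l * y) choose 2)] (mod q)"
      unfolding two_choose_two by (intro cong_mult cong_diff cong_refl)
  qed
  have D: "[(\<Sum>l<n. int ((l * y) choose 2)) = int (n choose 3) * int y^2] (mod q)"
  proof (rule cancel_two1)
    \<comment> \<open>The remainder l (y^2 - y) is linear in l, so its sum carries the factor C(n,
      2), which q divides.\<close>
    have "2 * (\<Sum>l<n. int ((l * y) choose 2))
       = (\<Sum>l<n. 2 * (int (l choose 2) * int y^2) + int l * (int y^2 - int y))"
      unfolding sum_distrib_left two_choose_two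
    proof (rule sum.cong[OF HOL.refl])
      fix l
      have "2 * (int (l choose 2) * int y^2) = int l * (int l - 1) * int y^2"
        using two_choose_two[of l] by simp
      then show "int (l * y) * (int (l * y) - 1) =
         2 * (int (l choose 2) * int y^2) + int l * (int y^2 - int y)"
        by (simp add: algebra_simps power2_eq_square)
    qed
    also have "\<dots> = 2 * (int (n choose 3) * int y^2) + int (n choose 2) * (int y^2 - int y)"
      by (simp add: sum.distrib sum_id_choose sum_choose_two flip: sum_distrib_right sum_distrib_left)
    finally show "[2 * (\<Sum>l<n. int ((l * y) choose 2)) = 2 * (int (n choose 3) * int y^2)] (mod q)"
      unfolding cong_iff_dvd_diff using qn by simp
  qed
  have "[(\<Sum>l<n. int a ^ its l y) = (\<Sum>l<n. 1 + int (its l y) * e + int (its l y choose 2) * e^2)] (mod q^3)"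
    by (intro cong_sum power_cong)
  also have "[(\<Sum>l<n. 1 + int (its l y) * e + int (its l y choose 2) * e^2) =
     (\<Sum>l<n. 1 + (e * (int l * int y) + e^2 * (int (l choose 2) * c)) + e^2 * int ((l * y) choose 2))] (mod q^3)"
    using A B by (intro cong_sum cong_add cong_refl) (auto simp: mult.commute)
  also have "(\<Sum>l<n. 1 + (e * (int l * int y) + e^2 * (int (l choose 2) * c)) + e^2 * int ((l * y) choose 2))
    = int n + e * int y * int (n choose 2) + e^2 * (int (n choose 3) * c)
      + e^2 * (\<Sum>l<n. int ((l * y) choose 2))"
    by (simp add: sum.distrib sum_id_choose sum_choose_two flip: sum_distrib_right sum_distrib_left)
  also have "[int n + e * int y * int (n choose 2) + e^2 * (int (n choose 3) * c)
      + e^2 * (\<Sum>l<n. int ((l * y) choose 2)) =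
      int n + e * int y * int (n choose 2) + e^2 * (int (n choose 3) * c)
      + e^2 * (int (n choose 3) * int y^2)] (mod q^3)"
    by (intro cong_add cong_refl cong_e2 D)
  finally show ?thesis by (simp add: c_def algebra_simps)
qed

lemma sum_power_its_cong2: "[(\<Sum>l<n. int a ^ its l y) = int n] (mod q ^ 2)"
proof -
  have "[int n + e * int y * int (n choose 2) + e^2 * (int (n choose 3) * (int (Suc y choose 2) + int y^2))
     = int n + 0 + 0] (mod q^2)"
    using dvd_mult2[OF e_choose, of "int y"] q2_dvd_e2
    by (intro cong_add cong_refl) (auto simp: cong_0_iff mult_ac)
  then have "[int n + e * int y * int (n choose 2) + e^2 * (int (n choose 3) * (int (Suc y choose 2) + int y^2))
     = int n] (mod q^2)" by simp
  with cong_q2I[OF sum_power_its_cong[of y]] show ?thesis by (rule cong_trans)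
qed

end

end

context mac_arith
begin

lemma dvd_choose_two:
  assumes "q dvd int n * (int n - 1)"
  shows "q dvd int (n choose 2)"
proof -
  have "[2 * int (n choose 2) = 2 * 0] (mod q)"
    using assms by (simp add: two_choose_two cong_0_iff)
  from cancel_two1[OF this] show ?thesis by (simp add: cong_0_iff)
qed

lemma dvd_choose_two': "q dvd int n \<Longrightarrow> q dvd int (n choose 2)"
  by (intro dvd_choose_two dvd_mult2)

lemma dvd_choose_two_a: "q dvd int (a choose 2)"
  using q_dvd_e by (intro dvd_choose_two dvd_mult) (simp add: e_def)

lemma q2_dvd_nq: "q dvd n \<Longrightarrow> q ^ 2 dvd n * e"
  using q_dvd_e by (simp add: power2_eq_square mult_dvd_mono)

lemma power_cong_1:
  assumes "q^2 dvd int n"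
  shows "[int a ^ n = 1] (mod q ^ 3)"
proof -
  have "q dvd int n" using assms by (meson dvd_trans dvd_power pos2)
  then have "[e^2 * int (n choose 2) = e^2 * 0] (mod q^3)"
    by (intro cong_e2) (simp add: dvd_choose_two' cong_0_iff)
  then have 1: "[int (n choose 2) * e^2 = 0] (mod q^3)" by (simp add: mult.commute)
  have 2: "[int n * e = 0] (mod q^3)"
    using mult_dvd_mono[OF assms q_dvd_e] by (simp add: cong_0_iff power3_eq_cube power2_eq_square)
  have "[1 + int n * e + int (n choose 2) * e^2 = 1 + 0 + 0] (mod q^3)"
    by (intro cong_add cong_refl 1 2)
  from cong_trans[OF power_cong[of n] this] show ?thesis by simp
qed

text \<open>Conjugation by D^k multiplies exponents of A by a^k. This congruence is why the exponent
  of D acts only through its residue modulo q^2 once A^(q^3) = 1.\<close>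

lemma power_cong_mod_q2:
  assumes "[z = z'] (mod nat (q^2))"
  shows "[int a ^ z = int a ^ z'] (mod q ^ 3)"
proof -
  have *: "[int a ^ x = int a ^ y] (mod q ^ 3)" if h: "[x = y] (mod nat (q^2))" and le: "x \<le> y" for x y
  proof -
    obtain k where k: "y = x + k * nat (q^2)"
      using cong_le_nat[OF le, of "nat (q^2)"] cong_sym[OF h] by (auto simp: add.commute)
    have "q^2 dvd int (k * nat (q^2))" using q_pos by simp
    from cong_mult[OF cong_refl[of "int a ^ x"] cong_sym[OF power_cong_1[OF this]]]
    show ?thesis by (simp add: k power_add)
  qed
  show ?thesis using *[of z z'] *[of z' z] assms by (cases "z \<le> z'") (auto intro: cong_sym)
qed

lemma power_cong2: "[int a ^ n = 1 + int n * e] (mod q ^ 2)"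
proof -
  have "[1 + int n * e + int (n choose 2) * e^2 = 1 + int n * e + 0] (mod q^2)"
    using q2_dvd_e2 by (intro cong_add cong_refl) (simp add: cong_0_iff)
  from cong_trans[OF cong_q2I[OF power_cong[of n]] this] show ?thesis by simp
qed

lemma power_cong_1_q: "[int a ^ n = 1] (mod q)"
proof -
  have "[int a ^ n = 1 ^ n] (mod q)"
    using q_dvd_e by (intro cong_pow) (simp add: e_def cong_iff_dvd_diff)
  then show ?thesis by simp
qed

lemma mult_power_cong: "q^2 dvd x \<Longrightarrow> [int a ^ n * x = x] (mod q ^ 3)"
  using mult_dvd_mono[of q "int a ^ n - 1" "q^2" x] power_cong_1_q[of n]
  by (simp add: cong_iff_dvd_diff power3_eq_cube power2_eq_square algebra_simps)

text \<open>Both C(n + 1, 2) and C(n + 1, 3) contain the factor n up to their denominators. As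
  \<open>r\<close> divides q^2, the division by 6 still leaves a multiple of q when p = 3.\<close>

lemma geo_cong_self:
  assumes "q^2 dvd int n"
  shows "[int (geo a n) = int n] (mod q ^ 3)"
proof -
  have 2: "[2 * int (Suc n choose 2) = 2 * 0] (mod q^2)"
    unfolding two_C using assms by (simp add: cong_0_iff)
  have 1: "[e * int (Suc n choose 2) = e * 0] (mod q^3)"
    using cong_e[OF cancel_two[OF 2]] by (simp add: numeral_3_eq_3 numeral_2_eq_2)
  have "r dvd int n" using assms r_dvd_q2 dvd_trans by blast
  then have 3: "[6 * int (Suc n choose 3) = 6 * 0] (mod r)"
    unfolding six_C by (simp add: cong_0_iff)
  have 4: "[e^2 * int (Suc n choose 3) = e^2 * 0] (mod q^3)"
    by (intro cong_e2 cancel_six[OF 3])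
  have "[int n + int (Suc n choose 2) * e + int (Suc n choose 3) * e^2 = int n + 0 + 0] (mod q^3)"
    using 1 4 by (intro cong_add cong_refl) (simp_all add: mult.commute)
  from cong_trans[OF geo_cong[of n] this] show ?thesis by simp
qed

lemma geo_cong_q: "[int (geo a n) = int n] (mod q)"
proof -
  have "[int n + int (Suc n choose 2) * e = int n + 0] (mod q)"
    using q_dvd_e by (intro cong_add cong_refl) (simp add: cong_0_iff)
  from cong_trans[OF cong_q2D[OF geo_cong2[of n]] this] show ?thesis by simp
qed

text \<open>This congruence is the reason why the model below satisfies the relation between the first
  generator and the commutator.\<close>

lemma sum_power_its_a:
  "[(\<Sum>l<a. int a ^ its l y) - int a = int a * int (it a y) - int (geo a (a * y))] (mod q ^ 3)"
proof -
  define c where "c = int (Suc y choose 2)"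
  define t where "t = int (Suc y choose 3)"
  define Y where "Y = int y"
  define E2 where "E2 = e * Y"
  have c2: "2 * c = Y * (Y + 1)" by (simp add: c_def two_C Y_def)
  have t6: "6 * t = (Y + 1) * Y * (Y - 1)" by (simp add: t_def six_C Y_def)
  have ay: "int (a * y) = Y + e * Y" by (simp add: int_a Y_def algebra_simps)
  define u where "u = int (Suc (a * y) choose 2)"
  define v where "v = int (Suc (a * y) choose 3)"
  define s where "s = int (a choose 3)"
  define d where "d = int (a choose 2)"
  have u2: "2 * u = (Y + e * Y) * (Y + e * Y + 1)"
    using two_C[of "a * y"] unfolding u_def ay .
  have v6: "6 * v = (Y + e * Y + 1) * (Y + e * Y) * (Y + e * Y - 1)"
    using six_C[of "a * y"] unfolding v_def ay .
  have d2: "2 * d = (1 + e) * e" using two_choose_two[of a] by (simp add: d_def int_a)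
  have s6: "6 * s = (1 + e) * e * (e - 1)"
    using six_choose_three[of a] by (simp add: s_def int_a)
  have e3: "[x * e^3 = 0] (mod q^3)" for x using q3_dvd_e3 by (simp add: cong_0_iff)
  have L: "[(\<Sum>l<a. int a ^ its l y) - int a = e * Y * d + e^2 * (s * (c + Y^2))] (mod q^3)"
    using cong_diff[OF sum_power_its_cong[OF dvd_choose_two_a, of y] cong_refl[of "int a"]]
    by (simp add: c_def s_def d_def Y_def)
  have R: "[int a * int (it a y) - int (geo a (a * y)) =
      (1 + e) * (Y + (1 + e) * (e * c) + (1 + e) * (e^2 * t)) - (Y + e * Y + u * e + v * e^2)] (mod q^3)"
    using it_cong3[OF dvd_choose_two_a, of y] geo_cong[of "a * y"]
    unfolding ay Y_def[symmetric] c_def[symmetric] t_def[symmetric] u_def[symmetric] v_def[symmetric]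
      int_a by (intro cong_diff cong_mult cong_refl)
  have M: "[e * Y * d + e^2 * (s * (c + Y^2)) =
      (1 + e) * (Y + (1 + e) * (e * c) + (1 + e) * (e^2 * t)) - (Y + e * Y + u * e + v * e^2)] (mod q^3)"
  proof -
    \<comment> \<open>The part with a single explicit e: after doubling it is zero as a polynomial
      in e and Y.\<close>
    have 1: "[e * Y * d - (e * c * (1 + e)^2 - u * e) = 0] (mod q^3)"
    proof (rule cancel_two)
      have "2 * (e * Y * d - (e * c * (1 + e)^2 - u * e)) =
        e * Y * (2 * d) - (e * (2 * c) * (1 + e)^2 - (2 * u) * e)" by (simp add: algebra_simps)
      also have "\<dots> = 0 * e^3" unfolding c2 u2 d2
        by (simp add: algebra_simps power2_eq_square power3_eq_cube)
      finally show "[2 * (e * Y * d - (e * c * (1 + e)^2 - u * e)) = 2 * 0] (mod q^3)" by simp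
    qed
    \<comment> \<open>The coefficients of e^2, compared modulo q. Multiplied by 12 their difference
      is a multiple of 3e plus a multiple of e^2, and the modulus \<open>r\<close> divides
      both.\<close>
    have 2: "[s * (c + Y^2) = t - v] (mod q)"
    proof (rule cancel_two1, rule cancel_six)
      have "6 * (2 * (s * (c + Y^2))) = 6 * s * (2 * c + 2 * Y^2)" by (simp add: algebra_simps)
      also have "\<dots> = (1 + e) * e * (e - 1) * (Y * (Y + 1) + 2 * Y^2)" by (simp add: c2 s6)
      finally have l: "6 * (2 * (s * (c + Y^2))) = (1 + e) * e * (e - 1) * (Y * (Y + 1) + 2 * Y^2)" .
      have "6 * (2 * (t - v)) = 2 * ((Y + 1) * Y * (Y - 1)) - 2 * ((Y + e * Y + 1) * (Y + e * Y) * (Y + e * Y - 1))"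
        using t6 v6 by (simp add: algebra_simps)
      then have "6 * (2 * (s * (c + Y^2))) - 6 * (2 * (t - v)) =
         3 * e * (2 * Y^3 - Y^2 - Y) + e^2 * (6 * Y^3 + e * (2 * Y^3 + Y + 3 * Y^2))"
        unfolding l by (simp add: algebra_simps power2_eq_square power3_eq_cube)
      moreover have "r dvd 3 * e" using r_dvd_3q q_dvd_e by (meson dvd_trans mult_dvd_mono dvd_refl)
      moreover have "r dvd e^2" using r_dvd_q2 q2_dvd_e2 dvd_trans by blast
      ultimately show "[6 * (2 * (s * (c + Y^2))) = 6 * (2 * (t - v))] (mod r)"
        unfolding cong_iff_dvd_diff by (simp only: dvd_add dvd_mult2)
    qed
    have 3: "[e^2 * (s * (c + Y^2)) = e^2 * (t - v)] (mod q^3)" by (rule cong_e2[OF 2])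
    \<comment> \<open>The subtracted multiple of e^3 is what the factor (1 + e)^2 in front of e^2 t
      leaves over.\<close>
    have "[(e * Y * d - (e * c * (1 + e)^2 - u * e)) + e^2 * (s * (c + Y^2)) - e^2 * (t - v)
       - (2 * t + e * t) * e^3 = 0 + e^2 * (t - v) - e^2 * (t - v) - 0] (mod q^3)"
      by (intro cong_diff cong_add cong_refl 1 3 e3)
    then show ?thesis unfolding cong_iff_dvd_diff
      by (simp add: algebra_simps power2_eq_square power3_eq_cube)
  qed
  show ?thesis by (rule cong_trans[OF cong_trans[OF L M] cong_sym[OF R]])
qed

lemma sum_power_its_a2: "[(\<Sum>l<a. int a ^ its l y) = int a] (mod q ^ 2)"
  by (rule sum_power_its_cong2[OF dvd_choose_two_a])

text \<open>The left-hand side is twice the later \<open>excess\<close> for \<alpha> = a. Its two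
  terms agree to first order in e, so e^2 remains. The bracket decides about further factors p: it
  is 1 modulo p for p > 3, and u + 1 modulo 3 for p = 3, where u = (a - 1) / 3.\<close>

lemma power_geo_cong:
  "[2 * (int a ^ (a + 1) - int (geo a a)) = e^2 * (1 - 2 * int (Suc a choose 3))] (mod q ^ 3)"
proof -
  define u where "u = int (Suc a choose 2)"
  define v where "v = int (Suc a choose 3)"
  have u2: "2 * u = (1 + e) * (2 + e)" using two_C[of a] by (simp add: u_def int_a)
  have "[2 * (int a ^ (a + 1) - int (geo a a)) =
      2 * ((1 + int (a + 1) * e + u * e^2) - (int a + u * e + v * e^2))] (mod q^3)"
    using power_cong[of "a + 1"] geo_cong[of a] unfolding u_def v_def
    by (intro cong_mult cong_refl cong_diff) simp_all
  also have "2 * ((1 + int (a + 1) * e + u * e^2) - (int a + u * e + v * e^2))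
      = 2 * (1 + (2 + e) * e) - 2 * (1 + e) + (2 * u) * (e^2 - e) - 2 * v * e^2"
    by (simp add: int_a algebra_simps)
  also have "\<dots> = e^2 * (1 - 2 * v) + (2 + e) * e^3"
    unfolding u2 by (simp add: algebra_simps power2_eq_square power3_eq_cube)
  also have "[e^2 * (1 - 2 * v) + (2 + e) * e^3 = e^2 * (1 - 2 * v) + 0] (mod q^3)"
    using q3_dvd_e3 by (intro cong_add cong_refl) (simp add: cong_0_iff)
  finally show ?thesis by (simp add: v_def)
qed

end


section \<open>Homomorphisms from presented groups\<close>

definition eval_word :: "('a, 'b) monoid_scheme \<Rightarrow> ('g \<Rightarrow> 'a) \<Rightarrow> 'g word \<Rightarrow> 'a" where
  "eval_word H g w = foldr (\<lambda>(x, b) y. (if b then g x else inv\<^bsub>H\<^esub> (g x)) \<otimes>\<^bsub>H\<^esub> y) w \<one>\<^bsub>H\<^esub>"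

text \<open>An arbitrary representative of the class is evaluated; \<open>eval_word_free_eq\<close>
  makes the choice immaterial.\<close>

definition free_lift :: "('a, 'b) monoid_scheme \<Rightarrow> ('g \<Rightarrow> 'a) \<Rightarrow> 'g word set \<Rightarrow> 'a" where
  "free_lift H g P = eval_word H g (SOME w. w \<in> P)"

context group
begin

lemma eval_word_closed [simp]:
  assumes "range g \<subseteq> carrier G"
  shows "eval_word G g w \<in> carrier G"
  using assms by (induction w) (auto simp: eval_word_def image_subset_iff)

lemma eval_word_append:
  assumes g: "range g \<subseteq> carrier G"
  shows "eval_word G g (u @ v) = eval_word G g u \<otimes> eval_word G g v"
proof (induction u)
  case Nil
  have "eval_word G g [] = \<one>" by (simp add: eval_word_def)
  then show ?case using eval_word_closed[OF g, of v] by simp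
next
  case (Cons l u)
  obtain x b where l: "l = (x, b)" by force
  have "g x \<in> carrier G" using g by auto
  then show ?case
    using Cons g eval_word_closed[OF g, of u] eval_word_closed[OF g, of v]
    by (simp add: eval_word_def l m_assoc)
qed

lemma eval_word_free_eq:
  assumes g: "range g \<subseteq> carrier G" and "free_eq u v"
  shows "eval_word G g u = eval_word G g v"
  using assms(2)
proof induction
  case (cancel u x b v)
  have "g x \<in> carrier G" using g by auto
  then have "eval_word G g [(x, b), (x, \<not> b)] = \<one>"
    by (simp add: eval_word_def)
  then show ?case using g by (simp only: eval_word_append[OF g]) simp
qed auto

lemma free_lift_word_class:
  assumes g: "range g \<subseteq> carrier G"
  shows "free_lift G g (word_class u) = eval_word G g u"
proof -
  have "(SOME w. w \<in> word_class u) \<in> word_class u"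
    by (rule someI[of _ u]) (simp add: word_class_def free_eq.refl)
  then show ?thesis
    unfolding free_lift_def by (intro eval_word_free_eq[OF g]) (auto simp: word_class_def intro: free_eq.sym)
qed

lemma free_lift_gen [simp]:
  assumes g: "range g \<subseteq> carrier G"
  shows "free_lift G g (free_gen x) = g x"
proof -
  have "g x \<in> carrier G" using g by auto
  then show ?thesis by (simp add: free_gen_def free_lift_word_class[OF g] eval_word_def)
qed

lemma free_lift_hom:
  assumes g: "range g \<subseteq> carrier G"
  shows "free_lift G g \<in> hom free_group G"
proof (rule homI)
  fix P Q :: "'c word set" assume "P \<in> carrier free_group" "Q \<in> carrier free_group"
  then obtain u v where "P = word_class u" "Q = word_class v" by (auto simp: free_group_def)
  then show "free_lift G g (P \<otimes>\<^bsub>free_group\<^esub> Q) = free_lift G g P \<otimes> free_lift G g Q"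
    by (simp add: free_group_mult free_lift_word_class[OF g] eval_word_append[OF g])
next
  fix P :: "'c word set" assume "P \<in> carrier free_group"
  then obtain u where "P = word_class u" by (auto simp: free_group_def)
  then show "free_lift G g P \<in> carrier G"
    using g by (simp add: free_lift_word_class[OF g])
qed

end

lemma free_gen_closed [simp]: "free_gen x \<in> carrier free_group"
  by (simp add: free_gen_def free_group_def)

text \<open>A word is the product of its letters, and an inverse letter represents the inverse of a
  generator.\<close>

lemma carrier_free_group: "carrier free_group = generate free_group (range free_gen)"
proof
  interpret F: group free_group by (rule group_free_group)
  show "generate free_group (range free_gen) \<subseteq> carrier free_group"
    by (intro F.generate_incl) auto
  have inv: "inv\<^bsub>free_group\<^esub> (free_gen x) = word_class [(x, False)]" for x
  proof (rule F.inv_equality)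
    have "free_eq ([] @ [(x, False), (x, \<not> False)] @ []) ([] @ [])" by (rule free_eq.cancel)
    then show "word_class [(x, False)] \<otimes>\<^bsub>free_group\<^esub> free_gen x = \<one>\<^bsub>free_group\<^esub>"
      by (simp add: free_gen_def free_group_mult word_class_eq_iff) (simp add: free_group_def word_class_eq_iff)
  qed (auto simp: free_gen_def free_group_def)
  have one: "\<one>\<^bsub>free_group\<^esub> = word_class []" by (simp add: free_group_def)
  have "word_class u \<in> generate free_group (range free_gen)" for u :: "'a word"
  proof (induction u)
    case Nil
    show ?case using generate.one[of free_group "range free_gen"] by (simp add: one)
  next
    case (Cons l u)
    obtain x b where l: "l = (x, b)" by force
    have "word_class [(x, b)] \<in> generate free_group (range free_gen)"
      using generate.incl[of "free_gen x" "range free_gen" free_group]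
        generate.inv[of "free_gen x" "range free_gen" free_group]
      by (cases b) (auto simp: inv, simp add: free_gen_def)
    from generate.eng[OF this Cons] show ?case by (simp add: free_group_mult l)
  qed
  then have "range (word_class :: 'a word \<Rightarrow> 'a word set) \<subseteq> generate free_group (range free_gen)"
    by (rule image_subsetI)
  then show "carrier (free_group :: 'a word set monoid) \<subseteq> generate free_group (range free_gen)"
    by (simp add: free_group_def)
qed

locale presentation =
  fixes rels :: "('g word set \<times> 'g word set) set"
  assumes rels: "rels \<subseteq> carrier free_group \<times> carrier free_group"
begin

definition relators :: "'g word set set" where
  "relators = {u \<otimes>\<^bsub>free_group\<^esub> inv\<^bsub>free_group\<^esub> v | u v. (u, v) \<in> rels}"

definition proj :: "'g word set \<Rightarrow> 'g word set set" where
  "proj P = normal_closure free_group relators #>\<^bsub>free_group\<^esub> P"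

lemma relators_closed: "relators \<subseteq> carrier free_group"
proof -
  interpret F: group free_group by (rule group_free_group)
  show ?thesis using rels by (auto simp: relators_def)
qed

lemma presented_group_eq: "presented_group rels = free_group Mod normal_closure free_group relators"
  by (simp add: presented_group_def relators_def)

lemma normal_relators: "normal_closure free_group relators \<lhd> free_group"
  using group.normal_normal_closure[OF group_free_group relators_closed] .

lemma proj_hom: "proj \<in> hom free_group (presented_group rels)"
  unfolding presented_group_eq proj_def using normal.r_coset_hom_Mod[OF normal_relators] .

sublocale presented: group "presented_group rels"
  by (rule group_presented_group[OF rels])

sublocale proj: group_hom free_group "presented_group rels" proj
  by (intro group_hom.intro group_hom_axioms.intro group_free_group presented.is_group proj_hom)

lemma relators_subset: "relators \<subseteq> normal_closure free_group relators"
  by (auto simp: normal_closure_def)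

lemma proj_rel:
  assumes "(u, v) \<in> rels"
  shows "proj u = proj v"
proof -
  interpret F: group free_group by (rule group_free_group)
  interpret N: normal "normal_closure free_group relators" free_group by (rule normal_relators)
  have uv: "u \<in> carrier free_group" "v \<in> carrier free_group" using assms rels by auto
  have "u \<otimes>\<^bsub>free_group\<^esub> inv\<^bsub>free_group\<^esub> v \<in> normal_closure free_group relators"
    using relators_subset assms by (auto simp: relators_def)
  then have "u \<in> proj v" unfolding proj_def
    by (rule N.rcos_module_rev[OF F.is_group uv(2,1)])
  then show ?thesis unfolding proj_def
    using F.repr_independence[OF _ uv(2) N.subgroup_axioms] by blast
qed

lemma carrier_presented: "carrier (presented_group rels) = generate (presented_group rels) (range (\<lambda>x. proj (free_gen x)))"
proof -
  have "carrier (presented_group rels) = proj ` carrier free_group"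
    unfolding presented_group_eq carrier_FactGroup proj_def by simp
  also have "\<dots> = generate (presented_group rels) (proj ` range free_gen)"
    unfolding carrier_free_group by (rule proj.generate_img[symmetric]) auto
  finally show ?thesis by (simp add: image_image)
qed

text \<open>Von Dyck's theorem: the kernel of the lifted map on the free group is normal and
  contains the relators, hence their normal closure, so the map factors through the
  quotient.\<close>

lemma presented_lift:
  assumes H: "group H" and g: "range g \<subseteq> carrier H"
    and rel: "\<And>u v. (u, v) \<in> rels \<Longrightarrow> free_lift H g u = free_lift H g v"
  obtains h where "h \<in> hom (presented_group rels) H" "\<And>x. h (proj (free_gen x)) = g x"
proof -
  interpret F: group free_group by (rule group_free_group)
  interpret H: group H by (rule H)
  interpret L: group_hom free_group H "free_lift H g"
    by (intro group_hom.intro group_hom_axioms.intro F.is_group H H.free_lift_hom g)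
  interpret N: normal "normal_closure free_group relators" free_group by (rule normal_relators)
  have "relators \<subseteq> kernel free_group H (free_lift H g)"
  proof
    fix w assume "w \<in> relators"
    then obtain u v where uv: "w = u \<otimes>\<^bsub>free_group\<^esub> inv\<^bsub>free_group\<^esub> v" "(u, v) \<in> rels"
      by (auto simp: relators_def)
    then have c: "u \<in> carrier free_group" "v \<in> carrier free_group" using rels by auto
    then have "free_lift H g w = \<one>\<^bsub>H\<^esub>" using rel[OF uv(2)] by (simp add: uv(1))
    then show "w \<in> kernel free_group H (free_lift H g)"
      using c by (simp add: kernel_def uv(1))
  qed
  then have ker: "normal_closure free_group relators \<subseteq> kernel free_group H (free_lift H g)"
    unfolding normal_closure_def using L.normal_kernel by blast
  obtain h where h: "h \<in> hom (free_group Mod normal_closure free_group relators) H"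
    "\<And>x. x \<in> carrier free_group \<Longrightarrow> h (normal_closure free_group relators #>\<^bsub>free_group\<^esub> x) = free_lift H g x"
  proof (rule FactGroup_universal[OF L.homh normal_relators])
    fix x y assume xy: "x \<in> carrier free_group" "y \<in> carrier free_group"
      and eq: "normal_closure free_group relators #>\<^bsub>free_group\<^esub> x = normal_closure free_group relators #>\<^bsub>free_group\<^esub> y"
    have "x \<in> normal_closure free_group relators #>\<^bsub>free_group\<^esub> y"
      using F.rcos_self[OF xy(1) N.subgroup_axioms] eq by simp
    from N.rcos_module_imp[OF F.is_group xy(2) this]
    have "x \<otimes>\<^bsub>free_group\<^esub> inv\<^bsub>free_group\<^esub> y \<in> kernel free_group H (free_lift H g)"
      using ker xy by blast
    then have "free_lift H g x \<otimes>\<^bsub>H\<^esub> inv\<^bsub>H\<^esub> free_lift H g y = \<one>\<^bsub>H\<^esub>"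
      using xy by (simp add: kernel_def)
    then show "free_lift H g x = free_lift H g y"
      using xy H.inv_equality by (metis H.inv_closed H.inv_inv L.hom_closed)
  qed blast
  show thesis
  proof (rule that)
    show "h \<in> hom (presented_group rels) H" using h(1) by (simp add: presented_group_eq)
    show "h (proj (free_gen x)) = g x" for x
      using h(2)[of "free_gen x"] H.free_lift_gen[OF g] by (simp add: proj_def)
  qed
qed

end


section \<open>The Macdonald relations\<close>

text \<open>Integer version of \<open>geo\<close>: \<alpha> may be negative until it is replaced by
  a positive residue.\<close>

primrec geoi :: "int \<Rightarrow> nat \<Rightarrow> int" where
  "geoi \<alpha> 0 = 0"
| "geoi \<alpha> (Suc n) = \<alpha> * (1 + geoi \<alpha> n)"

lemma geoi_int: "geoi (int a) n = int (geo a n)"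
  by (induction n) (auto simp: algebra_simps)

lemma geoi_mult_pred: "(\<alpha> - 1) * geoi \<alpha> n = \<alpha> * (\<alpha> ^ n - 1)"
  by (induction n) (auto simp: algebra_simps)

context group
begin

lemma inv_mult_cancel [simp]:
  "\<lbrakk>x \<in> carrier G; y \<in> carrier G\<rbrakk> \<Longrightarrow> inv x \<otimes> (x \<otimes> y) = y"
  "\<lbrakk>x \<in> carrier G; y \<in> carrier G\<rbrakk> \<Longrightarrow> x \<otimes> (inv x \<otimes> y) = y"
  by (simp_all flip: m_assoc)

lemma conj_int_pow:
  assumes [simp]: "x \<in> carrier G" "g \<in> carrier G" "y \<in> carrier G" and "g \<otimes> x = y \<otimes> g"
  shows "g \<otimes> x [^] (i::int) = y [^] i \<otimes> g"
proof -
  have y: "y = g \<otimes> x \<otimes> inv g" using assms(4) by (simp add: m_assoc)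
  have nat: "(g \<otimes> x \<otimes> inv g) [^] n = g \<otimes> x [^] n \<otimes> inv g" for n :: nat
    by (induction n) (simp_all add: m_assoc)
  have "(g \<otimes> x \<otimes> inv g) [^] i = g \<otimes> x [^] i \<otimes> inv g"
    by (cases i rule: int_cases2) (simp_all add: int_pow_int int_pow_neg_int inv_mult_group m_assoc
      nat[unfolded m_assoc[OF assms(2,1) inv_closed[OF assms(2)]]])
  then show ?thesis by (simp add: y m_assoc)
qed

end

text \<open>The element \<open>D\<close> is the commutator \<open>[B, A]\<close>. With it all relations become positive, which
  gives a right action of the generators on the normal forms \<open>A\<^sup>i D\<^sup>k B\<^sup>j\<close>.\<close>

locale macdonald_int = group +
  fixes A B D :: 'a and \<alpha> :: int
  assumes closed [simp]: "A \<in> carrier G" "B \<in> carrier G" "D \<in> carrier G"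
    and D_A: "D \<otimes> A = A [^] \<alpha> \<otimes> D"
    and B_D: "B \<otimes> D = D \<otimes> B [^] \<alpha>"
    and B_A: "B \<otimes> A = A \<otimes> (B \<otimes> D)"
begin

text \<open>The presentation is symmetric in A and B, and [A, B] is the inverse of [B, A]. Every
  statement about A thus has a counterpart about B.\<close>

lemma swap: "macdonald_int G B A (inv D) \<alpha>"
proof
  have "D \<otimes> B [^] \<alpha> \<otimes> inv D = B" by (simp flip: B_D add: m_assoc)
  then have "inv D \<otimes> B = inv D \<otimes> (D \<otimes> B [^] \<alpha> \<otimes> inv D)" by simp
  then show "inv D \<otimes> B = B [^] \<alpha> \<otimes> inv D" by (simp add: m_assoc)
  have "inv D \<otimes> A [^] \<alpha> = inv D \<otimes> (A [^] \<alpha> \<otimes> D \<otimes> inv D)" by (simp add: m_assoc)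
  also have "\<dots> = A \<otimes> inv D" by (simp flip: D_A add: m_assoc)
  finally show "A \<otimes> inv D = inv D \<otimes> A [^] \<alpha>" by simp
  have "A \<otimes> B = A \<otimes> (B \<otimes> D) \<otimes> inv D" by (simp add: m_assoc)
  also have "\<dots> = B \<otimes> (A \<otimes> inv D)" by (simp flip: B_A add: m_assoc)
  finally show "A \<otimes> B = B \<otimes> (A \<otimes> inv D)" .
qed auto

lemma D_Apow: "D \<otimes> A [^] (i::int) = A [^] (\<alpha> * i) \<otimes> D"
  using conj_int_pow[OF _ _ _ D_A, of i] by (simp add: int_pow_pow)

lemma Dpow_Apow: "D [^] (k::nat) \<otimes> A [^] (i::int) = A [^] (\<alpha> ^ k * i) \<otimes> D [^] k"
proof (induction k arbitrary: i)
  case (Suc k)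
  have "D [^] Suc k \<otimes> A [^] i = D [^] k \<otimes> (D \<otimes> A [^] i)" by (simp add: m_assoc)
  also have "\<dots> = (D [^] k \<otimes> A [^] (\<alpha> * i)) \<otimes> D" by (simp add: D_Apow m_assoc)
  also have "\<dots> = A [^] (\<alpha> ^ Suc k * i) \<otimes> D [^] Suc k" by (simp add: Suc m_assoc mult_ac)
  finally show ?case .
qed simp

lemma Bpow_D: "B [^] (j::int) \<otimes> D = D \<otimes> B [^] (\<alpha> * j)"
proof -
  have "inv D \<otimes> B [^] j = B [^] (\<alpha> * j) \<otimes> inv D"
    using macdonald_int.D_Apow[OF swap] .
  then have "D \<otimes> (inv D \<otimes> B [^] j) \<otimes> D = D \<otimes> (B [^] (\<alpha> * j) \<otimes> inv D) \<otimes> D" by simp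
  then show ?thesis by (simp add: m_assoc)
qed

lemma Bpow_Dpow: "B [^] (j::int) \<otimes> D [^] (k::nat) = D [^] k \<otimes> B [^] (\<alpha> ^ k * j)"
proof (induction k)
  case (Suc k)
  have "B [^] j \<otimes> D [^] Suc k = (B [^] j \<otimes> D [^] k) \<otimes> D" by (simp add: m_assoc)
  also have "\<dots> = D [^] k \<otimes> (B [^] (\<alpha> ^ k * j) \<otimes> D)" by (simp add: Suc m_assoc)
  also have "\<dots> = D [^] Suc k \<otimes> B [^] (\<alpha> ^ Suc k * j)" by (simp add: Bpow_D m_assoc mult_ac)
  finally show ?case .
qed simp

text \<open>Each further B passes A at the cost of one D on its right; carrying this D to the left
  past a power of B multiplies the exponent by \<alpha>. This is the recursion of
  \<open>geoi\<close>.\<close>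

lemma Bpow_A: "B [^] (j::nat) \<otimes> A = A \<otimes> (D [^] j \<otimes> B [^] geoi \<alpha> j)"
proof (induction j)
  case (Suc j)
  have "B [^] Suc j \<otimes> A = (B [^] j \<otimes> A) \<otimes> (B \<otimes> D)" by (simp add: m_assoc B_A)
  also have "\<dots> = A \<otimes> (D [^] j \<otimes> (B [^] geoi \<alpha> j \<otimes> B [^] (1::int) \<otimes> D))"
    by (simp add: Suc m_assoc)
  also have "B [^] geoi \<alpha> j \<otimes> B [^] (1::int) \<otimes> D = D \<otimes> B [^] geoi \<alpha> (Suc j)"
    by (simp only: int_pow_mult[OF closed(2), symmetric] Bpow_D) (simp add: algebra_simps)
  finally show ?case by (simp add: m_assoc)
qed simp

lemmas Apow_B = macdonald_int.Bpow_A[OF swap]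

text \<open>The exponent left over when the two ways are compared. For negative \<alpha> the power
  A^|\<alpha>| is the inverse of A^\<alpha>, which changes the count.\<close>

definition excess :: int where
  "excess = (if \<alpha> \<ge> 0 then \<alpha> ^ (nat \<alpha> + 1) - geoi \<alpha> (nat \<alpha>) else geoi \<alpha> (nat (- \<alpha>)) + \<alpha>)"

text \<open>The two ways of moving the powers of \<open>A\<close> and \<open>B\<close> with exponent \<open>\<bar>\<alpha>\<bar>\<close> past the other generator
  are compared.\<close>

lemma excess_conj:
  defines "n \<equiv> nat \<bar>\<alpha>\<bar>"
  shows "A [^] excess \<otimes> (D [^] (n + 1) \<otimes> B [^] excess) = D [^] (n + 1)"
proof -
  define f where "f = geoi \<alpha> n"
  define P where "P = D [^] n"
  define E where "E = D [^] (n + 1)"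
  define F where "F = A [^] f"
  define b where "b = B [^] \<alpha>"
  define K where "K = B [^] excess"
  have c [simp]: "P \<in> carrier G" "E \<in> carrier G" "F \<in> carrier G" "b \<in> carrier G" "K \<in> carrier G"
    by (auto simp: P_def E_def F_def b_def K_def)
  have E1: "E = P \<otimes> D" by (simp add: E_def P_def)
  have E2: "E = D \<otimes> P" unfolding E_def P_def by (simp only: Suc_eq_plus1[symmetric] nat_pow_Suc2 closed)
  have invE: "inv D \<otimes> (inv P \<otimes> y) = inv E \<otimes> y" if "y \<in> carrier G" for y
    using that by (simp add: E1 inv_mult_group m_assoc)
  have invDE: "inv D \<otimes> E = P" by (simp add: E2)
  have C: "inv D [^] n = inv P" by (simp add: nat_pow_inv P_def)
  have CB1: "inv D \<otimes> B = b \<otimes> inv D"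
    using macdonald_int.D_A[OF swap] by (simp add: b_def)
  have CBx: "inv D \<otimes> (B \<otimes> x) = b \<otimes> (inv D \<otimes> x)" if "x \<in> carrier G" for x
    using that CB1 by (simp flip: m_assoc)
  \<comment> \<open>A^n and B^n are conjugates, by powers of D, of A and B or of their inverses
    according to the sign of \<alpha>. So these two rules rewrite products of the same kind and can
    be played against each other.\<close>
  have Bn: "B [^] n \<otimes> A = A \<otimes> (P \<otimes> B [^] f)" unfolding f_def P_def by (rule Bpow_A)
  have An: "A [^] n \<otimes> B = B \<otimes> (inv P \<otimes> F)" using Apow_B[of n] by (simp add: f_def F_def C)
  have DA: "A [^] \<alpha> = D \<otimes> (A \<otimes> inv D)" using D_A by (simp flip: m_assoc) (simp add: m_assoc)
  have key: "E \<otimes> (A \<otimes> K) = A [^] (\<alpha> ^ (n + 1) - excess) \<otimes> E"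
  proof (cases "\<alpha> \<ge> 0")
    case True
    then have n: "int n = \<alpha>" and ex: "excess = \<alpha> ^ (n + 1) - f" by (auto simp: n_def f_def excess_def)
    have "A [^] n = A [^] \<alpha>" by (simp flip: n add: int_pow_int)
    then have "D \<otimes> (A \<otimes> (inv D \<otimes> B)) = B \<otimes> (inv P \<otimes> F)"
      using An by (simp add: DA m_assoc)
    then have "inv D \<otimes> (D \<otimes> (A \<otimes> (inv D \<otimes> B))) = inv D \<otimes> (B \<otimes> (inv P \<otimes> F))" by (simp only:)
    then have "A \<otimes> (b \<otimes> inv D) = b \<otimes> (inv E \<otimes> F)" by (simp add: CB1 CBx invE)
    then have "A \<otimes> (b \<otimes> inv D) \<otimes> E = b \<otimes> (inv E \<otimes> F) \<otimes> E" by (simp only:)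
    then have 1: "A \<otimes> (b \<otimes> P) = b \<otimes> (inv E \<otimes> (F \<otimes> E))" by (simp add: m_assoc invDE)
    have b: "b = B [^] n" by (simp add: b_def int_pow_int flip: n)
    have "b \<otimes> (A \<otimes> K) = B [^] n \<otimes> A \<otimes> K" by (simp add: b m_assoc)
    also have "\<dots> = A \<otimes> (P \<otimes> B [^] (f + excess))"
      unfolding Bn by (simp add: m_assoc int_pow_mult K_def)
    \<comment> \<open>\<open>excess\<close> is chosen so that this exponent is \<alpha>^(n+1):
      carrying D^n past that power of B leaves B^\<alpha>.\<close>
    also have "f + excess = \<alpha> ^ n * \<alpha>" by (simp add: ex)
    also have "P \<otimes> B [^] (\<alpha> ^ n * \<alpha>) = b \<otimes> P"
      unfolding P_def b_def by (simp add: Bpow_Dpow)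
    finally have "b \<otimes> (A \<otimes> K) = b \<otimes> (inv E \<otimes> (F \<otimes> E))" using 1 by simp
    then have "A \<otimes> K = inv E \<otimes> (F \<otimes> E)" by simp
    then have "E \<otimes> (A \<otimes> K) = F \<otimes> E" by simp
    then show ?thesis by (simp add: ex F_def)
  next
    case False
    then have n: "int n = - \<alpha>" and ex: "excess = f + \<alpha>" by (auto simp: n_def f_def excess_def)
    have "A [^] n = A [^] (- \<alpha>)" by (simp flip: n add: int_pow_int)
    also have "\<dots> = D \<otimes> (inv A \<otimes> inv D)" by (simp add: int_pow_neg DA inv_mult_group m_assoc)
    finally have "D \<otimes> (inv A \<otimes> (inv D \<otimes> B)) = B \<otimes> (inv P \<otimes> F)"
      using An by (simp add: m_assoc)
    then have "inv D \<otimes> (D \<otimes> (inv A \<otimes> (inv D \<otimes> B))) = inv D \<otimes> (B \<otimes> (inv P \<otimes> F))" by (simp only:)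
    then have "inv A \<otimes> (b \<otimes> inv D) = b \<otimes> (inv E \<otimes> F)" by (simp add: CB1 CBx invE)
    then have "inv A \<otimes> (b \<otimes> inv D) \<otimes> D = b \<otimes> (inv E \<otimes> F) \<otimes> D" by (simp only:)
    then have "inv A \<otimes> b = b \<otimes> (inv E \<otimes> (F \<otimes> D))" by (simp add: m_assoc)
    \<comment> \<open>Inversion replaces b by its inverse, which is B^n for negative \<alpha>, so
      that \<open>Bn\<close> applies.\<close>
    then have "inv (inv A \<otimes> b) = inv (b \<otimes> (inv E \<otimes> (F \<otimes> D)))" by (simp only:)
    then have "inv b \<otimes> A = inv D \<otimes> (inv F \<otimes> (E \<otimes> inv b))" by (simp add: inv_mult_group m_assoc)
    moreover have b: "inv b = B [^] n" by (simp add: b_def n flip: int_pow_neg int_pow_int)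
    ultimately have "A \<otimes> (P \<otimes> B [^] f) = inv D \<otimes> (inv F \<otimes> (E \<otimes> inv b))" using Bn by simp
    then have "D \<otimes> (A \<otimes> (P \<otimes> B [^] f)) \<otimes> b = D \<otimes> (inv D \<otimes> (inv F \<otimes> (E \<otimes> inv b))) \<otimes> b" by (simp only:)
    then have "D \<otimes> (A \<otimes> (P \<otimes> (B [^] f \<otimes> b))) = inv F \<otimes> E" by (simp add: m_assoc)
    moreover have "B [^] f \<otimes> b = K" by (simp add: K_def b_def ex int_pow_mult)
    ultimately have "D \<otimes> A \<otimes> (P \<otimes> K) = inv F \<otimes> E" by (simp add: m_assoc)
    then have 1: "A [^] \<alpha> \<otimes> (E \<otimes> K) = A [^] (- f) \<otimes> E"
      unfolding D_A by (simp add: m_assoc E2 int_pow_neg F_def)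
    have "E \<otimes> (A \<otimes> K) = (E \<otimes> A [^] (1::int)) \<otimes> K" by (simp add: m_assoc)
    also have "\<dots> = A [^] (\<alpha> ^ (n + 1)) \<otimes> E \<otimes> K"
      unfolding E_def Dpow_Apow by simp
    also have "\<dots> = A [^] (\<alpha> ^ (n + 1) - \<alpha>) \<otimes> A [^] \<alpha> \<otimes> (E \<otimes> K)"
      by (subst int_pow_mult[symmetric]) (simp_all add: m_assoc)
    also have "\<dots> = A [^] (\<alpha> ^ (n + 1) - \<alpha>) \<otimes> (A [^] (- f) \<otimes> E)"
      using 1 by (simp add: m_assoc)
    also have "\<dots> = A [^] (\<alpha> ^ (n + 1) - \<alpha>) \<otimes> A [^] (- f) \<otimes> E" by (simp add: m_assoc)
    also have "\<dots> = A [^] (\<alpha> ^ (n + 1) - excess) \<otimes> E"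
      by (subst int_pow_mult[symmetric]) (simp_all add: ex algebra_simps)
    finally show ?thesis .
  qed
  have "A [^] (\<alpha> ^ (n + 1)) \<otimes> (E \<otimes> K) = (E \<otimes> A [^] (1::int)) \<otimes> K"
    unfolding E_def Dpow_Apow by (simp add: m_assoc K_def)
  also have "\<dots> = A [^] (\<alpha> ^ (n + 1) - excess) \<otimes> E" using key by (simp add: m_assoc)
  finally have 1: "A [^] (\<alpha> ^ (n + 1)) \<otimes> (E \<otimes> K) = A [^] (\<alpha> ^ (n + 1) - excess) \<otimes> E" .
  have "A [^] excess \<otimes> (E \<otimes> K) = A [^] (excess - \<alpha> ^ (n + 1)) \<otimes> (A [^] (\<alpha> ^ (n + 1)) \<otimes> (E \<otimes> K))"
    by (subst m_assoc[symmetric]) (simp_all add: int_pow_mult[symmetric] del: int_pow_mult)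
  also have "\<dots> = A [^] (excess - \<alpha> ^ (n + 1)) \<otimes> A [^] (\<alpha> ^ (n + 1) - excess) \<otimes> E"
    unfolding 1 by (simp add: m_assoc)
  also have "\<dots> = E" by (subst int_pow_mult[symmetric]) simp_all
  finally show ?thesis by (simp add: E_def K_def)
qed

text \<open>By \<open>excess_conj\<close>, B^excess is conjugate to A^(-excess) under D^(n+1).
  Taking the power \<alpha>^(n+1) on both sides is useful because D^(n+1) B^(excess *
  \<alpha>^(n+1)) is B^excess D^(n+1), so D drops out.\<close>

lemma excess_relation:
  defines "n \<equiv> nat \<bar>\<alpha>\<bar>"
  shows "A [^] (excess * \<alpha> ^ (n + 1)) \<otimes> B [^] excess = \<one>"
proof -
  let ?D = "D [^] (n + 1)"
  have "A [^] excess \<otimes> (?D \<otimes> B [^] excess) = ?D"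
    unfolding n_def by (rule excess_conj)
  then have "?D \<otimes> B [^] excess = inv (A [^] excess) \<otimes> ?D"
    by (metis closed(1,3) int_pow_closed inv_mult_cancel(1) m_closed nat_pow_closed closed(2))
  from conj_int_pow[OF _ _ _ this, of "\<alpha> ^ (n + 1)"]
  have "?D \<otimes> B [^] (excess * \<alpha> ^ (n + 1)) = inv (A [^] (excess * \<alpha> ^ (n + 1))) \<otimes> ?D"
    by (simp add: int_pow_pow flip: int_pow_neg)
  moreover have "?D \<otimes> B [^] (excess * \<alpha> ^ (n + 1)) = B [^] excess \<otimes> ?D"
    using Bpow_Dpow[of excess "n + 1"] by (simp add: mult.commute)
  ultimately have "B [^] excess = inv (A [^] (excess * \<alpha> ^ (n + 1)))" by simp
  then show ?thesis by simp
qed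

text \<open>The relation B A = A B D expresses D as a word in A and B.\<close>

lemma commute_D:
  assumes x: "x \<in> carrier G" and "x \<otimes> A = A \<otimes> x" "x \<otimes> B = B \<otimes> x"
  shows "x \<otimes> D = D \<otimes> x"
proof -
  have D: "D = inv B \<otimes> (inv A \<otimes> (B \<otimes> A))" by (simp add: B_A)
  have i: "x \<otimes> inv y = inv y \<otimes> x" if "y \<in> carrier G" "x \<otimes> y = y \<otimes> x" for y
  proof -
    have "inv y \<otimes> (x \<otimes> y) \<otimes> inv y = inv y \<otimes> (y \<otimes> x) \<otimes> inv y" using that by simp
    then show ?thesis using that(1) x by (simp add: m_assoc)
  qed
  have c: "x \<otimes> (y \<otimes> z) = (y \<otimes> z) \<otimes> x"
    if "y \<in> carrier G" "z \<in> carrier G" "x \<otimes> y = y \<otimes> x" "x \<otimes> z = z \<otimes> x" for y z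
  proof -
    have "x \<otimes> (y \<otimes> z) = (x \<otimes> y) \<otimes> z" using that(1,2) x by (simp add: m_assoc)
    also have "\<dots> = y \<otimes> (x \<otimes> z)" unfolding that(3) using that(1,2) x by (simp add: m_assoc)
    also have "\<dots> = (y \<otimes> z) \<otimes> x" unfolding that(4) using that(1,2) x by (simp add: m_assoc)
    finally show ?thesis .
  qed
  show ?thesis unfolding D by (intro c i m_closed inv_closed closed assms)
qed

lemma excess_order:
  defines "n \<equiv> nat \<bar>\<alpha>\<bar>"
  shows "A [^] ((\<alpha> - 1) * (excess * \<alpha> ^ (n + 1))) = \<one>"
proof -
  let ?x = "A [^] (excess * \<alpha> ^ (n + 1))"
  have x: "?x = inv (B [^] excess)"
    using excess_relation by (metis n_def inv_equality closed int_pow_closed)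
  have "?x \<otimes> A = A \<otimes> ?x"
    using int_pow_mult[of A "excess * \<alpha> ^ (n + 1)" 1] int_pow_mult[of A 1 "excess * \<alpha> ^ (n + 1)"]
    by (simp add: add.commute)
  moreover have "?x \<otimes> B = B \<otimes> ?x"
    using int_pow_mult[of B "- excess" 1] int_pow_mult[of B 1 "- excess"] unfolding x
    by (simp add: int_pow_neg)
  ultimately have "?x \<otimes> D = D \<otimes> ?x" by (intro commute_D) auto
  also have "\<dots> = A [^] (\<alpha> * (excess * \<alpha> ^ (n + 1))) \<otimes> D" by (rule D_Apow)
  finally have "A [^] (\<alpha> * (excess * \<alpha> ^ (n + 1))) = ?x" by simp
  then have "A [^] (\<alpha> * (excess * \<alpha> ^ (n + 1)) - excess * \<alpha> ^ (n + 1)) = \<one>"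
    by (simp add: int_pow_diff)
  then show ?thesis by (simp add: algebra_simps)
qed

end

section \<open>Normal forms for a positive exponent\<close>

locale macdonald_nat = macdonald_int G A B D "int a" for G (structure) and A B D and a :: nat +
  assumes a_pos: "a > 0"
begin

lemma swap_nat: "macdonald_nat G B A (inv D) a"
  by (intro macdonald_nat.intro swap macdonald_nat_axioms.intro a_pos)

lemma Dpow_Apow_nat: "D [^] (k::nat) \<otimes> A [^] (i::nat) = A [^] (a ^ k * i) \<otimes> D [^] k"
  using Dpow_Apow[of k "int i"] by (simp flip: int_pow_int)

lemma Bpow_Dpow_nat: "B [^] (j::nat) \<otimes> D [^] (k::nat) = D [^] k \<otimes> B [^] (a ^ k * j)"
  using Bpow_Dpow[of "int j" k] by (simp flip: int_pow_int)

lemma Bpow_A_nat: "B [^] (j::nat) \<otimes> A = A \<otimes> (D [^] j \<otimes> B [^] geo a j)"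
  using Bpow_A[of j] by (simp add: geoi_int int_pow_int)

definition N :: "nat \<Rightarrow> nat \<Rightarrow> nat \<Rightarrow> 'a" where
  "N i k j = A [^] i \<otimes> (D [^] k \<otimes> B [^] j)"

lemma N_closed [simp]: "N i k j \<in> carrier G" by (simp add: N_def)

lemma N_B: "N i k j \<otimes> B [^] (n::nat) = N i k (j + n)"
  by (simp add: N_def m_assoc nat_pow_mult)

lemma N_D: "N i k j \<otimes> D [^] (n::nat) = N i (k + n) (a ^ n * j)"
  by (simp add: N_def m_assoc Bpow_Dpow_nat nat_pow_mult) (simp add: m_assoc flip: nat_pow_mult)

lemma N_A: "N i k j \<otimes> A = N (i + a ^ k) (k + j) (geo a j)"
proof -
  have "N i k j \<otimes> A = A [^] i \<otimes> (D [^] k \<otimes> A [^] (1::nat)) \<otimes> (D [^] j \<otimes> B [^] geo a j)"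
    by (simp add: N_def m_assoc Bpow_A_nat)
  also have "\<dots> = A [^] i \<otimes> A [^] (a ^ k) \<otimes> (D [^] k \<otimes> D [^] j \<otimes> B [^] geo a j)"
    unfolding Dpow_Apow_nat by (simp add: m_assoc)
  also have "\<dots> = N (i + a ^ k) (k + j) (geo a j)"
    by (simp add: N_def nat_pow_mult)
  finally show ?thesis .
qed

text \<open>A single A sends (i, k, j) to (i + a^k, k + j, geo a j). Iteration therefore puts
  iterates of \<open>geo\<close> in the third place, their partial sums in the second, and powers of
  a with these sums as exponents in the first.\<close>

lemma N_Apow:
  "N i k j \<otimes> A [^] (n::nat) =
    N (i + a ^ k * (\<Sum>l<n. a ^ geo_iter_sum a l j)) (k + geo_iter_sum a n j) (geo_iter a n j)"
proof (induction n)
  case (Suc n)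
  have "N i k j \<otimes> A [^] Suc n = (N i k j \<otimes> A [^] n) \<otimes> A" by (simp add: m_assoc)
  then show ?case
    by (simp add: Suc N_A geo_iter_Suc geo_iter_sum_Suc algebra_simps power_add)
qed (simp add: N_def)

lemma N_0 [simp]: "N 0 0 0 = \<one>" by (simp add: N_def)

text \<open>Closure of the set of normal forms under right multiplication is the property that
  passes through \<open>generate\<close>. Finite order turns the inverses of A and B into positive
  powers.\<close>

lemma generate_N:
  assumes n: "n > 0" "A [^] (n::nat) = \<one>" "B [^] n = \<one>"
    and x: "x \<in> generate G {A, B}"
  obtains i k j where "x = N i k j"
proof -
  let ?S = "{N i k j | i k j. True}"
  have Sub: "?S \<subseteq> carrier G" by auto
  have inv: "inv y = y [^] (n - 1)" if "y \<in> carrier G" "y [^] n = \<one>" for y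
  proof (rule inv_equality)
    have "y [^] (n - 1) \<otimes> y = y [^] n" using n(1) by (metis Suc_diff_1 nat_pow_Suc)
    then show "y [^] (n - 1) \<otimes> y = \<one>" using that by simp
  qed (use that in auto)
  have "\<forall>s\<in>?S. s \<otimes> x \<in> ?S" using x
  proof (induction rule: generate.induct)
    case one
    show ?case
    proof
      fix s assume "s \<in> ?S"
      moreover from this have "s \<in> carrier G" using Sub by blast
      ultimately show "s \<otimes> \<one> \<in> ?S" by simp
    qed
  next
    case (incl h)
    then consider "h = A" | "h = B" by blast
    then show ?case
    proof cases
      case 1 then show ?thesis by (auto simp: N_A) blast
    next
      case 2 then show ?thesis using N_B[of _ _ _ 1] by auto blast
    qed
  next
    case (inv h)
    then consider "h = A" | "h = B" by blast
    then show ?case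
    proof cases
      case 1 then show ?thesis by (auto simp: \<open>\<And>y. \<lbrakk>y \<in> carrier G; y [^] n = \<one>\<rbrakk> \<Longrightarrow> inv y = y [^] (n - 1)\<close> n N_Apow) blast
    next
      case 2 then show ?thesis by (auto simp: \<open>\<And>y. \<lbrakk>y \<in> carrier G; y [^] n = \<one>\<rbrakk> \<Longrightarrow> inv y = y [^] (n - 1)\<close> n N_B) blast
    qed
  next
    case (eng h1 h2)
    have h: "h1 \<in> carrier G" "h2 \<in> carrier G"
      using eng(1,2) generate_in_carrier[of "{A, B}"] by auto
    show ?case
    proof
      fix s assume s: "s \<in> ?S"
      then have "s \<otimes> h1 \<otimes> h2 \<in> ?S" using eng(3,4) by blast
      moreover have "s \<in> carrier G" using s Sub by blast
      ultimately show "s \<otimes> (h1 \<otimes> h2) \<in> ?S" using h by (simp add: m_assoc)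
    qed
  qed
  moreover have "\<one> \<in> ?S" using N_0[symmetric] by blast
  ultimately have "\<one> \<otimes> x \<in> ?S" by blast
  moreover have "x \<in> carrier G" using x generate_in_carrier[of "{A, B}"] by auto
  ultimately show thesis using that by auto
qed

text \<open>With B^n = 1 the rule for moving B^n past A reads A = A D^n B^(geo a n).\<close>

lemma Dpow_eq:
  assumes "B [^] (n::nat) = \<one>"
  shows "D [^] n = inv (B [^] geo a n)"
proof -
  have "A \<otimes> (D [^] n \<otimes> B [^] geo a n) = A \<otimes> \<one>"
    using Bpow_A_nat[of n] assms by simp
  then have "D [^] n \<otimes> B [^] geo a n = \<one>" by (simp del: r_one)
  then show ?thesis by (intro inv_equality[symmetric]) auto
qed

lemma Dpow_order:
  assumes "B [^] (n::nat) = \<one>"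
  shows "D [^] (n * n) = \<one>"
proof -
  have "D [^] (n * n) = inv (B [^] geo a n) [^] n"
    using Dpow_eq[OF assms] by (simp flip: nat_pow_pow)
  also have "\<dots> = inv ((B [^] n) [^] geo a n)"
    by (simp add: nat_pow_inv nat_pow_pow mult.commute)
  finally show ?thesis by (simp add: assms)
qed

lemma pow_mod_nat:
  assumes "x \<in> carrier G" "x [^] (n::nat) = \<one>"
  shows "x [^] (i::nat) = x [^] (i mod n)"
proof -
  have "x [^] (n * (i div n) + i mod n) = (x [^] n) [^] (i div n) \<otimes> x [^] (i mod n)"
    by (simp add: assms(1) nat_pow_mult nat_pow_pow)
  then show ?thesis using assms by simp
qed

text \<open>The exponents reduce modulo n, n^2 and n; the bound n^2 for D is that of
  \<open>Dpow_order\<close>.\<close>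

lemma finite_generate:
  assumes n: "n > 0" "A [^] (n::nat) = \<one>" "B [^] n = \<one>"
  shows "finite (generate G {A, B})"
proof (rule finite_subset)
  show "generate G {A, B} \<subseteq> (\<lambda>(i, k, j). N i k j) ` ({..<n} \<times> {..<n * n} \<times> {..<n})"
  proof
    fix x assume "x \<in> generate G {A, B}"
    then obtain i k j where x: "x = N i k j" using generate_N[OF n] by blast
    have "x = N (i mod n) (k mod (n * n)) (j mod n)"
      unfolding x N_def using pow_mod_nat[OF closed(1) n(2), of i] pow_mod_nat[OF closed(2) n(3), of j]
        pow_mod_nat[OF closed(3) Dpow_order[OF n(3)], of k] by simp
    then show "x \<in> (\<lambda>(i, k, j). N i k j) ` ({..<n} \<times> {..<n * n} \<times> {..<n})"
      using n(1) by (auto intro!: image_eqI[where x = "(i mod n, k mod (n * n), j mod n)"])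
  qed
qed auto

end

section \<open>Geometric sums modulo prime powers\<close>

lemma geo_eq_sum: "int (geo a n) = int a * (\<Sum>l<n. int a ^ l)"
proof (induction n)
  case (Suc n)
  have "(\<Sum>l<Suc n. int a ^ l) = 1 + int a * (\<Sum>l<n. int a ^ l)"
    unfolding sum.lessThan_Suc_shift by (simp add: sum_distrib_left)
  then show ?case using Suc by (simp add: algebra_simps)
qed simp

lemma sum_power_mult:
  fixes x :: int
  shows "(\<Sum>l<n * k. x ^ l) = (\<Sum>l<n. x ^ l) * (\<Sum>l<k. (x ^ n) ^ l)"
proof (induction k)
  case (Suc k)
  have *: "(\<Sum>l<u + v. x ^ l) = (\<Sum>l<u. x ^ l) + (\<Sum>l<v. x ^ (u + l))" for u v
    by (induction v) (auto simp: algebra_simps)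
  have "(\<Sum>l<n * k + n. x ^ l) = (\<Sum>l<n * k. x ^ l) + (\<Sum>l<n. x ^ (n * k + l))"
    by (rule *)
  also have "(\<Sum>l<n. x ^ (n * k + l)) = (\<Sum>l<n. x ^ l) * (x ^ n) ^ k"
    by (simp add: power_add sum_distrib_left sum_distrib_right mult.commute flip: power_mult)
  finally show ?case by (simp add: Suc distrib_left add.commute)
qed simp

lemma sum_power_pred:
  fixes x :: int
  shows "(x - 1) * (\<Sum>l<n. x ^ l) = x ^ n - 1"
  by (simp add: power_diff_1_eq)

lemma sum_power_cong_1:
  fixes x :: int
  assumes "[x = 1] (mod s)"
  shows "[(\<Sum>l<n. x ^ l) = int n] (mod s)"
proof -
  have "[(\<Sum>l<n. x ^ l) = (\<Sum>l<n. 1)] (mod s)"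
    using cong_pow[OF assms] by (intro cong_sum) simp
  then show ?thesis by simp
qed

text \<open>With y = x^(r^k), the difference y^r - 1 is y - 1 times a sum of r terms, each 1 modulo
  r; so every step gains a factor r.\<close>

lemma prime_power_dvd_power_diff:
  fixes x :: int
  assumes "[x = 1] (mod int r)"
  shows "[x ^ (r ^ k) = 1] (mod int r ^ Suc k)"
proof (induction k)
  case (Suc k)
  let ?y = "x ^ (r ^ k)"
  have "[?y = 1] (mod int r)"
    by (rule cong_dvd_modulus[OF Suc]) simp
  then have "int r dvd (\<Sum>l<r. ?y ^ l)"
    using sum_power_cong_1[of ?y "int r" r] by (metis cong_dvd_iff dvd_refl)
  moreover have "int r ^ Suc k dvd ?y - 1" using Suc by (simp add: cong_iff_dvd_diff)
  ultimately have "int r ^ Suc k * int r dvd (?y - 1) * (\<Sum>l<r. ?y ^ l)"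
    by (rule mult_dvd_mono[rotated])
  then have "int r ^ Suc k * int r dvd ?y ^ r - 1" unfolding sum_power_pred .
  moreover have "x ^ (r ^ Suc k) = ?y ^ r" by (simp add: mult.commute flip: power_mult)
  ultimately show ?case by (simp add: cong_iff_dvd_diff mult.commute)
qed (use assms in simp)

text \<open>The sum over r n terms is the sum over n terms times a sum of r powers of x^n. As x^n =
  1 + r z, the second factor is r + C(r, 2) r z modulo r^2, which is r because an odd r divides C(r,
  2).\<close>

lemma sum_power_cong_odd_prime:
  fixes x :: int
  assumes r: "odd r" and x: "[x = 1] (mod int r)"
  shows "[(\<Sum>l<r ^ k * t. x ^ l) = int (r ^ k * t)] (mod int r ^ Suc k)"
proof (induction k)
  case 0
  then show ?case using sum_power_cong_1[OF x, of t] by simp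
next
  case (Suc k)
  let ?n = "r ^ k * t"
  have "[x ^ ?n = 1] (mod int r)" using cong_pow[OF x, of ?n] by simp
  then obtain z where z: "x ^ ?n = 1 + int r * z"
    by (metis add.commute cong_iff_lin cong_sym)
  have "(int r)^2 dvd (\<Sum>l<k. (1 + int r * z) ^ l - (1 + int l * (int r * z)))" for k
  proof (rule dvd_sum)
    fix l
    show "(int r)^2 dvd (1 + int r * z) ^ l - (1 + int l * (int r * z))"
    proof (induction l)
      case (Suc l)
      have "(1 + int r * z) ^ Suc l - (1 + int (Suc l) * (int r * z)) =
        (1 + int r * z) * ((1 + int r * z) ^ l - (1 + int l * (int r * z))) + (int r)^2 * (int l * z^2)"
        by (simp add: algebra_simps power2_eq_square)
      then show ?case using Suc by simp
    qed simp
  qed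
  then have 1: "(int r)^2 dvd (\<Sum>l<r. (1 + int r * z) ^ l) - (int r + int (r choose 2) * (int r * z))"
    by (simp add: sum_subtractf sum.distrib sum_id_choose flip: sum_distrib_right)
  have "int r dvd int (r choose 2)"
  proof -
    have "int r dvd 2 * int (r choose 2)" by (simp add: two_choose_two)
    moreover have "coprime (int r) 2" using r by simp
    ultimately show ?thesis by (simp add: coprime_dvd_mult_right_iff)
  qed
  then have 2: "(int r)^2 dvd int (r choose 2) * (int r * z)"
    by (simp add: power2_eq_square mult_dvd_mono flip: mult.assoc)
  from dvd_add[OF 1 2] obtain w where w: "(\<Sum>l<r. (1 + int r * z) ^ l) = int r + (int r)^2 * w"
    by (auto simp: dvd_def algebra_simps)
  obtain y where y: "(\<Sum>l<?n. x ^ l) = int ?n + int r ^ Suc k * y"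
    using Suc by (metis cong_iff_lin cong_sym)
  have "(\<Sum>l<r ^ Suc k * t. x ^ l) = (\<Sum>l<?n * r. x ^ l)" by (simp add: mult_ac)
  also have "\<dots> = (\<Sum>l<?n. x ^ l) * (\<Sum>l<r. (x ^ ?n) ^ l)" by (rule sum_power_mult)
  also have "\<dots> = (int ?n + int r ^ Suc k * y) * (int r + (int r)^2 * w)"
    by (simp only: z y w)
  also have "\<dots> = int (r ^ Suc k * t) + int r ^ Suc (Suc k) * (int t * w + y + y * int r * w)"
    by (simp add: algebra_simps power2_eq_square)
  finally show ?case by (simp add: cong_iff_dvd_diff)
qed

text \<open>Write b = r^k t with r not dividing t. For a prime s dividing b, the order of a modulo s
  divides b and s - 1. As s \<le> r, it is prime to r and so divides t; this is where the largest
  prime is needed to drop one factor r from the exponent b. The final disjunction depends on whether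
  r divides a - 1; for r = 2 both cases occur.\<close>

lemma largest_prime_arith:
  fixes a b r i :: nat
  assumes b: "b > 1" and cop: "coprime a b" and dvd: "b dvd geo a b"
    and r: "r = Max (prime_factors b)" and i: "i = b div r"
  shows "prime r" "r dvd b" "[int a ^ i = 1] (mod int b)"
    "b dvd geo a i \<or> [geo a i = i] (mod b)"
proof -
  have fin: "finite (prime_factors b)" and ne: "prime_factors b \<noteq> {}"
    using b by (auto simp: prime_factorization_empty_iff)
  have rmem: "r \<in> prime_factors b" unfolding r by (rule Max_in[OF fin ne])
  then show pr: "prime r" and rb: "r dvd b" by (auto simp: in_prime_factors_iff)
  have rmax: "s \<le> r" if "prime s" "s dvd b" for s
    unfolding r using that b fin by (intro Max_ge) (auto simp: in_prime_factors_iff)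
  obtain k t where kt: "b = r ^ k * t" "\<not> r dvd t"
    using b pr multiplicity_decompose'[of b r] by (metis not_prime_unit not_one_less_zero mult.commute)
  then obtain e where e: "k = Suc e" using rb pr by (cases k) auto
  have i_eq: "i = r ^ e * t" using kt e pr by (simp add: i prime_gt_0_nat)
  have b_eq: "b = i * r" by (simp add: i_eq kt e)
  define S where "S n = (\<Sum>l<n. int a ^ l)" for n
  define R where "R = (\<Sum>l<r. (int a ^ i) ^ l)"
  have "int b dvd int a * S b"
    using dvd unfolding S_def geo_eq_sum[symmetric] by simp
  moreover have copi: "coprime (int b) (int a)" using cop by (simp add: coprime_commute)
  ultimately have Sb: "int b dvd S b" by (simp add: coprime_dvd_mult_right_iff)
  have SbR: "S b = S i * R" by (simp add: S_def R_def b_eq sum_power_mult)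
  have at: "[a ^ t = 1] (mod s)" if s: "prime s" "s dvd b" for s
  proof -
    have cs: "coprime s a" using cop s(2) by (meson coprime_commute coprime_divisors dvd_refl)
    have "int b dvd (int a - 1) * S b" using Sb by simp
    then have "int s dvd int a ^ b - 1" using s(2) unfolding S_def sum_power_pred
      by (meson dvd_trans of_nat_dvd_iff)
    then have "[int (a ^ b) = int 1] (mod int s)" by (simp add: cong_iff_dvd_diff)
    then have "[a ^ b = 1] (mod s)" unfolding cong_int_iff .
    then have d: "ord s a dvd b" by (simp only: ord_divides)
    have "ord s a dvd totient s" by (rule order_divides_totient[OF cs])
    then have "ord s a < s" using s(1) prime_gt_1_nat[OF s(1)]
      by (auto simp: totient_prime dest!: dvd_imp_le)
    moreover have "ord s a > 0" using cs by (simp add: ord_eq_0)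
    moreover have "s \<le> r" by (rule rmax[OF s])
    ultimately have "\<not> r dvd ord s a" by (auto dest: dvd_imp_le)
    then have "coprime (ord s a) (r ^ k)"
      using pr by (metis coprime_commute coprime_power_left_iff prime_imp_coprime)
    then have "ord s a dvd t" using d unfolding kt by (simp add: coprime_dvd_mult_right_iff)
    then show ?thesis by (simp only: ord_divides)
  qed
  have t0: "t > 0" using kt b by (cases t) auto
  \<comment> \<open>Modulo a common prime divisor s all r terms of R are 1, so s divides r; but r
    does not divide t.\<close>
  have "coprime (int t) R"
  proof (rule ccontr)
    assume "\<not> coprime (int t) R"
    then have "\<not> is_unit (gcd (int t) R)" by (metis is_unit_gcd)
    moreover have "gcd (int t) R \<noteq> 0" using t0 by simp
    ultimately obtain s' where "prime s'" "s' dvd gcd (int t) R" by (metis prime_divisorE)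
    then have s': "prime s'" "s' dvd int t" "s' dvd R" by auto
    define s where "s = nat s'"
    have ss: "s' = int s" using s'(1) by (simp add: s_def prime_ge_0_int)
    have s: "prime s" "s dvd t" "int s dvd R" using s' unfolding ss by auto
    then have sb: "s dvd b" by (simp add: kt)
    have "[a ^ t = 1] (mod s)" using at s sb by blast
    then have "[int (a ^ t) = int 1] (mod int s)" unfolding cong_int_iff .
    then have "[(int a ^ t) ^ (r ^ e) = 1 ^ (r ^ e)] (mod int s)" by (intro cong_pow) simp
    then have "[int a ^ i = 1] (mod int s)" by (simp add: i_eq mult.commute flip: power_mult)
    then have "[R = int r] (mod int s)" unfolding R_def by (rule sum_power_cong_1)
    then have "s dvd r" using s(3) by (metis cong_dvd_iff of_nat_dvd_iff)
    then have "s = r" using s(1) pr primes_dvd_imp_eq by blast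
    then show False using s(2) kt(2) by simp
  qed
  moreover have "int t dvd S i * R" using Sb SbR kt(1) by (metis dvd_trans dvd_triv_right of_nat_dvd_iff)
  ultimately have tS: "int t dvd S i" by (simp add: coprime_dvd_mult_left_iff)
  have copt: "coprime (int r ^ Suc e) (int t)"
    using kt(2) pr prime_imp_coprime by (metis coprime_int_iff coprime_power_left_iff of_nat_power)
  have comb: "int b dvd x" if "int r ^ Suc e dvd x" "int t dvd x" for x
    using divides_mult[OF that copt] by (simp add: kt e)
  have "[int (a ^ t) = int 1] (mod int r)" unfolding cong_int_iff by (rule at[OF pr rb])
  from prime_power_dvd_power_diff[OF this[unfolded of_nat_1], of e]
  have ri: "int r ^ Suc e dvd int a ^ i - 1"
    by (simp add: i_eq cong_iff_dvd_diff mult.commute flip: power_mult)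
  have "int b dvd int a ^ i - 1"
  proof (rule comb[OF ri])
    show "int t dvd int a ^ i - 1" using dvd_mult[OF tS, of "int a - 1"] unfolding S_def sum_power_pred .
  qed
  then show ai: "[int a ^ i = 1] (mod int b)" by (simp add: cong_iff_dvd_diff)
  \<comment> \<open>The second summand is a^i - 1, which is 0 modulo b.\<close>
  have geo: "int (geo a i) = S i + (int a - 1) * S i"
    by (simp add: geo_eq_sum S_def algebra_simps)
  show "b dvd geo a i \<or> [geo a i = i] (mod b)"
  proof (cases "int r dvd int a - 1")
    case False
    then have "coprime (int r ^ Suc e) (int a - 1)"
      using pr by (simp add: prime_imp_coprime)
    moreover have "int r ^ Suc e dvd (int a - 1) * S i"
      using ri unfolding S_def sum_power_pred .
    ultimately have "int r ^ Suc e dvd S i" by (simp only: coprime_dvd_mult_right_iff)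
    then have "int b dvd S i" using tS by (rule comb)
    then have "int b dvd int (geo a i)" unfolding geo by simp
    then show ?thesis by simp
  next
    case True
    then have a1: "[int a = 1] (mod int r)" by (simp add: cong_iff_dvd_diff)
    show ?thesis
    proof (cases "r = 2")
      case False
      then have "odd r" using pr by (metis two_is_prime_nat primes_dvd_imp_eq)
      from sum_power_cong_odd_prime[OF this a1, of e t]
      have 1: "int r ^ Suc e dvd S i - int i" by (simp add: S_def i_eq cong_iff_dvd_diff)
      have 2: "int t dvd S i - int i" using tS by (simp add: i_eq)
      have "int b dvd (S i - int i) + (int a - 1) * S i"
        using comb[OF 1 2] ai unfolding S_def sum_power_pred by (simp add: cong_iff_dvd_diff)
      then have "int b dvd int (geo a i) - int i" unfolding geo by (simp add: algebra_simps)
      then have "[int (geo a i) = int i] (mod int b)" by (simp add: cong_iff_dvd_diff)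
      then show ?thesis unfolding cong_int_iff ..
    next
      case True
      \<comment> \<open>With 2 as its largest prime factor, b is a power of 2.\<close>
      have "t = 1"
      proof (rule ccontr)
        assume "t \<noteq> 1"
        then obtain s where s: "prime s" "s dvd t" using prime_factor_nat by blast
        then have "s \<le> 2" using rmax[of s] kt(1) True by simp
        then have "s = 2" using prime_ge_2_nat[OF s(1)] by simp
        then show False using s(2) kt(2) True by simp
      qed
      have "int (2 ^ k') dvd S (2 ^ k')" for k'
      proof (induction k')
        case (Suc k')
        have "even (1 + int a ^ (2 ^ k'))" using a1 True by (simp add: cong_iff_dvd_diff)
        moreover have "S (2 ^ Suc k') = S (2 ^ k') * (1 + int a ^ (2 ^ k'))"
          using sum_power_mult[of "int a" "2 ^ k'" 2] by (simp add: S_def mult.commute numeral_2_eq_2)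
        ultimately have "int (2 ^ k') * 2 dvd S (2 ^ Suc k')" using mult_dvd_mono[OF Suc] by simp
        then show ?case by (simp add: mult.commute)
      qed simp
      then have "int i dvd S i" using i_eq True \<open>t = 1\<close> by simp
      then have "int i dvd int (geo a i)" by (simp add: geo_eq_sum S_def)
      then have "i dvd geo a i" by simp
      \<comment> \<open>Here b = 2 i, so the parity of c decides between the two
        alternatives.\<close>
      then obtain c where c: "geo a i = i * c" by (auto elim: dvdE)
      show ?thesis
      proof (cases "even c")
        case True
        then show ?thesis using c b_eq \<open>r = 2\<close> by auto
      next
        case False
        then obtain c' where "c = 2 * c' + 1" by (rule oddE)
        then have "geo a i = i + c' * b" using c b_eq \<open>r = 2\<close> by (simp add: algebra_simps)
        then show ?thesis by (simp add: cong_def)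
      qed
    qed
  qed
qed


section \<open>Upper central series and nilpotency\<close>

context group
begin

lemma commute_generate:
  assumes S: "S \<subseteq> carrier G" and x: "x \<in> carrier G" and c: "\<And>s. s \<in> S \<Longrightarrow> x \<otimes> s = s \<otimes> x"
    and y: "y \<in> generate G S"
  shows "x \<otimes> y = y \<otimes> x"
  using y
proof (induction rule: generate.induct)
  case (inv h)
  then have h: "h \<in> carrier G" "x \<otimes> h = h \<otimes> x" using S c by auto
  have "inv h \<otimes> (x \<otimes> h) \<otimes> inv h = inv h \<otimes> (h \<otimes> x) \<otimes> inv h" using h(2) by simp
  then show ?case using h(1) x by (simp add: m_assoc)
next
  case (eng h1 h2)
  then have h: "h1 \<in> carrier G" "h2 \<in> carrier G" using generate_in_carrier[OF S] by auto
  have "x \<otimes> (h1 \<otimes> h2) = (x \<otimes> h1) \<otimes> h2" using h x by (simp add: m_assoc)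
  also have "\<dots> = h1 \<otimes> (x \<otimes> h2)" unfolding eng(3) using h x by (simp add: m_assoc)
  also have "\<dots> = (h1 \<otimes> h2) \<otimes> x" unfolding eng(4) using h x by (simp add: m_assoc)
  finally show ?case .
qed (use c x in auto)

lemma pow_commute:
  assumes "x \<in> carrier G" "y \<in> carrier G" "x \<otimes> y = y \<otimes> x"
  shows "x \<otimes> y [^] (n::nat) = y [^] n \<otimes> x"
proof (induction n)
  case (Suc n)
  have "x \<otimes> y [^] Suc n = (x \<otimes> y [^] n) \<otimes> y" using assms(1,2) by (simp add: m_assoc)
  also have "\<dots> = y [^] n \<otimes> (x \<otimes> y)" unfolding Suc using assms(1,2) by (simp add: m_assoc)
  also have "\<dots> = y [^] Suc n \<otimes> x" unfolding assms(3) using assms(1,2) by (simp add: m_assoc)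
  finally show ?case .
qed (use assms in simp)

text \<open>Since w commutes with g and h, moving g^s past h produces w^s, and moving g past h^t
  produces w^t. Both are trivial, so the order of w divides s and t.\<close>

lemma central_commutator_trivial:
  assumes g: "g \<in> carrier G" and h: "h \<in> carrier G" and w: "w \<in> carrier G"
    and gh: "g \<otimes> h = h \<otimes> g \<otimes> w" and wg: "w \<otimes> g = g \<otimes> w" and wh: "w \<otimes> h = h \<otimes> w"
    and s: "g [^] (s::nat) = \<one>" and t: "h [^] (t::nat) = \<one>" and cop: "coprime s t"
  shows "w = \<one>"
proof -
  have 1: "g [^] n \<otimes> h = h \<otimes> (g [^] n \<otimes> w [^] n)" for n :: nat
  proof (induction n)
    case (Suc n)
    have "g [^] Suc n \<otimes> h = g [^] n \<otimes> (g \<otimes> h)" using g h by (simp add: m_assoc)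
    also have "\<dots> = (g [^] n \<otimes> h) \<otimes> (g \<otimes> w)" unfolding gh using g h w by (simp add: m_assoc)
    also have "\<dots> = h \<otimes> (g [^] n \<otimes> ((w [^] n \<otimes> g) \<otimes> w))"
      unfolding Suc using g h w by (simp add: m_assoc)
    also have "w [^] n \<otimes> g = g \<otimes> w [^] n"
      using pow_commute[OF g w wg[symmetric], of n] by simp
    finally show ?case using g h w by (simp add: m_assoc)
  qed (use h in simp)
  have 2: "g \<otimes> h [^] n = h [^] n \<otimes> (g \<otimes> w [^] n)" for n :: nat
  proof (induction n)
    case (Suc n)
    have "g \<otimes> h [^] Suc n = (g \<otimes> h [^] n) \<otimes> h" using g h by (simp add: m_assoc)
    also have "\<dots> = h [^] n \<otimes> (g \<otimes> (w [^] n \<otimes> h))" unfolding Suc using g h w by (simp add: m_assoc)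
    also have "w [^] n \<otimes> h = h \<otimes> w [^] n"
      using pow_commute[OF h w wh[symmetric], of n] by simp
    also have "h [^] n \<otimes> (g \<otimes> (h \<otimes> w [^] n)) = h [^] n \<otimes> ((g \<otimes> h) \<otimes> w [^] n)"
      using g h w by (simp add: m_assoc)
    also have "\<dots> = h [^] Suc n \<otimes> (g \<otimes> (w \<otimes> w [^] n))" unfolding gh using g h w by (simp add: m_assoc)
    also have "w \<otimes> w [^] n = w [^] Suc n" using w by (simp only: nat_pow_Suc2)
    finally show ?case .
  qed (use g in simp)
  have "h \<otimes> w [^] s = h \<otimes> \<one>" using 1[of s] g h w s by simp
  then have ws: "w [^] s = \<one>" using h w by (simp del: r_one)
  have "g \<otimes> w [^] t = g \<otimes> \<one>" using 2[of t] g h w t by simp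
  then have "w [^] t = \<one>" using g w by (simp del: r_one)
  with ws have "local.ord w dvd s" "local.ord w dvd t" using w by (auto simp: pow_eq_id)
  with cop have "local.ord w = 1" using coprime_common_divisor_nat by blast
  then show ?thesis using w ord_eq_1 by blast
qed

lemma subgroup_center: "subgroup (center G) G"
proof
  fix x y assume x: "x \<in> center G" and y: "y \<in> center G"
  then have c: "x \<in> carrier G" "y \<in> carrier G" by (auto simp: center_def)
  show "x \<otimes> y \<in> center G"
    unfolding center_def
  proof (intro CollectI conjI ballI)
    fix z assume z: "z \<in> carrier G"
    have "x \<otimes> y \<otimes> z = x \<otimes> (y \<otimes> z)" using c z by (simp add: m_assoc)
    also have "y \<otimes> z = z \<otimes> y" using y z by (auto simp: center_def)
    also have "x \<otimes> (z \<otimes> y) = (x \<otimes> z) \<otimes> y" using c z by (simp add: m_assoc)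
    also have "x \<otimes> z = z \<otimes> x" using x z by (auto simp: center_def)
    finally show "x \<otimes> y \<otimes> z = z \<otimes> (x \<otimes> y)" using c z by (simp add: m_assoc)
  qed (use c in simp)
next
  fix x assume x: "x \<in> center G"
  then have c: "x \<in> carrier G" by (auto simp: center_def)
  show "inv x \<in> center G"
    unfolding center_def
  proof (intro CollectI conjI ballI)
    fix z assume z: "z \<in> carrier G"
    have "x \<otimes> z = z \<otimes> x" using x z by (auto simp: center_def)
    then have "inv x \<otimes> (x \<otimes> z) \<otimes> inv x = inv x \<otimes> (z \<otimes> x) \<otimes> inv x" by simp
    then show "inv x \<otimes> z = z \<otimes> inv x" using c z by (simp add: m_assoc)
  qed (use c in simp)
qed (auto simp: center_def)

lemma rcos_eq_iff:
  assumes K: "K \<lhd> G" and u: "u \<in> carrier G" and v: "v \<in> carrier G"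
  shows "K #> u = K #> v \<longleftrightarrow> inv v \<otimes> u \<in> K"
proof -
  interpret K: normal K G by (rule K)
  have "K #> u = K #> v \<longleftrightarrow> u \<otimes> inv v \<in> K"
    using K.rcos_module[OF is_group v u] repr_independence[OF _ v K.subgroup_axioms, of u]
      rcos_self[OF u K.subgroup_axioms] by blast
  also have "\<dots> \<longleftrightarrow> inv v \<otimes> u \<in> K"
  proof
    assume "u \<otimes> inv v \<in> K"
    from K.inv_op_closed1[OF v this] show "inv v \<otimes> u \<in> K"
      using u v by (simp add: m_assoc)
  next
    assume "inv v \<otimes> u \<in> K"
    from K.inv_op_closed2[OF v this] show "u \<otimes> inv v \<in> K"
      using u v by (simp add: m_assoc)
  qed
  finally show ?thesis .
qed

lemma rcos_in_center_iff:
  assumes K: "K \<lhd> G" and x: "x \<in> carrier G"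
  shows "K #> x \<in> center (G Mod K) \<longleftrightarrow> (\<forall>y\<in>carrier G. commutator G x y \<in> K)"
proof -
  interpret K: normal K G by (rule K)
  have "K #> (x \<otimes> y) = K #> (y \<otimes> x) \<longleftrightarrow> commutator G x y \<in> K" if "y \<in> carrier G" for y
    using rcos_eq_iff[OF K, of "x \<otimes> y" "y \<otimes> x"] x that
    by (simp add: commutator_def inv_mult_group m_assoc)
  then show ?thesis
    using x by (auto simp: center_def carrier_FactGroup K.rcos_sum)
qed

lemma upper_central_normal: "upper_central G i \<lhd> G"
proof (induction i)
  case 0
  show ?case by (simp add: one_is_normal)
next
  case (Suc i)
  let ?K = "upper_central G i"
  interpret K: normal ?K G by (rule Suc)
  interpret Q: group "G Mod ?K" by (rule K.factorgroup_is_group)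
  interpret Z: subgroup "center (G Mod ?K)" "G Mod ?K" by (rule Q.subgroup_center)
  interpret \<pi>: group_hom G "G Mod ?K" "\<lambda>x. ?K #> x"
    by (intro group_hom.intro group_hom_axioms.intro is_group Q.is_group K.r_coset_hom_Mod)
  have sub: "subgroup (upper_central G (Suc i)) G"
  proof
    show "\<one> \<in> upper_central G (Suc i)" using Z.one_closed \<pi>.hom_one by simp
    show "x \<otimes> y \<in> upper_central G (Suc i)"
      if "x \<in> upper_central G (Suc i)" "y \<in> upper_central G (Suc i)" for x y
      using that Z.m_closed \<pi>.hom_mult by auto
    show "inv x \<in> upper_central G (Suc i)" if "x \<in> upper_central G (Suc i)" for x
      using that Z.m_inv_closed \<pi>.hom_inv by auto
  qed auto
  have "g \<otimes> x \<otimes> inv g \<in> upper_central G (Suc i)"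
    if g: "g \<in> carrier G" and x: "x \<in> upper_central G (Suc i)" for g x
  proof -
    have xc: "x \<in> carrier G" "?K #> x \<in> center (G Mod ?K)" using x by auto
    have "inv x \<otimes> (g \<otimes> x \<otimes> inv g) = commutator G x (inv g)"
      using xc g by (simp add: commutator_def m_assoc)
    also have "\<dots> \<in> ?K" using xc g rcos_in_center_iff[OF Suc xc(1)] by simp
    finally have "?K #> (g \<otimes> x \<otimes> inv g) = ?K #> x"
      using xc g by (subst rcos_eq_iff[OF Suc]) auto
    then have "?K #> (g \<otimes> x \<otimes> inv g) \<in> center (G Mod ?K)" using xc(2) by (simp only:)
    moreover have "g \<otimes> x \<otimes> inv g \<in> carrier G" using xc g by simp
    ultimately show ?thesis unfolding upper_central.simps by blast
  qed
  then show ?case using sub by (simp add: normal_inv_iff del: upper_central.simps)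
qed

lemma upper_central_Suc_iff:
  "x \<in> upper_central G (Suc i) \<longleftrightarrow> x \<in> carrier G \<and> (\<forall>y\<in>carrier G. commutator G x y \<in> upper_central G i)"
  using rcos_in_center_iff[OF upper_central_normal] by auto

lemma upper_central_1: "upper_central G 1 = center G"
proof -
  have "commutator G x y = \<one> \<longleftrightarrow> x \<otimes> y = y \<otimes> x" if "x \<in> carrier G" "y \<in> carrier G" for x y
  proof -
    have "commutator G x y = inv (y \<otimes> x) \<otimes> (x \<otimes> y)"
      using that by (simp add: commutator_def inv_mult_group m_assoc)
    moreover have "inv (y \<otimes> x) \<otimes> (x \<otimes> y) = \<one> \<longleftrightarrow> x \<otimes> y = y \<otimes> x"
    proof
      assume "inv (y \<otimes> x) \<otimes> (x \<otimes> y) = \<one>"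
      then have "(y \<otimes> x) \<otimes> (inv (y \<otimes> x) \<otimes> (x \<otimes> y)) = (y \<otimes> x) \<otimes> \<one>" by (simp only:)
      then show "x \<otimes> y = y \<otimes> x" using that by (simp only: inv_mult_cancel m_closed r_one)
    next
      assume "x \<otimes> y = y \<otimes> x"
      then show "inv (y \<otimes> x) \<otimes> (x \<otimes> y) = \<one>" using that by (simp only: l_inv m_closed)
    qed
    ultimately show ?thesis by simp
  qed
  then have "x \<in> upper_central G (Suc 0) \<longleftrightarrow> x \<in> center G" for x
    unfolding upper_central_Suc_iff by (auto simp: center_def)
  then show ?thesis by auto
qed

lemma upper_central_mono: "upper_central G i \<subseteq> upper_central G (Suc i)"
proof
  fix x assume x: "x \<in> upper_central G i"
  interpret K: normal "upper_central G i" G by (rule upper_central_normal)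
  have xc: "x \<in> carrier G" using x K.subset by auto
  have "commutator G x y \<in> upper_central G i" if y: "y \<in> carrier G" for y
  proof -
    have "commutator G x y = inv x \<otimes> (inv y \<otimes> x \<otimes> y)" using xc y by (simp add: commutator_def m_assoc)
    then show ?thesis using x K.m_inv_closed K.inv_op_closed1[OF y x] by simp
  qed
  then show "x \<in> upper_central G (Suc i)" using xc upper_central_Suc_iff by blast
qed

text \<open>If the commutator lies in Z_(i+1), it is central modulo Z_i and therefore trivial there
  by \<open>central_commutator_trivial\<close>. Descending from Z_c one reaches Z_0.\<close>

lemma coprime_orders_commute:
  assumes nilp: "upper_central G c = carrier G"
    and g: "g \<in> carrier G" "g [^] (s::nat) = \<one>" and h: "h \<in> carrier G" "h [^] (t::nat) = \<one>"
    and cop: "coprime s t"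
  shows "g \<otimes> h = h \<otimes> g"
proof -
  define w where "w = commutator G g h"
  have w: "w \<in> carrier G" using g h by (simp add: w_def commutator_def)
  have gh: "g \<otimes> h = h \<otimes> g \<otimes> w" using g h by (simp add: w_def commutator_def m_assoc)
  have "w \<in> upper_central G (c - j)" for j
  proof (induction j)
    case (Suc j)
    show ?case
    proof (cases "c - j")
      case 0
      then show ?thesis using Suc by simp
    next
      case (Suc i)
      then have wi: "w \<in> upper_central G (Suc i)" and cj: "c - Suc j = i"
        using \<open>w \<in> upper_central G (c - j)\<close> by auto
      let ?K = "upper_central G i"
      interpret K: normal ?K G by (rule upper_central_normal)
      interpret Q: group "G Mod ?K" by (rule K.factorgroup_is_group)
      interpret \<pi>: group_hom G "G Mod ?K" "\<lambda>x. ?K #> x"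
        by (intro group_hom.intro group_hom_axioms.intro is_group Q.is_group K.r_coset_hom_Mod)
      have wz: "?K #> w \<in> center (G Mod ?K)" using wi by simp
      have "?K #> w = \<one>\<^bsub>G Mod ?K\<^esub>"
      proof (rule Q.central_commutator_trivial[where g = "?K #> g" and h = "?K #> h" and s = s and t = t])
        show "(?K #> g) \<otimes>\<^bsub>G Mod ?K\<^esub> (?K #> h) = (?K #> h) \<otimes>\<^bsub>G Mod ?K\<^esub> (?K #> g) \<otimes>\<^bsub>G Mod ?K\<^esub> (?K #> w)"
          using g h w arg_cong[OF gh, of "\<lambda>x. ?K #> x"] by (simp only: \<pi>.hom_mult m_closed)
        show "(?K #> g) [^]\<^bsub>G Mod ?K\<^esub> s = \<one>\<^bsub>G Mod ?K\<^esub>"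
          using g by (simp flip: \<pi>.hom_nat_pow)
        show "(?K #> h) [^]\<^bsub>G Mod ?K\<^esub> t = \<one>\<^bsub>G Mod ?K\<^esub>"
          using h by (simp flip: \<pi>.hom_nat_pow)
      qed (use g h w wz cop \<pi>.hom_closed in \<open>auto simp: center_def\<close>)
      then have "?K #> w = ?K" by simp
      then have "w \<in> ?K" using rcos_self[OF w K.subgroup_axioms] by simp
      then show ?thesis by (simp add: cj)
    qed
  qed (use nilp w in simp)
  from this[of c] have "w = \<one>" by simp
  then show ?thesis using gh g h by simp
qed

end

section \<open>Nilpotency\<close>

context macdonald_nat
begin

text \<open>With g = gcd(a, ord A), the element A^(ord A / g) becomes trivial when raised to the
  power a, that is, when conjugated by D. So it is trivial itself, and g = 1.\<close>

lemma coprime_ord: "coprime a (local.ord A)" if "local.ord A > 0"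
proof -
  define g where "g = gcd a (local.ord A)"
  define i where "i = local.ord A div g"
  have gi: "local.ord A = g * i" "g dvd a" by (auto simp: g_def i_def)
  have "local.ord A dvd a * i" using gi by (simp add: mult_dvd_mono)
  then have "A [^] (a * i) = \<one>" by (simp add: pow_eq_id)
  then have "D \<otimes> A [^] i = D \<otimes> \<one>" using Dpow_Apow_nat[of 1 i] by simp
  then have "A [^] i = \<one>" by (simp del: r_one)
  then have "g * i dvd i" using gi by (simp add: pow_eq_id)
  then have "g = 1" using that gi by simp
  then show ?thesis by (simp add: g_def coprime_iff_gcd_eq_1)
qed

text \<open>With \<open>r\<close> the largest prime dividing the common order \<open>b\<close> of \<open>A\<close> and \<open>B\<close>, the powers of \<open>D\<close>, \<open>A\<close>
  and \<open>B\<close> with exponent \<open>b / r\<close> are central.\<close>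

theorem trivial_if_center_trivial:
  assumes gen: "carrier G = generate G {A, B}"
    and n: "n > 0" "A [^] (n::nat) = \<one>" "B [^] n = \<one>"
    and center: "\<And>z. z \<in> center G \<Longrightarrow> z = \<one>"
  shows "A = \<one>" "B = \<one>"
proof -
  have triv: "z = \<one>" if "z \<in> carrier G" "z \<otimes> A = A \<otimes> z" "z \<otimes> B = B \<otimes> z" for z
  proof (rule center)
    have "z \<otimes> y = y \<otimes> z" if "y \<in> generate G {A, B}" for y
      by (rule commute_generate[OF _ _ _ that])
        (use \<open>z \<in> carrier G\<close> \<open>z \<otimes> A = A \<otimes> z\<close> \<open>z \<otimes> B = B \<otimes> z\<close> in auto)
    then show "z \<in> center G" unfolding center_def gen[symmetric] using that(1) by blast
  qed
  define b where "b = lcm (local.ord A) (local.ord B)"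
  have "local.ord A dvd n" "local.ord B dvd n" using n by (auto simp: pow_eq_id)
  then have pos: "local.ord A > 0" "local.ord B > 0" using n(1) by (auto intro: dvd_pos_nat)
  then have b0: "b > 0" by (simp add: b_def lcm_pos_nat)
  interpret S: macdonald_nat G B A "inv D" a by (rule swap_nat)
  have Ab: "A [^] i = \<one>" "B [^] i = \<one>" if "b dvd i" for i
    using that by (auto simp: pow_eq_id b_def)
  have Db: "D [^] b = inv (B [^] geo a b)" "inv D [^] b = inv (A [^] geo a b)"
    using Dpow_eq[of b] S.Dpow_eq[of b] Ab[of b] by auto
  have inj: "x = y" if "inv x = inv y" "x \<in> carrier G" "y \<in> carrier G" for x y
    using that by (metis inv_inv)
  have "inv (D [^] b) = inv (A [^] geo a b)" using Db by (simp add: nat_pow_inv)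
  then have DbA: "D [^] b = A [^] geo a b" by (rule inj) auto
  \<comment> \<open>D^b is a power of A as well as of B, hence central.\<close>
  have "D [^] b = \<one>"
  proof (rule triv)
    show "D [^] b \<otimes> A = A \<otimes> D [^] b"
      unfolding DbA using pow_commute[of A A] by simp
    have "inv (B [^] geo a b) \<otimes> B = B \<otimes> inv (B [^] geo a b)"
      using pow_commute[of B "inv B" "geo a b"] by (simp add: nat_pow_inv)
    then show "D [^] b \<otimes> B = B \<otimes> D [^] b" unfolding Db .
  qed simp
  then have 1: "A [^] geo a b = \<one>" "B [^] geo a b = \<one>"
    using DbA Db inv_eq_1_iff[of "B [^] geo a b"] by auto
  have dvd: "b dvd geo a b" using 1 by (simp add: b_def pow_eq_id)
  have cop: "coprime a b"
  proof -
    have "coprime a (local.ord A * local.ord B)"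
      using coprime_ord S.coprime_ord pos by simp
    moreover have "b dvd local.ord A * local.ord B" unfolding b_def by (rule lcm_least) auto
    ultimately show ?thesis by (meson coprime_divisors dvd_refl)
  qed
  have "b = 1"
  proof (rule ccontr)
    assume "b \<noteq> 1"
    then have b1: "b > 1" using b0 by simp
    define r where "r = Max (prime_factors b)"
    define i where "i = b div r"
    note ar = largest_prime_arith[OF b1 cop dvd r_def i_def]
    have bi: "b = r * i" using ar(2) by (simp add: i_def)
    have "[a ^ i = 1] (mod b)" using ar(3) by (metis cong_int_iff of_nat_1 of_nat_power)
    then have ai: "a ^ i mod local.ord A = 1 mod local.ord A" "a ^ i mod local.ord B = 1 mod local.ord B"
      using cong_dvd_modulus_nat[of "a ^ i" 1 b] by (auto simp: b_def cong_def)
    have A_ai: "A [^] (a ^ i) = A"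
      using pow_mod_nat[OF closed(1), of "local.ord A" "a ^ i"] pow_mod_nat[OF closed(1), of "local.ord A" 1] ai by simp
    have B_ai: "B [^] (a ^ i) = B"
      using pow_mod_nat[OF closed(2), of "local.ord B" "a ^ i"] pow_mod_nat[OF closed(2), of "local.ord B" 1] ai by simp
    \<comment> \<open>Conjugation by D^i raises A to the power a^i, which is A itself; likewise for
      B. So D^i is central.\<close>
    have Di: "D [^] i = \<one>"
    proof (rule triv)
      show "D [^] i \<otimes> A = A \<otimes> D [^] i" using Dpow_Apow_nat[of i 1] A_ai by simp
      show "D [^] i \<otimes> B = B \<otimes> D [^] i" using Bpow_Dpow_nat[of 1 i] B_ai by simp
    qed simp
    have iD: "inv D [^] i = \<one>" using nat_pow_inv[of D i] Di by simp
    have BA: "B [^] i \<otimes> A = A \<otimes> B [^] geo a i" using Bpow_A_nat[of i] Di by simp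
    have AB: "A [^] i \<otimes> B = B \<otimes> A [^] geo a i" using S.Bpow_A_nat[of i] iD by simp
    have "A [^] i = \<one> \<and> B [^] i = \<one>"
      using ar(4)
    proof
      assume "b dvd geo a i"
      then have "B [^] i \<otimes> A = A" "A [^] i \<otimes> B = B" using BA AB Ab by auto
      then show ?thesis using l_cancel_one' by auto
    next
      assume "[geo a i = i] (mod b)"
      then have c: "geo a i mod b = i mod b" by (simp add: cong_def)
      have "B [^] geo a i = B [^] i" "A [^] geo a i = A [^] i"
        using pow_mod_nat[OF closed(2) Ab(2), of b "geo a i"] pow_mod_nat[OF closed(2) Ab(2), of b i]
          pow_mod_nat[OF closed(1) Ab(1), of b "geo a i"] pow_mod_nat[OF closed(1) Ab(1), of b i] c by auto
      then have "B [^] i \<otimes> A = A \<otimes> B [^] i" "A [^] i \<otimes> B = B \<otimes> A [^] i" using BA AB by auto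
      then show ?thesis
        using pow_commute[of A A i] pow_commute[of B B i] by (intro conjI triv) auto
    qed
    then have "b dvd i" by (simp add: b_def pow_eq_id)
    moreover have "i > 0" "r > 1" using bi b0 ar(1) prime_gt_1_nat by auto
    ultimately show False using bi by (auto dest!: dvd_imp_le)
  qed
  then show "A = \<one>" "B = \<one>" using Ab[of 1] by auto
qed

text \<open>The upper central series of a finite group becomes stationary. The quotient by the
  stationary term has trivial center and inherits the Macdonald relations, so both generators are
  trivial in it.\<close>

theorem nilpotent:
  assumes gen: "carrier G = generate G {A, B}"
    and n: "n > 0" "A [^] (n::nat) = \<one>" "B [^] n = \<one>"
  obtains c where "upper_central G c = carrier G"
proof -
  have fin: "finite (carrier G)" unfolding gen by (rule finite_generate[OF n])
  have sub: "upper_central G i \<subseteq> carrier G" for i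
    using upper_central_normal[of i] by (meson normal_imp_subgroup subgroup.subset)
  have "\<exists>i. upper_central G (Suc i) = upper_central G i"
  proof (rule ccontr)
    assume "\<not> ?thesis"
    then have "upper_central G i \<subset> upper_central G (Suc i)" for i
      using upper_central_mono[of i] by (metis psubsetI)
    then have "card (upper_central G i) < card (upper_central G (Suc i))" for i
      using psubset_card_mono[OF finite_subset[OF sub fin]] by blast
    then have "strict_mono (\<lambda>i. card (upper_central G i))" by (simp add: strict_mono_Suc_iff)
    then have "card (upper_central G (Suc (card (carrier G)))) \<ge> Suc (card (carrier G))"
      by (rule strict_mono_imp_increasing)
    then show False using card_mono[OF fin sub, of "Suc (card (carrier G))"] by simp
  qed
  then obtain i where i: "upper_central G (Suc i) = upper_central G i" by blast
  let ?K = "upper_central G i"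
  interpret K: normal ?K G by (rule upper_central_normal)
  interpret Q: group "G Mod ?K" by (rule K.factorgroup_is_group)
  interpret \<pi>: group_hom G "G Mod ?K" "\<lambda>x. ?K #> x"
    by (intro group_hom.intro group_hom_axioms.intro is_group Q.is_group K.r_coset_hom_Mod)
  interpret M: macdonald_nat "G Mod ?K" "?K #> A" "?K #> B" "?K #> D" a
  proof
    show "(?K #> D) \<otimes>\<^bsub>G Mod ?K\<^esub> (?K #> A) = (?K #> A) [^]\<^bsub>G Mod ?K\<^esub> int a \<otimes>\<^bsub>G Mod ?K\<^esub> (?K #> D)"
      using arg_cong[OF D_A, of "\<lambda>x. ?K #> x"]
      by (simp only: \<pi>.hom_mult \<pi>.hom_int_pow closed int_pow_closed)
    show "(?K #> B) \<otimes>\<^bsub>G Mod ?K\<^esub> (?K #> D) = (?K #> D) \<otimes>\<^bsub>G Mod ?K\<^esub> (?K #> B) [^]\<^bsub>G Mod ?K\<^esub> int a"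
      using arg_cong[OF B_D, of "\<lambda>x. ?K #> x"]
      by (simp only: \<pi>.hom_mult \<pi>.hom_int_pow closed int_pow_closed)
    show "(?K #> B) \<otimes>\<^bsub>G Mod ?K\<^esub> (?K #> A) = (?K #> A) \<otimes>\<^bsub>G Mod ?K\<^esub> ((?K #> B) \<otimes>\<^bsub>G Mod ?K\<^esub> (?K #> D))"
      using arg_cong[OF B_A, of "\<lambda>x. ?K #> x"]
      by (simp only: \<pi>.hom_mult closed m_closed)
  qed (auto simp: a_pos)
  have im: "(\<lambda>x. ?K #> x) ` {A, B} = {?K #> A, ?K #> B}" by simp
  have "carrier (G Mod ?K) = (\<lambda>x. ?K #> x) ` generate G {A, B}"
    unfolding carrier_FactGroup gen ..
  also have "\<dots> = generate (G Mod ?K) {?K #> A, ?K #> B}"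
    unfolding im[symmetric] by (rule \<pi>.generate_img[symmetric]) auto
  finally have gen': "carrier (G Mod ?K) = generate (G Mod ?K) {?K #> A, ?K #> B}" .
  have n': "(?K #> A) [^]\<^bsub>G Mod ?K\<^esub> n = \<one>\<^bsub>G Mod ?K\<^esub>" "(?K #> B) [^]\<^bsub>G Mod ?K\<^esub> n = \<one>\<^bsub>G Mod ?K\<^esub>"
    using n by (auto simp flip: \<pi>.hom_nat_pow)
  have cen: "z = \<one>\<^bsub>G Mod ?K\<^esub>" if "z \<in> center (G Mod ?K)" for z
  proof -
    have "z \<in> carrier (G Mod ?K)" using that unfolding center_def by blast
    then obtain x where x: "x \<in> carrier G" "z = ?K #> x" unfolding carrier_FactGroup by blast
    then have "x \<in> upper_central G (Suc i)" using that by simp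
    then have "x \<in> ?K" by (simp only: i)
    then show ?thesis using x by (simp add: coset_join2 K.subgroup_axioms)
  qed
  have "?K #> A = ?K" "?K #> B = ?K"
    using M.trivial_if_center_trivial[OF gen' n(1) n' cen] by auto
  then have "A \<in> ?K" "B \<in> ?K"
    using rcos_self[OF closed(1) K.subgroup_axioms] rcos_self[OF closed(2) K.subgroup_axioms] by auto
  then have "generate G {A, B} \<subseteq> ?K" by (intro generate_subgroup_incl K.subgroup_axioms) auto
  then have "?K = carrier G" using gen sub by blast
  then show thesis by (rule that)
qed

end


section \<open>A permutation group on normal forms\<close>

context mac_arith
begin

text \<open>The relation A^(q^2) B^(q^2) = 1 allows i and j to be shifted together by q^2, which
  leaves i - j unchanged; hence this difference modulo q^3 instead of i. There are q^7
  classes.\<close>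

definition nf_class :: "nat \<times> nat \<times> nat \<Rightarrow> int \<times> int \<times> int" where
  "nf_class = (\<lambda>(i, k, j). (int k mod q^2, int j mod q^2, (int i - int j) mod q^3))"

lemma nf_class_eq_iff:
  "nf_class (i, k, j) = nf_class (i', k', j') \<longleftrightarrow>
    [int k = int k'] (mod q^2) \<and> [int j = int j'] (mod q^2) \<and> [int i - int j = int i' - int j'] (mod q^3)"
  by (simp add: nf_class_def cong_def)

lemma nat_q2: "int (nat (q^2)) = q^2" and nat_q3: "int (nat (q^3)) = q^3" and nat_q: "int (nat q) = q"
  using q_pos by auto

lemma power_cong_mod_q2':
  assumes "[int z = int z'] (mod q^2)"
  shows "[int a ^ z = int a ^ z'] (mod q ^ 3)"
  using assms power_cong_mod_q2[of z z'] by (simp flip: cong_int_iff add: nat_q2)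

text \<open>The coordinate i - j is taken modulo q^3 although j is known only modulo q^2, so
  differences like this one must be well defined. Adding a multiple c of q^2 to j changes both
  \<open>geo a j\<close> and j by c modulo q^3.\<close>

lemma geo_cong_diff:
  assumes "[int j = int j'] (mod q^2)"
  shows "[int (geo a j) - int j = int (geo a j') - int j'] (mod q^3)"
proof -
  have *: "[int (geo a x) - int x = int (geo a y) - int y] (mod q ^ 3)"
    if h: "[int x = int y] (mod q^2)" and le: "x \<le> y" for x y
  proof -
    obtain c where c: "y = x + c" using le by (auto simp: le_iff_add)
    then have "q^2 dvd int c" using cong_sym[OF h] by (simp add: cong_iff_dvd_diff)
    then have "[int a ^ x * int (geo a c) = int a ^ x * int c] (mod q^3)" "[int a ^ x * int c = int c] (mod q^3)"
      by (auto intro: cong_mult geo_cong_self mult_power_cong)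
    then have "[int a ^ x * int (geo a c) = int c] (mod q^3)" by (rule cong_trans)
    then have "[int (geo a x) - int x + int a ^ x * int (geo a c) - int c = int (geo a x) - int x + int c - int c] (mod q^3)"
      by (intro cong_diff cong_add cong_refl)
    moreover have "int (geo a y) - int y = int (geo a x) - int x + int a ^ x * int (geo a c) - int c"
      by (simp add: c geo_add)
    ultimately show ?thesis by (simp add: cong_sym_eq)
  qed
  show ?thesis using *[of j j'] *[of j' j] assms by (cases "j \<le> j'") (auto intro: cong_sym)
qed

lemma geo_cong_mod_q2:
  assumes "[int j = int j'] (mod q^2)"
  shows "[int (geo a j) = int (geo a j')] (mod q^2)"
  using cong_add[OF cong_q2I[OF geo_cong_diff[OF assms]] assms] by simp

text \<open>Right multiplication by A, and below by B and D, as read off from \<open>N_A\<close>,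
  \<open>N_B\<close> and \<open>N_D\<close>.\<close>

definition act_A :: "nat \<times> nat \<times> nat \<Rightarrow> nat \<times> nat \<times> nat" where
  "act_A = (\<lambda>(i, k, j). (i + a ^ k, k + j, geo a j))"

definition act_B :: "nat \<times> nat \<times> nat \<Rightarrow> nat \<times> nat \<times> nat" where
  "act_B = (\<lambda>(i, k, j). (i, k, Suc j))"

definition act_D :: "nat \<times> nat \<times> nat \<Rightarrow> nat \<times> nat \<times> nat" where
  "act_D = (\<lambda>(i, k, j). (i, Suc k, a * j))"

lemma act_simps: "act_A (i, k, j) = (i + a ^ k, k + j, geo a j)"
    "act_B (i, k, j) = (i, k, Suc j)" "act_D (i, k, j) = (i, Suc k, a * j)"
  by (auto simp: act_A_def act_B_def act_D_def)

lemma act_A_pow: "(act_A ^^ n) (i, k, j) =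
    (i + a ^ k * (\<Sum>l<n. a ^ its l j), k + its n j, it n j)"
  by (induction n) (auto simp: act_A_def geo_iter_Suc geo_iter_sum_Suc algebra_simps power_add)

lemma act_B_pow: "(act_B ^^ n) (i, k, j) = (i, k, n + j)"
  by (induction n) (auto simp: act_B_def)

lemma act_D_pow: "(act_D ^^ n) (i, k, j) = (i, n + k, a ^ n * j)"
  by (induction n) (auto simp: act_D_def)

definition compatible :: "(nat \<times> nat \<times> nat \<Rightarrow> nat \<times> nat \<times> nat) \<Rightarrow> bool" where
  "compatible f \<longleftrightarrow> (\<forall>t t'. nf_class t = nf_class t' \<longrightarrow> nf_class (f t) = nf_class (f t'))"

lemma compatible_A: "compatible act_A"
  unfolding compatible_def
proof (intro allI impI)
  fix t t' :: "nat \<times> nat \<times> nat"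
  assume h: "nf_class t = nf_class t'"
  obtain i k j i' k' j' where t: "t = (i, k, j)" "t' = (i', k', j')" by (metis prod_cases3)
  have 1: "[int k = int k'] (mod q^2)" "[int j = int j'] (mod q^2)" "[int i - int j = int i' - int j'] (mod q^3)"
    using h unfolding t nf_class_eq_iff by auto
  from cong_diff[OF cong_add[OF 1(3) power_cong_mod_q2'[OF 1(1)]] geo_cong_diff[OF 1(2)]]
  have "[int (i + a ^ k) - int (geo a j) = int (i' + a ^ k') - int (geo a j')] (mod q^3)"
    by (simp add: algebra_simps)
  moreover have "[int (k + j) = int (k' + j')] (mod q^2)" using cong_add[OF 1(1,2)] by simp
  ultimately show "nf_class (act_A t) = nf_class (act_A t')"
    using geo_cong_mod_q2[OF 1(2)] by (simp add: t act_A_def nf_class_eq_iff)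
qed

lemma compatible_B: "compatible act_B"
proof -
  have *: "[int (Suc j) = int (Suc j')] (mod q^2)" if "[int j = int j'] (mod q^2)" for j j'
    using cong_add[OF that cong_refl[of 1]] by (simp add: add.commute)
  have "[int i - int (Suc j) = int i' - int (Suc j')] (mod q^3)"
    if "[int i - int j = int i' - int j'] (mod q^3)" for i j i' j'
    using cong_diff[OF that cong_refl[of 1]] by (simp add: algebra_simps)
  with * show ?thesis
    unfolding compatible_def act_B_def by (auto simp: nf_class_eq_iff)
qed

lemma a_mult_cong:
  assumes "[int j = int j'] (mod q^2)"
  shows "[int (a * j) - int j = int (a * j') - int j'] (mod q^3)"
proof -
  have "[e * int j = e * int j'] (mod q^3)" using cong_e[OF assms] by (simp add: numeral_3_eq_3 numeral_2_eq_2)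
  then show ?thesis by (simp add: e_def algebra_simps)
qed

lemma compatible_D: "compatible act_D"
  unfolding compatible_def
proof (intro allI impI)
  fix t t' :: "nat \<times> nat \<times> nat"
  assume h: "nf_class t = nf_class t'"
  obtain i k j i' k' j' where t: "t = (i, k, j)" "t' = (i', k', j')" by (metis prod_cases3)
  have 1: "[int k = int k'] (mod q^2)" "[int j = int j'] (mod q^2)" "[int i - int j = int i' - int j'] (mod q^3)"
    using h unfolding t nf_class_eq_iff by auto
  from cong_diff[OF 1(3) a_mult_cong[OF 1(2)]]
  have "[int i - int (a * j) = int i' - int (a * j')] (mod q^3)" by (simp add: algebra_simps)
  moreover have "[int (a * j) = int (a * j')] (mod q^2)"
    using cong_mult[OF cong_refl[of "int a"] 1(2)] by simp
  moreover have "[int (Suc k) = int (Suc k')] (mod q^2)"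
    using cong_add[OF 1(1) cong_refl[of 1]] by (simp add: add.commute)
  ultimately show "nf_class (act_D t) = nf_class (act_D t')"
    by (simp add: t act_D_def nf_class_eq_iff)
qed

lemma compatible_id: "compatible (\<lambda>t. t)" by (simp add: compatible_def)

lemma compatible_comp: "compatible f \<Longrightarrow> compatible g \<Longrightarrow> compatible (f \<circ> g)"
  unfolding compatible_def comp_apply by meson

lemma compatible_funpow: "compatible f \<Longrightarrow> compatible (f ^^ n)"
  by (induction n) (simp_all add: compatible_comp, simp add: id_def compatible_id)

definition nf_classes :: "(int \<times> int \<times> int) set" where "nf_classes = range nf_class"

text \<open>Extensional outside the set of classes, as membership in \<open>Bij\<close>
  requires.\<close>

definition lift :: "(nat \<times> nat \<times> nat \<Rightarrow> nat \<times> nat \<times> nat) \<Rightarrow> int \<times> int \<times> int \<Rightarrow> int \<times> int \<times> int" where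
  "lift f = (\<lambda>s\<in>nf_classes. nf_class (f (SOME t. nf_class t = s)))"

lemma lift_nf_class: "compatible f \<Longrightarrow> lift f (nf_class t) = nf_class (f t)"
proof -
  assume f: "compatible f"
  have "nf_class (SOME t'. nf_class t' = nf_class t) = nf_class t" by (rule someI[of _ t]) simp
  then have "nf_class (f (SOME t'. nf_class t' = nf_class t)) = nf_class (f t)"
    using f unfolding compatible_def by blast
  then show ?thesis by (simp add: lift_def nf_classes_def)
qed

lemma lift_eqI:
  assumes "compatible f" "compatible g" "\<And>t. nf_class (f t) = nf_class (g t)"
  shows "lift f = lift g"
proof
  fix s show "lift f s = lift g s"
  proof (cases "s \<in> nf_classes")
    case True
    then obtain t where "s = nf_class t" by (auto simp: nf_classes_def)
    then show ?thesis using assms by (simp add: lift_nf_class)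
  qed (simp add: lift_def)
qed

lemma lift_comp:
  assumes "compatible f" "compatible g"
  shows "compose nf_classes (lift f) (lift g) = lift (f \<circ> g)"
proof
  fix s show "compose nf_classes (lift f) (lift g) s = lift (f \<circ> g) s"
  proof (cases "s \<in> nf_classes")
    case True
    then obtain t where "s = nf_class t" by (auto simp: nf_classes_def)
    then show ?thesis using assms True by (simp add: lift_nf_class compose_def compatible_comp)
  qed (simp add: lift_def compose_def)
qed

lemma lift_id: "lift (\<lambda>t. t) = (\<lambda>s\<in>nf_classes. s)"
proof
  fix s show "lift (\<lambda>t. t) s = (\<lambda>s\<in>nf_classes. s) s"
  proof (cases "s \<in> nf_classes")
    case True
    then obtain t where "s = nf_class t" by (auto simp: nf_classes_def)
    then show ?thesis using True by (simp add: lift_nf_class compatible_id)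
  qed (simp add: lift_def)
qed

lemma lift_Bij:
  assumes f: "compatible f" and n: "\<And>t. nf_class ((f ^^ Suc n) t) = nf_class t"
  shows "lift f \<in> Bij nf_classes"
proof -
  have "lift (f ^^ n) (lift f s) = s \<and> lift f (lift (f ^^ n) s) = s \<and> lift f s \<in> nf_classes \<and> lift (f ^^ n) s \<in> nf_classes"
    if "s \<in> nf_classes" for s
  proof -
    obtain t where t: "s = nf_class t" using \<open>s \<in> nf_classes\<close> by (auto simp: nf_classes_def)
    have "(f ^^ n) (f t) = (f ^^ Suc n) t" "f ((f ^^ n) t) = (f ^^ Suc n) t"
      by (auto simp: funpow_swap1)
    then show ?thesis using n[of t] by (simp add: t lift_nf_class f compatible_funpow nf_classes_def del: funpow.simps)
  qed
  then have "bij_betw (lift f) nf_classes nf_classes" by (intro bij_betw_byWitness[where f' = "lift (f ^^ n)"]) auto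
  then show ?thesis by (simp add: Bij_def lift_def)
qed

definition model :: "(int \<times> int \<times> int \<Rightarrow> int \<times> int \<times> int) monoid" where
  "model = BijGroup nf_classes"

lemma model_mult: "lift f \<in> carrier model \<Longrightarrow> lift g \<in> carrier model \<Longrightarrow> compatible f \<Longrightarrow> compatible g \<Longrightarrow>
    lift f \<otimes>\<^bsub>model\<^esub> lift g = lift (f \<circ> g)"
  by (simp add: model_def BijGroup_def lift_comp)

lemma model_one: "\<one>\<^bsub>model\<^esub> = lift (\<lambda>t. t)"
  by (simp add: model_def BijGroup_def lift_id)

lemma group_model: "group model"
  by (simp add: model_def group_BijGroup)

lemma model_pow:
  assumes "lift f \<in> carrier model" "compatible f"
  shows "lift f [^]\<^bsub>model\<^esub> n = lift (f ^^ n)"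
proof -
  interpret group model by (rule group_model)
  have "lift (f ^^ n) \<in> carrier model \<and> lift f [^]\<^bsub>model\<^esub> n = lift (f ^^ n)"
  proof (induction n)
    case 0
    have "f ^^ 0 = (\<lambda>t. t)" by (simp add: id_def)
    then have "lift (f ^^ 0) = \<one>\<^bsub>model\<^esub>" by (simp only: model_one)
    then show ?case by (simp only: one_closed nat_pow_0 simp_thms)
  next
    case (Suc n)
    then have "lift f [^]\<^bsub>model\<^esub> Suc n = lift (f ^^ n) \<otimes>\<^bsub>model\<^esub> lift f" by simp
    also have "\<dots> = lift (f ^^ n \<circ> f)"
      using Suc by (intro model_mult assms compatible_funpow) blast
    also have "f ^^ n \<circ> f = f ^^ Suc n" by (simp only: funpow_Suc_right)
    finally have "lift f [^]\<^bsub>model\<^esub> Suc n = lift (f ^^ Suc n)" .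
    then show ?case using nat_pow_closed[OF assms(1), of "Suc n"] by (simp only:)
  qed
  then show ?thesis ..
qed

lemma q_dvd_choose:
  shows "q^3 dvd int (nat (q^3) choose 2)" "q dvd int (nat (q^3) choose 3)" "q dvd int (nat (q^3) choose 2)"
proof -
  have "[2 * int (nat (q^3) choose 2) = 2 * 0] (mod q^3)"
    unfolding two_choose_two nat_q3 by (simp add: cong_0_iff)
  from cancel_two[OF this] show 1: "q^3 dvd int (nat (q^3) choose 2)" by (simp add: cong_0_iff)
  then show "q dvd int (nat (q^3) choose 2)" by (rule dvd_trans[rotated]) simp
  have "r dvd q^3" using r_dvd_q2 by (rule dvd_trans) (simp add: le_imp_power_dvd)
  then have "[6 * int (nat (q^3) choose 3) = 6 * 0] (mod r)"
    unfolding six_choose_three nat_q3 by (simp add: cong_0_iff)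
  from cancel_six[OF this] show "q dvd int (nat (q^3) choose 3)" by (simp add: cong_0_iff)
qed

text \<open>Together with the two analogues for B and D this makes the actions invertible on
  classes. For n = q^3 all corrections in the third-order congruences vanish.\<close>

lemma act_A_order: "nf_class ((act_A ^^ nat (q^3)) t) = nf_class t"
proof -
  obtain i k j where t: "t = (i, k, j)" by (metis prod_cases3)
  let ?n = "nat (q^3)"
  have q23: "q^2 dvd q^3" by (simp add: le_imp_power_dvd)
  have 1: "[int (its ?n j) = 0] (mod q^2)"
    using cong_trans[OF its_cong2'[OF q_dvd_choose(3), of j], of 0] q23 by (simp add: nat_q3 cong_0_iff)
  have "[int j + int ?n * (e * int (Suc j choose 2)) + int ?n * (e^2 * int (Suc j choose 3)) = int j + 0 + 0] (mod q^3)"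
    by (intro cong_add cong_refl) (auto simp: nat_q3 cong_0_iff)
  from cong_trans[OF it_cong3[OF q_dvd_choose(3)] this]
  have 2: "[int (it ?n j) = int j] (mod q^3)" by simp
  have "[e^2 * (int (?n choose 3) * (int (Suc j choose 2) + int j^2)) = e^2 * 0] (mod q^3)"
    using q_dvd_choose(2) by (intro cong_e2) (simp add: cong_0_iff)
  then have "[int ?n + e * int j * int (?n choose 2) + e^2 * (int (?n choose 3) * (int (Suc j choose 2) + int j^2))
    = 0 + 0 + e^2 * 0] (mod q^3)"
    using q_dvd_choose(1) by (intro cong_add) (auto simp: nat_q3 cong_0_iff)
  from cong_trans[OF sum_power_its_cong[OF q_dvd_choose(3)] this]
  have "[(\<Sum>l<?n. int a ^ its l j) = 0] (mod q^3)" by simp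
  from cong_mult[OF cong_refl[of "int a ^ k"] this]
  have "[int (i + a ^ k * (\<Sum>l<?n. a ^ its l j)) = int i] (mod q^3)"
    using cong_add[OF cong_refl[of "int i"]] by fastforce
  from cong_diff[OF this 2] have "[int (i + a ^ k * (\<Sum>l<?n. a ^ its l j)) - int (it ?n j) = int i - int j] (mod q^3)" .
  moreover have "[int (k + its ?n j) = int k] (mod q^2)" using cong_add[OF cong_refl[of "int k"] 1] by simp
  ultimately show ?thesis using cong_q2I[OF 2] by (simp add: t act_A_pow nf_class_eq_iff)
qed

lemma act_B_order: "nf_class ((act_B ^^ nat (q^3)) t) = nf_class t"
proof -
  obtain i k j where t: "t = (i, k, j)" by (metis prod_cases3)
  have "[int (nat (q^3) + j) = int j] (mod q^3)" by (simp add: nat_q3 cong_def)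
  then show ?thesis
    using cong_q2I[of "int (nat (q^3) + j)" "int j"] cong_diff[OF cong_refl[of "int i"]]
    by (simp add: t act_B_pow nf_class_eq_iff del: of_nat_add)
qed

lemma act_D_order: "nf_class ((act_D ^^ nat (q^3)) t) = nf_class t"
proof -
  obtain i k j where t: "t = (i, k, j)" by (metis prod_cases3)
  have q23: "q^2 dvd q^3" by (simp add: le_imp_power_dvd)
  have "[int a ^ nat (q^3) = 1] (mod q^3)" using q23 by (intro power_cong_1) (simp add: nat_q3)
  from cong_mult[OF this cong_refl[of "int j"]]
  have 1: "[int (a ^ nat (q^3) * j) = int j] (mod q^3)" by simp
  have "[int (nat (q^3) + k) = int k] (mod q^3)" by (simp add: nat_q3 cong_def)
  then show ?thesis
    using cong_q2I[OF 1] cong_q2I[of "int (nat (q^3) + k)" "int k"] cong_diff[OF cong_refl[of "int i"] 1]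
    by (simp add: t act_D_pow nf_class_eq_iff del: of_nat_add of_nat_mult of_nat_power)
qed

text \<open>The other two relations hold on triples themselves; this one needs the passage to
  classes. Comparing the coordinates i - j of both sides leads to
  \<open>sum_power_its_a\<close>.\<close>

lemma act_A_D: "nf_class (act_A (act_D t)) = nf_class (act_D ((act_A ^^ a) t))"
proof -
  obtain i k j where t: "t = (i, k, j)" by (metis prod_cases3)
  let ?S = "\<Sum>l<a. int a ^ its l j"
  have S2: "[?S = int a] (mod q^2)" by (rule sum_power_its_a2)
  then have q2: "q^2 dvd ?S - int a" by (simp add: cong_iff_dvd_diff)
  have S3: "[?S - int a = int a * int (it a j) - int (geo a (a * j))] (mod q^3)" by (rule sum_power_its_a)
  \<comment> \<open>The factor a^k is 1 modulo q, and what it multiplies is divisible by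
    q^2.\<close>
  have "[int a ^ k * (?S - int a) = int a * int (it a j) - int (geo a (a * j))] (mod q^3)"
    using mult_power_cong[OF q2] S3 by (rule cong_trans)
  then have "[int i + int a ^ k * int a + (int a ^ k * (?S - int a)) - int a * int (it a j)
      = int i + int a ^ k * int a + (int a * int (it a j) - int (geo a (a * j))) - int a * int (it a j)] (mod q^3)"
    by (intro cong_diff cong_add cong_refl)
  then have 1: "[int (i + a ^ k * (\<Sum>l<a. a ^ its l j)) - int (a * it a j) = int (i + a ^ Suc k) - int (geo a (a * j))] (mod q^3)"
    by (simp add: algebra_simps)
  have "q^2 dvd int a * int (it a j) - int (geo a (a * j))"
    using q2 cong_dvd_iff[OF cong_q2I[OF S3]] by simp
  then have 2: "[int (a * it a j) = int (geo a (a * j))] (mod q^2)" by (simp add: cong_iff_dvd_diff)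
  have "[int (its a j) = int (a * j)] (mod q^2)" using its_cong2'[OF dvd_choose_two_a, of j] by simp
  from cong_add[OF this cong_refl[of "int (Suc k)"]]
  have 3: "[int (Suc (k + its a j)) = int (Suc k + a * j)] (mod q^2)" by (simp add: algebra_simps)
  show ?thesis
    using cong_sym[OF 1] cong_sym[OF 2] cong_sym[OF 3]
    by (simp add: t act_A_pow act_simps nf_class_eq_iff del: of_nat_add of_nat_mult of_nat_power of_nat_sum of_nat_Suc)
qed

theorem model_exists:
  obtains A B D where "macdonald_nat model A B D a"
    "A [^]\<^bsub>model\<^esub> nat (q^3) = \<one>\<^bsub>model\<^esub>" "B [^]\<^bsub>model\<^esub> nat (q^3) = \<one>\<^bsub>model\<^esub>"
    "\<And>i k j i' k' j'. macdonald_nat.N model A B D i k j = macdonald_nat.N model A B D i' k' j' \<Longrightarrow>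
      nf_class (i, k, j) = nf_class (i', k', j')"
proof -
  interpret group model by (rule group_model)
  obtain n where n: "nat (q^3) = Suc n" using q_pos by (metis gr0_implies_Suc zero_less_nat_eq zero_less_power)
  define x where "x = lift act_A"
  define y where "y = lift act_B"
  define z where "z = lift act_D"
  have car: "x \<in> carrier model" "y \<in> carrier model" "z \<in> carrier model"
    unfolding x_def y_def z_def model_def BijGroup_def
    using lift_Bij[OF compatible_A, of n] lift_Bij[OF compatible_B, of n] lift_Bij[OF compatible_D, of n]
      act_A_order act_B_order act_D_order by (auto simp: n simp del: funpow.simps)
  note resp = compatible_A compatible_B compatible_D compatible_funpow compatible_comp
  have pow: "x [^]\<^bsub>model\<^esub> n = lift (act_A ^^ n)" "y [^]\<^bsub>model\<^esub> n = lift (act_B ^^ n)"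
    "z [^]\<^bsub>model\<^esub> n = lift (act_D ^^ n)" for n
    using car model_pow compatible_A compatible_B compatible_D by (auto simp: x_def y_def z_def)
  have order: "x [^]\<^bsub>model\<^esub> nat (q^3) = \<one>\<^bsub>model\<^esub>" "y [^]\<^bsub>model\<^esub> nat (q^3) = \<one>\<^bsub>model\<^esub>"
    unfolding pow model_one using act_A_order act_B_order
    by (auto intro!: lift_eqI resp compatible_id)
  have mult: "lift f \<otimes>\<^bsub>model\<^esub> lift g = lift (f \<circ> g)"
    if "lift f \<in> carrier model" "lift g \<in> carrier model" "compatible f" "compatible g" for f g
    using that by (rule model_mult)
  have powc: "lift (act_A ^^ n) \<in> carrier model" "lift (act_B ^^ n) \<in> carrier model" "lift (act_D ^^ n) \<in> carrier model" for n
    unfolding pow[symmetric] using car by auto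
  note car' = car[unfolded x_def y_def z_def]
  have "x \<otimes>\<^bsub>model\<^esub> z = lift (act_A \<circ> act_D)" unfolding x_def z_def by (intro mult car' resp)
  also have "\<dots> = lift (act_D \<circ> act_A ^^ a)" using act_A_D by (intro lift_eqI resp) simp
  also have "\<dots> = z \<otimes>\<^bsub>model\<^esub> x [^]\<^bsub>model\<^esub> a" unfolding pow unfolding z_def by (intro mult[symmetric] car' powc resp)
  finally have xz: "x \<otimes>\<^bsub>model\<^esub> z = z \<otimes>\<^bsub>model\<^esub> x [^]\<^bsub>model\<^esub> a" .
  have "act_D \<circ> act_B = act_B ^^ a \<circ> act_D"
    by (rule ext) (auto simp: act_B_pow act_simps)
  then have "lift (act_D \<circ> act_B) = lift (act_B ^^ a \<circ> act_D)" by (rule arg_cong)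
  then have zy: "z \<otimes>\<^bsub>model\<^esub> y = y [^]\<^bsub>model\<^esub> a \<otimes>\<^bsub>model\<^esub> z"
    unfolding pow unfolding y_def z_def
    using mult[OF car'(3,2) compatible_D compatible_B] mult[OF powc(2) car'(3) compatible_funpow[OF compatible_B] compatible_D] by (simp only:)
  have "act_A \<circ> act_B = act_D \<circ> (act_B \<circ> act_A)"
    by (rule ext) (auto simp: act_simps)
  then have "lift (act_A \<circ> act_B) = lift (act_D \<circ> (act_B \<circ> act_A))" by (rule arg_cong)
  moreover have "lift (act_B \<circ> act_A) \<in> carrier model"
    using mult[OF car'(2,1) compatible_B compatible_A] car'(1,2) m_closed by metis
  ultimately have xy: "x \<otimes>\<^bsub>model\<^esub> y = z \<otimes>\<^bsub>model\<^esub> (y \<otimes>\<^bsub>model\<^esub> x)"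
    unfolding x_def y_def z_def
    using mult[OF car'(1,2) compatible_A compatible_B] mult[OF car'(2,1) compatible_B compatible_A]
      mult[OF car'(3) _ compatible_D compatible_comp[OF compatible_B compatible_A]] by (simp only:)
  \<comment> \<open>Products in the model are compositions, which write right multiplications in
    reverse order; taking inverses turns the order round again.\<close>
  define A B D where "A = inv\<^bsub>model\<^esub> x" and "B = inv\<^bsub>model\<^esub> y" and "D = inv\<^bsub>model\<^esub> z"
  interpret M: macdonald_nat model A B D a
  proof
    show "A \<in> carrier model" "B \<in> carrier model" "D \<in> carrier model" using car by (auto simp: A_def B_def D_def)
    show "D \<otimes>\<^bsub>model\<^esub> A = A [^]\<^bsub>model\<^esub> int a \<otimes>\<^bsub>model\<^esub> D"
      using arg_cong[OF xz, of "m_inv model"] car by (simp add: A_def D_def inv_mult_group nat_pow_inv int_pow_int)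
    show "B \<otimes>\<^bsub>model\<^esub> D = D \<otimes>\<^bsub>model\<^esub> B [^]\<^bsub>model\<^esub> int a"
      using arg_cong[OF zy, of "m_inv model"] car by (simp add: B_def D_def inv_mult_group nat_pow_inv int_pow_int)
    show "B \<otimes>\<^bsub>model\<^esub> A = A \<otimes>\<^bsub>model\<^esub> (B \<otimes>\<^bsub>model\<^esub> D)"
      using arg_cong[OF xy, of "m_inv model"] car by (simp add: A_def B_def D_def inv_mult_group m_assoc)
  qed (rule a)
  show thesis
  proof (rule that)
    show "macdonald_nat model A B D a" by (rule M.macdonald_nat_axioms)
    show "A [^]\<^bsub>model\<^esub> nat (q^3) = \<one>\<^bsub>model\<^esub>" "B [^]\<^bsub>model\<^esub> nat (q^3) = \<one>\<^bsub>model\<^esub>"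
      using order car by (simp_all add: A_def B_def nat_pow_inv)
    have N: "inv\<^bsub>model\<^esub> (M.N i k j) = y [^]\<^bsub>model\<^esub> j \<otimes>\<^bsub>model\<^esub> (z [^]\<^bsub>model\<^esub> k \<otimes>\<^bsub>model\<^esub> x [^]\<^bsub>model\<^esub> i)" for i k j
      using car unfolding M.N_def unfolding A_def B_def D_def
      by (simp add: inv_mult_group m_assoc nat_pow_inv)
    have it0: "it n 0 = 0" for n by (induction n) (simp_all add: geo_iter_Suc)
    then have its0: "its n 0 = 0" for n by (induction n) (simp_all add: geo_iter_sum_Suc)
    \<comment> \<open>The inverse of a normal form sends the base point to the class of its
      exponents, so different classes come from different elements.\<close>
    have lift_N: "(inv\<^bsub>model\<^esub> (M.N i k j)) (nf_class (0, 0, 0)) = nf_class (i, k, j)" for i k j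
    proof -
      have "lift (act_D ^^ k \<circ> act_A ^^ i) \<in> carrier model"
        using m_closed[OF powc(3,1), of k i]
        by (simp only: mult[OF powc(3,1) compatible_funpow[OF compatible_D] compatible_funpow[OF compatible_A]])
      then have "inv\<^bsub>model\<^esub> (M.N i k j) = lift (act_B ^^ j \<circ> (act_D ^^ k \<circ> act_A ^^ i))"
        unfolding N pow
        by (simp only: mult[OF powc(3,1) compatible_funpow[OF compatible_D] compatible_funpow[OF compatible_A]]
            mult[OF powc(2) _ compatible_funpow[OF compatible_B]
              compatible_comp[OF compatible_funpow[OF compatible_D] compatible_funpow[OF compatible_A]]])
      moreover have "(act_B ^^ j \<circ> (act_D ^^ k \<circ> act_A ^^ i)) (0, 0, 0) = (i, k, j)"
        by (simp only: comp_apply act_A_pow act_B_pow act_D_pow it0 its0) simp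
      moreover have "compatible (act_B ^^ j \<circ> (act_D ^^ k \<circ> act_A ^^ i))" by (intro resp)
      ultimately show ?thesis by (simp only: lift_nf_class)
    qed
    show "nf_class (i, k, j) = nf_class (i', k', j')" if "M.N i k j = M.N i' k' j'" for i k j i' k' j'
      using lift_N[of i k j] lift_N[of i' k' j'] that by simp
  qed
qed

end


section \<open>Orders of the generators in the primary part\<close>

context group
begin

lemma coprime_pow_cancel:
  assumes x: "x \<in> carrier G" and p: "x [^] (n::nat) = \<one>" and h: "x [^] (k * h :: int) = \<one>"
    and cop: "coprime h (int n)"
  shows "x [^] k = \<one>"
proof -
  obtain u v where "h * u + int n * v = 1"
    using bezout_int[of h "int n"] cop by (auto simp: mult.commute)
  then have "k * (h * u + int n * v) = k" by simp
  then have "k = (k * h) * u + int n * (v * k)" by (simp add: algebra_simps)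
  then have "x [^] k = (x [^] (k * h)) [^] u \<otimes> (x [^] int n) [^] (v * k)"
    using x by (metis int_pow_mult int_pow_pow)
  then show ?thesis using h p by (simp add: int_pow_int)
qed

lemma int_pow_eq_mod:
  assumes x: "x \<in> carrier G" and n: "x [^] (n::int) = \<one>" and ij: "[i = j] (mod n)"
  shows "x [^] i = x [^] j"
proof -
  obtain k where k: "i = j + n * k" using ij by (metis cong_iff_lin cong_sym)
  show ?thesis unfolding k using x n by (simp add: int_pow_mult flip: int_pow_pow)
qed

end

text \<open>\<open>val\<close> makes m the exact valuation of \<open>e\<close>, \<open>cond\<close>
  is the condition on p = 3 in the shape in which \<open>power_geo_cong\<close> produces it, and
  \<open>inj\<close> is to be supplied by a homomorphism to the permutation model.\<close>

locale mac_p_group =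
  macdonald_nat G A B D a + mac_arith p m a q e for G (structure) and A B D a p m q e +
  assumes gen: "carrier G = generate G {A, B}"
    and val: "\<not> int p * q dvd e"
    and cond: "\<not> int p dvd 1 - 2 * int (Suc a choose 3)"
    and p_order: "\<exists>L. A [^] (p ^ L) = \<one> \<and> B [^] (p ^ L) = \<one>"
    and inj: "\<And>i k j i' k' j'. N i k j = N i' k' j' \<Longrightarrow> nf_class (i, k, j) = nf_class (i', k', j')"
begin

lemma prime_p: "prime (int p)" using p by simp

lemma coprime_pI: "\<not> int p dvd x \<Longrightarrow> coprime x (int (p ^ n))"
  using prime_imp_coprime[OF prime_p] by (simp add: coprime_commute)

lemma obtain_unit: obtains u where "e = q * u" "\<not> int p dvd u"
proof -
  obtain u where "e = q * u" using q_dvd_e by blast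
  with val show thesis by (intro that[of u]) (auto simp: mult.commute)
qed

lemma p_dvd_q: "int p dvd q" using m by (simp add: q_def)

lemma excess_eq: "excess = int a ^ (a + 1) - int (geo a a)"
  by (simp add: excess_def geoi_int)

text \<open>With e = q u, twice the excess is q^2 times u^2 times the bracket of
  \<open>power_geo_cong\<close>, up to a multiple of q^3. Both u and the bracket are prime to
  p.\<close>

lemma obtain_excess: obtains g where "excess = q^2 * g" "\<not> int p dvd g"
proof -
  obtain u where u: "e = q * u" "\<not> int p dvd u" by (rule obtain_unit)
  let ?w = "1 - 2 * int (Suc a choose 3)"
  obtain z where "2 * excess = e^2 * ?w + q^3 * z"
    using power_geo_cong unfolding excess_eq by (metis cong_iff_lin cong_sym)
  then have 1: "2 * excess = q^2 * (u^2 * ?w + q * z)"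
    by (simp add: u power2_eq_square power3_eq_cube algebra_simps)
  have "[2 * excess = 2 * 0] (mod q^2)" by (simp add: cong_0_iff 1)
  from cancel_two[OF this] obtain g where g: "excess = q^2 * g" by (auto simp: cong_0_iff)
  then have "2 * g = u^2 * ?w + q * z" using 1 q_pos by simp
  moreover have "\<not> int p dvd u^2 * ?w"
    using u(2) cond prime_p by (simp add: prime_dvd_mult_iff prime_dvd_power_iff)
  ultimately have "\<not> int p dvd 2 * g"
    using p_dvd_q by (metis dvd_add_left_iff dvd_mult2)
  then have "\<not> int p dvd g" by (metis dvd_mult)
  then show thesis using g by (intro that[of g])
qed

text \<open>The exponent of \<open>excess_order\<close> is a product of factors of valuation m, 2m
  and 0. The part prime to p drops out because A' has p-power order. The generators are kept
  variable so that \<open>swap_nat\<close> covers B.\<close>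

lemma swap_order:
  assumes "macdonald_nat G A' B' D' a" "A' [^] (p ^ L) = \<one>"
  shows "A' [^] (q^3) = \<one>"
proof -
  interpret S: macdonald_nat G A' B' D' a by fact
  obtain u where u: "e = q * u" "\<not> int p dvd u" by (rule obtain_unit)
  obtain g where g: "excess = q^2 * g" "\<not> int p dvd g" by (rule obtain_excess)
  let ?t = "int a ^ (a + 1)"
  have t: "\<not> int p dvd ?t"
  proof
    assume "int p dvd ?t"
    then have "int p dvd int a" using prime_p by (rule prime_dvd_power[rotated])
    moreover have "int p dvd e" using p_dvd_q q_dvd_e by (rule dvd_trans)
    ultimately have "int p dvd int a - e" by (rule dvd_diff)
    then show False using prime_p by (simp add: e_def)
  qed
  have "A' [^] ((int a - 1) * (S.excess * ?t)) = \<one>"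
    using S.excess_order by (simp only: nat_int abs_of_nat)
  moreover have "(int a - 1) * (S.excess * ?t) = q^3 * (u * g * ?t)"
    using u(1) g(1) by (simp add: e_def power2_eq_square power3_eq_cube algebra_simps)
  moreover have "\<not> int p dvd u * g * ?t" using u g t prime_p by (simp only: prime_dvd_mult_iff simp_thms)
  ultimately show ?thesis
    using coprime_pow_cancel[OF S.closed(1) assms(2), of "q^3" "u * g * ?t"] coprime_pI[of "u * g * ?t" L]
    by (simp only: simp_thms)
qed

lemma A_q3: "A [^] (q^3) = \<one>" and B_q3: "B [^] (q^3) = \<one>"
  using p_order swap_order[OF macdonald_nat_axioms] swap_order[OF swap_nat] by auto

lemma commute_A_q2: "A [^] (q^2) \<otimes> B = B \<otimes> A [^] (q^2)"
  and A_q2_B_q2: "A [^] (q^2) \<otimes> B [^] (q^2) = \<one>"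
proof -
  obtain g where g: "excess = q^2 * g" "\<not> int p dvd g" by (rule obtain_excess)
  have "[int a ^ (a + 1) = 1] (mod q)" by (rule power_cong_1_q)
  \<comment> \<open>q^2 divides \<open>excess\<close> and q divides a^(a+1) - 1, so the factor
    a^(a+1) of \<open>excess_relation\<close> disappears modulo q^3.\<close>
  then have "q * q^2 dvd (int a ^ (a + 1) - 1) * q^2" by (simp add: cong_iff_dvd_diff)
  then have "[excess * int a ^ (a + 1) = excess] (mod q^3)"
    using dvd_mult2[of "q^3" "(int a ^ (a + 1) - 1) * q^2" g]
    by (simp add: g cong_iff_dvd_diff power2_eq_square power3_eq_cube algebra_simps)
  from int_pow_eq_mod[OF closed(1) A_q3 this] have rel: "A [^] excess \<otimes> B [^] excess = \<one>"
    using excess_relation by simp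
  have xg: "A [^] excess = B [^] (- excess)"
    using rel inv_equality[of "A [^] excess" "B [^] excess"] by (simp add: int_pow_neg)
  \<comment> \<open>By Bezout q^2 is a multiple of \<open>excess\<close> modulo q^3, so A^(q^2) is a
    power of A^excess and thereby a power of B.\<close>
  have "coprime g q" using coprime_pI[OF g(2), of m] by (simp add: q_def)
  then obtain s v where sv: "g * s + q * v = 1"
    using bezout_int[of g q] by (auto simp: mult.commute)
  have "q^2 = excess * s + q^3 * v"
    using arg_cong[OF sv, of "\<lambda>z. q^2 * z"] by (simp add: g(1) power2_eq_square power3_eq_cube algebra_simps)
  then have "A [^] (q^2) = (A [^] excess) [^] s \<otimes> (A [^] (q^3)) [^] v"
    by (simp only: int_pow_mult closed int_pow_pow)
  then have x: "A [^] (q^2) = B [^] (- excess * s)"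
    by (simp add: A_q3 xg int_pow_pow)
  show c: "A [^] (q^2) \<otimes> B = B \<otimes> A [^] (q^2)"
    unfolding x using int_pow_mult[of B "- excess * s" 1] int_pow_mult[of B 1 "- excess * s"]
    by (simp add: add.commute)
  let ?x = "A [^] (q^2) \<otimes> B [^] (q^2)"
  have comm: "A [^] (q^2) \<otimes> B [^] (q^2) = B [^] (q^2) \<otimes> A [^] (q^2)"
    unfolding x using int_pow_mult[of B "- excess * s" "q^2"] int_pow_mult[of B "q^2" "- excess * s"]
    by (simp add: add.commute)
  have xn: "?x [^] z = A [^] (q^2 * z) \<otimes> B [^] (q^2 * z)" for z :: int
    using int_pow_mult_distrib[OF comm, of z] by (simp add: int_pow_pow)
  \<comment> \<open>Both the g-th and the q-th power of the product are trivial, and g is prime to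
    q.\<close>
  have "?x [^] (1 * g) = \<one>" using xn[of g] rel by (simp add: g(1))
  moreover have "?x [^] (p ^ m) = \<one>"
  proof -
    have "?x [^] (int (p ^ m)) = A [^] (q^3) \<otimes> B [^] (q^3)"
      using xn[of q] by (simp add: q_def power2_eq_square power3_eq_cube mult.assoc)
    then show ?thesis by (simp only: A_q3 B_q3 int_pow_int r_one one_closed)
  qed
  ultimately show "?x = \<one>"
    using coprime_pow_cancel[of ?x "p ^ m" 1 g] coprime_pI[OF g(2)] by simp
qed

text \<open>In B^n A = A D^n B^(geo a n) with n = q^2, the power B^n is also a power of A and
  \<open>geo a n\<close> is n modulo q^3. Everything but D^n cancels.\<close>

lemma D_q2: "D [^] (q^2) = \<one>"
proof -
  let ?n = "nat (q^2)"
  have n: "int ?n = q^2" by simp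
  have cA: "B [^] ?n = inv (A [^] (q^2))"
  proof -
    have "B [^] (q^2) \<otimes> A [^] (q^2) = \<one>"
      using A_q2_B_q2 by (metis closed(1,2) int_pow_closed inv_comm)
    then have "inv (A [^] (q^2)) = B [^] (q^2)" by (intro inv_equality) auto
    then show ?thesis using int_pow_int[of G B ?n] by simp
  qed
  have "B [^] ?n \<otimes> A = A \<otimes> B [^] ?n"
    unfolding cA using int_pow_mult[of A "- (q^2)" 1] int_pow_mult[of A 1 "- (q^2)"]
    by (simp add: int_pow_neg)
  moreover have "[int (geo a ?n) = int ?n] (mod q^3)" by (rule geo_cong_self) simp
  then have "B [^] geo a ?n = B [^] ?n"
    using int_pow_eq_mod[OF closed(2) B_q3] by (simp only: flip: int_pow_int)
  ultimately have "A \<otimes> (D [^] ?n \<otimes> B [^] ?n) = A \<otimes> B [^] ?n" using Bpow_A_nat[of ?n] by simp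
  then have "D [^] ?n = \<one>" by simp
  then show ?thesis using int_pow_int[of G D ?n] by simp
qed

text \<open>One direction is \<open>inj\<close>. For the other, a common shift of i and j by q^2 t
  inserts A^(q^2 t) B^(q^2 t) = 1; its second factor, being a power of both A and B, commutes with
  D^k and can be carried to its place.\<close>

theorem N_eq_iff: "N i k j = N i' k' j' \<longleftrightarrow> nf_class (i, k, j) = nf_class (i', k', j')"
proof
  assume "nf_class (i, k, j) = nf_class (i', k', j')"
  then have h: "[int k = int k'] (mod q^2)" "[int j = int j'] (mod q^2)"
    "[int i - int j = int i' - int j'] (mod q^3)" by (auto simp: nf_class_eq_iff)
  have Dk: "D [^] k = D [^] k'"
    using int_pow_eq_mod[OF closed(3) D_q2 h(1)] by (simp add: int_pow_int)
  obtain t where t: "int j' = int j + q^2 * t" using h(2) by (metis cong_iff_lin)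
  obtain s where s: "int i' - int j' = int i - int j + q^3 * s" using h(3) by (metis cong_iff_lin)
  let ?x = "A [^] (q^2 * t)" and ?y = "B [^] (q^2 * t)"
  have inv: "inv (A [^] (q^2)) = B [^] (q^2)"
    using A_q2_B_q2 by (metis closed(1,2) int_pow_closed inv_comm inv_equality)
  have xy: "?x \<otimes> ?y = \<one>"
  proof -
    have "?y = inv (A [^] (q^2)) [^] t" by (simp add: inv int_pow_pow)
    also have "\<dots> = inv ?x" by (simp add: int_pow_inv int_pow_pow)
    finally show ?thesis by simp
  qed
  have y: "?y = A [^] (- (q^2 * t))"
    using xy by (metis closed(1,2) int_pow_closed int_pow_neg inv_comm inv_equality)
  have yA: "?y \<otimes> A = A \<otimes> ?y"
    unfolding y using int_pow_mult[of A "- (q^2 * t)" 1] int_pow_mult[of A 1 "- (q^2 * t)"]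
    by (simp add: add.commute)
  have yB: "?y \<otimes> B = B \<otimes> ?y"
    using int_pow_mult[of B "q^2 * t" 1] int_pow_mult[of B 1 "q^2 * t"] by (simp add: add.commute)
  have yD: "?y \<otimes> D = D \<otimes> ?y" by (intro commute_D yA yB) auto
  have "N i' k' j' = A [^] int i' \<otimes> (D [^] k \<otimes> B [^] int j')"
    by (simp add: N_def Dk int_pow_int)
  also have "int i' = int i + q^2 * t + q^3 * s" using s t by simp
  also have "A [^] (int i + q^2 * t + q^3 * s) = A [^] int i \<otimes> ?x"
    by (simp add: int_pow_mult A_q3 flip: int_pow_pow)
  also have "B [^] int j' = ?y \<otimes> B [^] int j" unfolding t
    using int_pow_mult[of B "q^2 * t" "int j"] by (simp add: add.commute)
  also have "D [^] k \<otimes> (?y \<otimes> B [^] int j) = ?y \<otimes> (D [^] k \<otimes> B [^] int j)"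
    using pow_commute[OF _ closed(3) yD, of k] by (simp flip: m_assoc)
  also have "A [^] int i \<otimes> ?x \<otimes> (?y \<otimes> (D [^] k \<otimes> B [^] int j)) =
     A [^] int i \<otimes> ((?x \<otimes> ?y) \<otimes> (D [^] k \<otimes> B [^] int j))" by (simp add: m_assoc)
  also have "\<dots> = N i k j" unfolding xy by (simp add: N_def int_pow_int)
  finally show "N i k j = N i' k' j'" ..
qed (rule inj)

lemma N_eqI:
  assumes "[int k = int k'] (mod q^2)" "[int j = int j'] (mod q^2)" "[int i - int j = int i' - int j'] (mod q^3)"
  shows "N i k j = N i' k' j'"
  using assms by (simp add: N_eq_iff nf_class_eq_iff)

lemma N_eqD:
  assumes "N i k j = N i' k' j'"
  shows "[int k = int k'] (mod q^2)" "[int j = int j'] (mod q^2)" "[int i - int j = int i' - int j'] (mod q^3)"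
  using assms by (simp_all add: N_eq_iff nf_class_eq_iff)

lemma A_order: "A [^] nat (q^3) = \<one>" and B_order: "B [^] nat (q^3) = \<one>"
  using A_q3 B_q3 int_pow_int[of G A "nat (q^3)"] int_pow_int[of G B "nat (q^3)"]
  by (simp_all only: nat_q3)

lemma obtain_N:
  assumes "x \<in> carrier G"
  obtains i k j where "x = N i k j"
  using generate_N[of "nat (q^3)" x] assms A_order B_order q_pos gen by auto

end

context group
begin

lemma commute_left:
  assumes "w \<otimes> x = x \<otimes> w" "w \<in> carrier G" "x \<in> carrier G" "t \<in> carrier G"
  shows "w \<otimes> (x \<otimes> t) = x \<otimes> (w \<otimes> t)"
proof -
  have "w \<otimes> (x \<otimes> t) = (w \<otimes> x) \<otimes> t" using assms(2-4) by (simp add: m_assoc)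
  also have "\<dots> = x \<otimes> (w \<otimes> t)" unfolding assms(1) using assms(2-4) by (simp add: m_assoc)
  finally show ?thesis .
qed

lemma upper_central_subgroup: "subgroup (upper_central G i) G"
  using upper_central_normal by (rule normal_imp_subgroup)

lemma upper_central_closed: "x \<in> upper_central G i \<Longrightarrow> x \<in> carrier G"
  using upper_central_subgroup subgroup.subset by blast

lemma upper_central_conj:
  assumes x: "x \<in> upper_central G (Suc i)" and y: "y \<in> carrier G"
  obtains w where "w \<in> upper_central G i" "x \<otimes> y = y \<otimes> w \<otimes> x"
proof -
  interpret K: normal "upper_central G i" G by (rule upper_central_normal)
  have xc: "x \<in> carrier G" using x by (rule upper_central_closed)
  have "commutator G x y \<in> upper_central G i" using x y upper_central_Suc_iff by blast
  from K.inv_op_closed2[OF xc this] have "x \<otimes> commutator G x y \<otimes> inv x \<in> upper_central G i" .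
  moreover have "x \<otimes> y = y \<otimes> (x \<otimes> commutator G x y \<otimes> inv x) \<otimes> x"
    using xc y by (simp add: commutator_def m_assoc)
  ultimately show thesis by (rule that)
qed

lemma upper_central_1_commute:
  assumes "w \<in> upper_central G 1" "x \<in> carrier G"
  shows "w \<otimes> x = x \<otimes> w"
  using assms unfolding upper_central_1 center_def by blast

lemma upper_central_SucI:
  assumes gen: "carrier G = generate G S" and S: "S \<subseteq> carrier G" and x: "x \<in> carrier G"
    and w: "\<And>s. s \<in> S \<Longrightarrow> \<exists>w\<in>upper_central G i. x \<otimes> s = s \<otimes> x \<otimes> w"
  shows "x \<in> upper_central G (Suc i)"
proof -
  let ?K = "upper_central G i"
  interpret K: normal ?K G by (rule upper_central_normal)
  interpret Q: group "G Mod ?K" by (rule K.factorgroup_is_group)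
  interpret \<pi>: group_hom G "G Mod ?K" "\<lambda>x. ?K #> x"
    by (intro group_hom.intro group_hom_axioms.intro is_group Q.is_group K.r_coset_hom_Mod)
  have comm: "(?K #> x) \<otimes>\<^bsub>G Mod ?K\<^esub> s = s \<otimes>\<^bsub>G Mod ?K\<^esub> (?K #> x)"
    if "s \<in> (\<lambda>x. ?K #> x) ` S" for s
  proof -
    obtain t where t: "t \<in> S" "s = ?K #> t" using \<open>s \<in> _\<close> by blast
    then have tc: "t \<in> carrier G" using S by blast
    obtain v where v: "v \<in> ?K" "x \<otimes> t = t \<otimes> x \<otimes> v" using w[OF t(1)] by blast
    then have vc: "v \<in> carrier G" by (intro upper_central_closed)
    have "?K #> (x \<otimes> t) = ?K #> (t \<otimes> x)"
      using x tc vc v by (subst rcos_eq_iff[OF upper_central_normal]) (auto simp: m_assoc inv_mult_group)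
    then show ?thesis using x tc by (simp only: t(2) \<pi>.hom_mult)
  qed
  have "carrier (G Mod ?K) = generate (G Mod ?K) ((\<lambda>x. ?K #> x) ` S)"
    using \<pi>.generate_img[OF S] unfolding gen[symmetric] by (simp add: carrier_FactGroup)
  then have gen': "y \<in> generate (G Mod ?K) ((\<lambda>x. ?K #> x) ` S)" if "y \<in> carrier (G Mod ?K)" for y
    using that by (simp only:)
  have S': "(\<lambda>x. ?K #> x) ` S \<subseteq> carrier (G Mod ?K)" using S by (intro image_subsetI \<pi>.hom_closed) blast
  have "?K #> x \<in> center (G Mod ?K)"
    unfolding center_def
  proof (intro CollectI conjI ballI)
    show "?K #> x \<in> carrier (G Mod ?K)" using x by (rule \<pi>.hom_closed)
    then show "(?K #> x) \<otimes>\<^bsub>G Mod ?K\<^esub> y = y \<otimes>\<^bsub>G Mod ?K\<^esub> (?K #> x)" if "y \<in> carrier (G Mod ?K)" for y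
      using Q.commute_generate[OF S' _ comm gen'[OF that]] by blast
  qed
  then show ?thesis using x by simp
qed

lemma generate_commute:
  assumes S: "S \<subseteq> carrier G" and c: "\<And>s t. s \<in> S \<Longrightarrow> t \<in> S \<Longrightarrow> s \<otimes> t = t \<otimes> s"
    and x: "x \<in> generate G S" and y: "y \<in> generate G S"
  shows "x \<otimes> y = y \<otimes> x"
proof (rule commute_generate[OF S _ _ y])
  show xc: "x \<in> carrier G" using x generate_in_carrier[OF S] by blast
  fix s assume "s \<in> S"
  then show "x \<otimes> s = s \<otimes> x"
    using commute_generate[OF S _ c x, of s] S by auto
qed

end

section \<open>Commutation with elements of the second and third centers\<close>

context macdonald_nat
begin

text \<open>The third term of the upper central series centralizes the third term of the lower one, and
  \<open>[A, D\<inverse>]\<close> is a power of \<open>A\<close>.\<close>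

lemma upper_central_2_D:
  assumes y: "y \<in> upper_central G 2"
  shows "y \<otimes> D = D \<otimes> y"
proof -
  have yc [simp]: "y \<in> carrier G" using y by (rule upper_central_closed)
  have y': "y \<in> upper_central G (Suc 1)" using y by (simp only: Suc_1)
  obtain c1 where c1: "c1 \<in> upper_central G 1" "y \<otimes> A = A \<otimes> c1 \<otimes> y"
    by (rule upper_central_conj[OF y' closed(1)])
  obtain c2 where c2: "c2 \<in> upper_central G 1" "y \<otimes> B = B \<otimes> c2 \<otimes> y"
    by (rule upper_central_conj[OF y' closed(2)])
  have [simp]: "c1 \<in> carrier G" "c2 \<in> carrier G" using c1(1) c2(1) upper_central_closed by auto
  note z1 = upper_central_1_commute[OF c1(1)] and z2 = upper_central_1_commute[OF c2(1)]
  have yA: "y \<otimes> (A \<otimes> x) = A \<otimes> (c1 \<otimes> (y \<otimes> x))" if "x \<in> carrier G" for x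
    using that c1(2) by (simp flip: m_assoc)
  have yB: "y \<otimes> (B \<otimes> x) = B \<otimes> (c2 \<otimes> (y \<otimes> x))" if "x \<in> carrier G" for x
    using that c2(2) by (simp flip: m_assoc)
  have "y \<otimes> A = A \<otimes> (c1 \<otimes> y)" using c1(2) by (simp add: m_assoc)
  then have "y \<otimes> (B \<otimes> A) = B \<otimes> (c2 \<otimes> (A \<otimes> (c1 \<otimes> y)))" by (simp only: yB closed)
  also have "c2 \<otimes> (A \<otimes> (c1 \<otimes> y)) = A \<otimes> (c2 \<otimes> (c1 \<otimes> y))"
    by (rule commute_left[OF z2]) auto
  also have "c2 \<otimes> (c1 \<otimes> y) = c1 \<otimes> (c2 \<otimes> y)" by (rule commute_left[OF z2]) auto
  finally have l: "y \<otimes> (B \<otimes> A) = (B \<otimes> A) \<otimes> (c1 \<otimes> (c2 \<otimes> y))" by (simp add: m_assoc)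
  have "y \<otimes> (A \<otimes> (B \<otimes> D)) = A \<otimes> (c1 \<otimes> (B \<otimes> (c2 \<otimes> (y \<otimes> D))))" by (simp only: yA yB closed m_closed yc)
  also have "c1 \<otimes> (B \<otimes> (c2 \<otimes> (y \<otimes> D))) = B \<otimes> (c1 \<otimes> (c2 \<otimes> (y \<otimes> D)))"
    by (rule commute_left[OF z1]) auto
  finally have "A \<otimes> (B \<otimes> (c1 \<otimes> (c2 \<otimes> (y \<otimes> D)))) = (A \<otimes> (B \<otimes> D)) \<otimes> (c1 \<otimes> (c2 \<otimes> y))"
    using l by (simp only: B_A)
  then have "c1 \<otimes> (c2 \<otimes> (y \<otimes> D)) = D \<otimes> (c1 \<otimes> (c2 \<otimes> y))" by (simp add: m_assoc)
  also have "\<dots> = c1 \<otimes> (D \<otimes> (c2 \<otimes> y))" by (rule commute_left[OF z1, symmetric]) auto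
  also have "D \<otimes> (c2 \<otimes> y) = c2 \<otimes> (D \<otimes> y)" by (rule commute_left[OF z2, symmetric]) auto
  finally show ?thesis by simp
qed

text \<open>Conjugation \<open>\<phi>\<close> by x multiplies A and B on the right by elements
  \<open>a1\<close>, \<open>b1\<close> of Z_2, and hence D by a central z. Applied to D A = A^a D,
  and since \<open>a1\<close> commutes with D, it gives \<phi>(A^a) = A^a a1, while \<phi>(A) = A
  a1. So A^(a-1) is fixed.\<close>

lemma upper_central_3_Apow:
  assumes x: "x \<in> upper_central G 3"
  shows "x \<otimes> A [^] (int a - 1) = A [^] (int a - 1) \<otimes> x"
proof -
  have xc [simp]: "x \<in> carrier G" using x by (rule upper_central_closed)
  have x': "x \<in> upper_central G (Suc 2)" using x by (simp only: Suc_numeral semiring_norm)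
  obtain a1 where a1: "a1 \<in> upper_central G 2" "x \<otimes> A = A \<otimes> a1 \<otimes> x"
    by (rule upper_central_conj[OF x' closed(1)])
  obtain b1 where b1: "b1 \<in> upper_central G 2" "x \<otimes> B = B \<otimes> b1 \<otimes> x"
    by (rule upper_central_conj[OF x' closed(2)])
  have c [simp]: "a1 \<in> carrier G" "b1 \<in> carrier G" using a1(1) b1(1) upper_central_closed by auto
  have s2: "Suc 1 = 2" by simp
  obtain z1 where z1: "z1 \<in> upper_central G 1" "a1 \<otimes> B = B \<otimes> z1 \<otimes> a1"
    using upper_central_conj[of a1 1 B] a1(1) s2 by (metis closed(2))
  obtain z2 where z2: "z2 \<in> upper_central G 1" "b1 \<otimes> A = A \<otimes> z2 \<otimes> b1"
    using upper_central_conj[of b1 1 A] b1(1) s2 by (metis closed(1))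
  obtain z3 where z3: "z3 \<in> upper_central G 1" "b1 \<otimes> a1 = a1 \<otimes> z3 \<otimes> b1"
    using upper_central_conj[of b1 1 a1] b1(1) s2 by (metis c(1))
  have zc [simp]: "z1 \<in> carrier G" "z2 \<in> carrier G" "z3 \<in> carrier G"
    using z1(1) z2(1) z3(1) upper_central_closed by auto
  note zz = upper_central_1_commute[OF z1(1)] upper_central_1_commute[OF z2(1)] upper_central_1_commute[OF z3(1)]
  define y where "y = a1 \<otimes> b1"
  have yc [simp]: "y \<in> carrier G" by (simp add: y_def)
  have y2: "y \<in> upper_central G 2" unfolding y_def
    using a1(1) b1(1) by (intro subgroup.m_closed[OF upper_central_subgroup])
  note yD = upper_central_2_D[OF y2]
  define \<phi> where "\<phi> t = x \<otimes> t \<otimes> inv x" for t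
  have \<phi>_mult: "\<phi> (s \<otimes> t) = \<phi> s \<otimes> \<phi> t" if "s \<in> carrier G" "t \<in> carrier G" for s t
    using that by (simp add: \<phi>_def m_assoc)
  have \<phi>_closed [simp]: "\<phi> t \<in> carrier G" if "t \<in> carrier G" for t using that by (simp add: \<phi>_def)
  have \<phi>A: "\<phi> A = A \<otimes> a1" and \<phi>B: "\<phi> B = B \<otimes> b1" using a1(2) b1(2) by (simp_all add: \<phi>_def m_assoc)
  have "\<phi> B \<otimes> \<phi> A = \<phi> A \<otimes> (\<phi> B \<otimes> \<phi> D)" using arg_cong[OF B_A, of \<phi>] by (simp add: \<phi>_mult)
  then have eq: "B \<otimes> (b1 \<otimes> (A \<otimes> a1)) = A \<otimes> (a1 \<otimes> (B \<otimes> (b1 \<otimes> \<phi> D)))" by (simp add: \<phi>A \<phi>B m_assoc)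
  have l: "B \<otimes> (b1 \<otimes> (A \<otimes> a1)) = (B \<otimes> A) \<otimes> (z2 \<otimes> (z3 \<otimes> y))"
  proof -
    have "b1 \<otimes> (A \<otimes> a1) = A \<otimes> (z2 \<otimes> (b1 \<otimes> a1))" using z2(2) by (simp flip: m_assoc)
    also have "b1 \<otimes> a1 = z3 \<otimes> y" unfolding z3(2) y_def using zz(3)[of a1] by (simp add: m_assoc flip: m_assoc[of z3 a1])
    finally show ?thesis by (simp add: m_assoc)
  qed
  have r: "A \<otimes> (a1 \<otimes> (B \<otimes> (b1 \<otimes> \<phi> D))) = (A \<otimes> B) \<otimes> (z1 \<otimes> (y \<otimes> \<phi> D))"
  proof -
    have "a1 \<otimes> (B \<otimes> (b1 \<otimes> \<phi> D)) = B \<otimes> (z1 \<otimes> (a1 \<otimes> (b1 \<otimes> \<phi> D)))" using z1(2) by (simp flip: m_assoc)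
    then show ?thesis by (simp add: y_def m_assoc)
  qed
  \<comment> \<open>z collects the central elements picked up when \<open>a1\<close> passes B and
    \<open>b1\<close> passes A and \<open>a1\<close>.\<close>
  define z where "z = z2 \<otimes> z3 \<otimes> inv z1"
  have z: "z \<in> upper_central G 1" unfolding z_def
    using z1(1) z2(1) z3(1) by (intro subgroup.m_closed[OF upper_central_subgroup] subgroup.m_inv_closed[OF upper_central_subgroup])
  have zc' [simp]: "z \<in> carrier G" by (simp add: z_def)
  note zcomm = upper_central_1_commute[OF z]
  have "(A \<otimes> B) \<otimes> (z1 \<otimes> (y \<otimes> \<phi> D)) = (A \<otimes> (B \<otimes> D)) \<otimes> (z2 \<otimes> (z3 \<otimes> y))"
    using eq unfolding l r B_A by simp
  then have "z1 \<otimes> (y \<otimes> \<phi> D) = D \<otimes> (z2 \<otimes> (z3 \<otimes> y))" by (simp add: m_assoc)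
  then have "inv z1 \<otimes> (z1 \<otimes> (y \<otimes> \<phi> D)) = inv z1 \<otimes> (D \<otimes> (z2 \<otimes> (z3 \<otimes> y)))" by (simp only:)
  then have "y \<otimes> \<phi> D = inv z1 \<otimes> ((D \<otimes> (z2 \<otimes> z3)) \<otimes> y)" by (simp add: m_assoc)
  also have "\<dots> = (z \<otimes> D) \<otimes> y"
  proof -
    have "inv z1 \<in> upper_central G 1" using z1(1) by (intro subgroup.m_inv_closed[OF upper_central_subgroup])
    from upper_central_1_commute[OF this] have i: "inv z1 \<otimes> t = t \<otimes> inv z1" if "t \<in> carrier G" for t using that by blast
    have "inv z1 \<otimes> ((D \<otimes> (z2 \<otimes> z3)) \<otimes> y) = (inv z1 \<otimes> (D \<otimes> (z2 \<otimes> z3))) \<otimes> y" by (simp add: m_assoc)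
    also have "inv z1 \<otimes> (D \<otimes> (z2 \<otimes> z3)) = D \<otimes> z" by (subst i) (simp_all add: z_def m_assoc)
    finally show ?thesis using zcomm[of D] by simp
  qed
  also have "\<dots> = z \<otimes> (y \<otimes> D)" by (simp add: m_assoc yD)
  also have "\<dots> = y \<otimes> (z \<otimes> D)" by (rule commute_left[OF zcomm]) auto
  finally have \<phi>D: "\<phi> D = z \<otimes> D" by simp
  have a1D: "a1 \<otimes> D = D \<otimes> a1" by (rule upper_central_2_D[OF a1(1)])
  have \<phi>pow: "\<phi> (A [^] i) = \<phi> A [^] i" for i :: int
  proof -
    have "x \<otimes> A = \<phi> A \<otimes> x" by (simp add: \<phi>_def m_assoc)
    then have "x \<otimes> A [^] i = \<phi> A [^] i \<otimes> x" by (intro conj_int_pow) auto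
    then show ?thesis by (simp add: \<phi>_def m_assoc)
  qed
  have "\<phi> D \<otimes> \<phi> A = \<phi> (A [^] int a) \<otimes> \<phi> D" using arg_cong[OF D_A, of \<phi>] by (simp add: \<phi>_mult)
  then have "z \<otimes> (D \<otimes> (A \<otimes> a1)) = \<phi> (A [^] int a) \<otimes> (z \<otimes> D)" by (simp add: \<phi>D \<phi>A m_assoc)
  also have "\<dots> = z \<otimes> (\<phi> (A [^] int a) \<otimes> D)" by (rule commute_left[OF zcomm, symmetric]) auto
  finally have "D \<otimes> (A \<otimes> a1) = \<phi> (A [^] int a) \<otimes> D" by simp
  moreover have "D \<otimes> (A \<otimes> a1) = (D \<otimes> A) \<otimes> a1" by (simp add: m_assoc)
  then have "D \<otimes> (A \<otimes> a1) = (A [^] int a \<otimes> a1) \<otimes> D"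
    unfolding D_A using a1D by (simp add: m_assoc)
  ultimately have "\<phi> (A [^] int a) = A [^] int a \<otimes> a1" by simp
  moreover have "A [^] int a = A [^] (int a - 1) \<otimes> A" using int_pow_mult[of A "int a - 1" 1] by simp
  ultimately have "\<phi> (A [^] (int a - 1)) \<otimes> (A \<otimes> a1) = A [^] (int a - 1) \<otimes> (A \<otimes> a1)"
    by (simp add: \<phi>_mult \<phi>A m_assoc)
  then have "\<phi> (A [^] (int a - 1)) = A [^] (int a - 1)" by simp
  then have "\<phi> (A [^] (int a - 1)) \<otimes> x = A [^] (int a - 1) \<otimes> x" by simp
  then show ?thesis by (simp add: \<phi>_def m_assoc)
qed

lemmas upper_central_3_Bpow = macdonald_nat.upper_central_3_Apow[OF swap_nat]

end


section \<open>The centre and the power subgroups\<close>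

context mac_p_group
begin

definition Q :: nat where "Q = p ^ m"

lemma int_Q [simp]: "int Q = q" by (simp add: q_def Q_def)

lemma Q_pos: "Q > 0" using p by (simp add: Q_def prime_gt_0_nat)

lemmas Apow_mod = int_pow_eq_mod[OF closed(1) A_q3]
lemmas Bpow_mod = int_pow_eq_mod[OF closed(2) B_q3]

lemma N_mult:
  obtains I K J where "N i k j \<otimes> N i' k' j' = N I K J"
    "[int I = int i + int i'] (mod q)" "[int K = int k + int k' + int j * int i'] (mod q)"
    "[int J = int j + int j'] (mod q)"
proof -
  let ?S = "\<Sum>l<i'. a ^ its l j"
  have "N i k j \<otimes> N i' k' j' = N i k j \<otimes> A [^] i' \<otimes> D [^] k' \<otimes> B [^] j'"
    by (simp add: N_def[of i'] m_assoc)
  also have "\<dots> = N (i + a ^ k * ?S) (k + its i' j + k') (a ^ k' * it i' j + j')"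
    by (simp only: N_Apow N_D N_B)
  finally have eq: "N i k j \<otimes> N i' k' j' = N (i + a ^ k * ?S) (k + its i' j + k') (a ^ k' * it i' j + j')" .
  have "[(\<Sum>l<i'. int a ^ its l j) = (\<Sum>l<i'. 1)] (mod q)" by (intro cong_sum power_cong_1_q)
  from cong_mult[OF power_cong_1_q[of k] this]
  have "[int (a ^ k * ?S) = int i'] (mod q)" by simp
  from cong_add[OF cong_refl[of "int i"] this]
  have 1: "[int (i + a ^ k * ?S) = int i + int i'] (mod q)" by simp
  have "[int k + int (its i' j) + int k' = int k + int i' * int j + int k'] (mod q)"
    by (intro cong_add cong_refl its_cong1)
  then have 2: "[int (k + its i' j + k') = int k + int k' + int j * int i'] (mod q)"
    by (simp add: algebra_simps)
  have "[int a ^ k' * int (it i' j) + int j' = 1 * int j + int j'] (mod q)"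
    by (intro cong_add cong_mult cong_refl power_cong_1_q it_cong1)
  then have 3: "[int (a ^ k' * it i' j + j') = int j + int j'] (mod q)" by simp
  show thesis by (rule that[OF eq 1 2 3])
qed

lemma N_pow:
  obtains I K J where "N i k j [^] n = N I K J"
    "[int I = int n * int i] (mod q)" "[int K = int n * int k + int (n choose 2) * (int i * int j)] (mod q)"
    "[int J = int n * int j] (mod q)"
proof -
  have "\<exists>I K J. N i k j [^] n = N I K J \<and> [int I = int n * int i] (mod q) \<and>
      [int K = int n * int k + int (n choose 2) * (int i * int j)] (mod q) \<and> [int J = int n * int j] (mod q)"
  proof (induction n)
    case 0
    show ?case by (rule exI[of _ 0], rule exI[of _ 0], rule exI[of _ 0]) (simp add: numeral_2_eq_2)
  next
    case (Suc n)
    then obtain I K J where IH: "N i k j [^] n = N I K J" "[int I = int n * int i] (mod q)"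
      "[int K = int n * int k + int (n choose 2) * (int i * int j)] (mod q)" "[int J = int n * int j] (mod q)"
      by blast
    obtain I' K' J' where M: "N I K J \<otimes> N i k j = N I' K' J'" "[int I' = int I + int i] (mod q)"
      "[int K' = int K + int k + int J * int i] (mod q)" "[int J' = int J + int j] (mod q)"
      by (rule N_mult)
    have "[int I + int i = int n * int i + int i] (mod q)" by (intro cong_add cong_refl IH)
    from cong_trans[OF M(2) this] have 1: "[int I' = int (Suc n) * int i] (mod q)" by (simp add: algebra_simps)
    have "[int K + int k + int J * int i =
        int n * int k + int (n choose 2) * (int i * int j) + int k + int n * int j * int i] (mod q)"
      by (intro cong_add cong_mult cong_refl IH)
    from cong_trans[OF M(3) this]
    have 2: "[int K' = int (Suc n) * int k + int (Suc n choose 2) * (int i * int j)] (mod q)"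
      by (simp add: numeral_2_eq_2 algebra_simps)
    have "[int J + int j = int n * int j + int j] (mod q)" by (intro cong_add cong_refl IH)
    from cong_trans[OF M(4) this] have 3: "[int J' = int (Suc n) * int j] (mod q)" by (simp add: algebra_simps)
    show ?case using IH(1) M(1) 1 2 3 by auto
  qed
  then show thesis using that by blast
qed

lemma N_eqD_q:
  assumes "N i k j = N i' k' j'"
  shows "[int i = int i'] (mod q)" "[int k = int k'] (mod q)" "[int j = int j'] (mod q)"
proof -
  note D = N_eqD[OF assms]
  show "[int k = int k'] (mod q)" and j: "[int j = int j'] (mod q)" using cong_q2D D by auto
  have "[int i - int j = int i' - int j'] (mod q)" using cong_q2D[OF cong_q2I[OF D(3)]] .
  from cong_add[OF this j] show "[int i = int i'] (mod q)" by simp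
qed

definition W :: "'a set" where "W = {N i k j | i k j. q dvd int i \<and> q dvd int k \<and> q dvd int j}"

lemma N_in_W_iff: "N i k j \<in> W \<longleftrightarrow> q dvd int i \<and> q dvd int k \<and> q dvd int j"
proof
  assume "N i k j \<in> W"
  then obtain i' k' j' where h: "N i k j = N i' k' j'" "q dvd int i'" "q dvd int k'" "q dvd int j'"
    by (auto simp: W_def)
  show "q dvd int i \<and> q dvd int k \<and> q dvd int j"
    using N_eqD_q[OF h(1)] h(2-4) by (simp add: cong_dvd_iff)
qed (auto simp: W_def)

abbreviation "X \<equiv> A [^] Q"
abbreviation "Y \<equiv> B [^] Q"
abbreviation "Z \<equiv> D [^] Q"

lemma N_W: "N (Q * i) (Q * k) (Q * j) = X [^] i \<otimes> (Z [^] k \<otimes> Y [^] j)"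
  by (simp add: N_def nat_pow_pow)

lemma W_eq: "W = {X [^] i \<otimes> (Z [^] k \<otimes> Y [^] j) | (i::nat) (k::nat) (j::nat). True}"
proof -
  have "q dvd int i \<longleftrightarrow> (\<exists>l. i = Q * l)" for i
    unfolding int_Q[symmetric] by (simp only: of_nat_dvd_iff) (auto elim: dvdE)
  then have "W = {N i k j | i k j. (\<exists>l. i = Q * l) \<and> (\<exists>l. k = Q * l) \<and> (\<exists>l. j = Q * l)}"
    by (simp only: W_def)
  also have "\<dots> = {N (Q * i) (Q * k) (Q * j) | i k j. True}" by blast
  finally show ?thesis unfolding N_W .
qed

lemma q_dvd_Q_choose: "q dvd int (Q choose 2)" by (intro dvd_choose_two') (simp only: int_Q dvd_refl)

lemma C2_dvd: "q ^ n dvd int j \<Longrightarrow> q ^ n dvd int (Suc j choose 2)"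
proof -
  assume "q ^ n dvd int j"
  then have "[2 * int (Suc j choose 2) = 2 * 0] (mod q ^ n)" by (simp add: two_C cong_0_iff)
  from cancel_two[OF this] show ?thesis by (simp add: cong_0_iff)
qed

text \<open>When q divides j, the corrections to the iterate and to its partial sum contain enough
  factors q to vanish, so multiplication by A^q changes i only.\<close>

lemma N_X:
  assumes j: "q dvd int j"
  shows "N i k j \<otimes> X = N (i + a ^ k * Q) k j"
proof -
  have cj: "q dvd int (Suc j choose 2)" using C2_dvd[of 1 j] j by simp
  have "[int Q * (e * int (Suc j choose 2)) = 0] (mod q^3)" "[int Q * (e^2 * int (Suc j choose 3)) = 0] (mod q^3)"
    using mult_dvd_mono[OF dvd_refl[of q] mult_dvd_mono[OF q_dvd_e cj]]
      mult_dvd_mono[OF dvd_refl[of q] dvd_mult2[OF q2_dvd_e2]]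
    by (simp_all add: cong_0_iff power3_eq_cube power2_eq_square mult.assoc)
  from cong_add[OF cong_add[OF cong_refl[of "int j"] this(1)] this(2)]
  have 1: "[int (it Q j) = int j] (mod q^3)"
    using cong_trans[OF it_cong3[OF q_dvd_Q_choose]] by simp
  have "[int (its Q j) = int Q * int j] (mod q^2)" by (rule its_cong2'[OF q_dvd_Q_choose])
  moreover have "[int Q * int j = 0] (mod q^2)"
    using j by (simp add: int_Q cong_0_iff power2_eq_square mult_dvd_mono)
  ultimately have "[int (its Q j) = 0] (mod q^2)" by (rule cong_trans)
  from cong_add[OF cong_refl[of "int k"] this] have 2: "[int (k + its Q j) = int k] (mod q^2)" by simp
  have s1: "[e * int j * int (Q choose 2) = 0] (mod q^3)"
    using mult_dvd_mono[OF mult_dvd_mono[OF q_dvd_e j] q_dvd_Q_choose]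
    by (simp add: cong_0_iff power3_eq_cube mult_ac)
  have "[e^2 * (int (Q choose 3) * (int (Suc j choose 2) + int j^2)) = e^2 * 0] (mod q^3)"
    using cj j by (intro cong_e2) (simp add: cong_0_iff power2_eq_square)
  from cong_add[OF cong_add[OF cong_refl[of "int Q"] s1] this]
  have "[(\<Sum>l<Q. int a ^ its l j) = int Q] (mod q^3)"
    using cong_trans[OF sum_power_its_cong[OF q_dvd_Q_choose]] by simp
  from cong_mult[OF cong_refl[of "int a ^ k"] this]
  have 3: "[int (a ^ k * (\<Sum>l<Q. a ^ its l j)) = int (a ^ k * Q)] (mod q^3)" by simp
  from cong_diff[OF cong_add[OF cong_refl[of "int i"] 3] 1]
  have "[int (i + a ^ k * (\<Sum>l<Q. a ^ its l j)) - int (it Q j) = int (i + a ^ k * Q) - int j] (mod q^3)" by simp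
  then show ?thesis unfolding N_Apow by (rule N_eqI[OF 2 cong_q2I[OF 1]])
qed

lemma XY: "X \<otimes> Y = Y \<otimes> X"
proof -
  have "N 0 0 Q \<otimes> X = N Q 0 Q" using N_X[of Q 0 0] by (simp add: int_Q)
  then show ?thesis by (simp add: N_def)
qed

lemma power_Q_cong: "[int a ^ Q * q = q] (mod q^3)"
proof -
  have "[1 + int Q * e = 1 + 0] (mod q^2)"
    using q2_dvd_nq[of q] by (intro cong_add cong_refl) (simp only: int_Q cong_0_iff dvd_refl)
  then have "[int a ^ Q = 1] (mod q^2)" using cong_trans[OF power_cong2[of Q]] by simp
  then have "q^2 * q dvd (int a ^ Q - 1) * q" by (simp add: cong_iff_dvd_diff)
  then show ?thesis by (simp add: cong_iff_dvd_diff power2_eq_square power3_eq_cube algebra_simps)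
qed

lemma ZX: "Z \<otimes> X = X \<otimes> Z"
proof -
  have "A [^] (a ^ Q * Q) = A [^] Q"
    using Apow_mod[of "int (a ^ Q * Q)" "int Q"] power_Q_cong
    by (simp only: int_pow_int) (simp add: int_Q flip: int_Q)
  then show ?thesis using Dpow_Apow_nat[of Q Q] by simp
qed

lemma YZ: "Y \<otimes> Z = Z \<otimes> Y"
proof -
  have "B [^] (a ^ Q * Q) = B [^] Q"
    using Bpow_mod[of "int (a ^ Q * Q)" "int Q"] power_Q_cong
    by (simp only: int_pow_int) (simp add: int_Q flip: int_Q)
  then show ?thesis using Bpow_Dpow_nat[of Q Q] by simp
qed

lemma W_generate: "W = generate G {X, Y, Z}"
proof
  show "W \<subseteq> generate G {X, Y, Z}"
  proof -
    interpret S: subgroup "generate G {X, Y, Z}" G by (rule generate_is_subgroup) auto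
    have pw: "x [^] (n::nat) \<in> generate G {X, Y, Z}" if "x \<in> {X, Y, Z}" for x n
    proof (induction n)
      case (Suc n)
      then show ?case using that by (auto intro: generate.incl)
    qed simp
    have "X [^] i \<otimes> (Z [^] k \<otimes> Y [^] j) \<in> generate G {X, Y, Z}" for i k j :: nat
      by (intro S.m_closed pw) auto
    then show ?thesis unfolding W_eq by blast
  qed
  have "W \<subseteq> carrier G" by (auto simp: W_def)
  have ord: "x [^] nat (q^3) = \<one>" if "x \<in> {X, Y, Z}" for x
  proof -
    have "D [^] nat (q^3) = \<one>"
    proof -
      have "D [^] (q^3) = (D [^] (q^2)) [^] q" by (simp add: int_pow_pow power2_eq_square power3_eq_cube)
      then show ?thesis using D_q2 int_pow_int[of G D "nat (q^3)"] by (simp only: nat_q3) simp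
    qed
    moreover have "(y [^] Q) [^] nat (q^3) = (y [^] nat (q^3)) [^] Q" if "y \<in> carrier G" for y
      using that by (simp add: nat_pow_pow mult.commute)
    ultimately show ?thesis using that A_order B_order by auto
  qed
  show "generate G {X, Y, Z} \<subseteq> W"
  proof (rule generate_subgroup_incl)
    have WI: "X [^] i \<otimes> (Z [^] k \<otimes> Y [^] j) \<in> W" for i k j :: nat unfolding W_eq by blast
    have "X \<in> W" "Y \<in> W" "Z \<in> W" using WI[of 1 0 0] WI[of 0 0 1] WI[of 0 1 0] by auto
    then show "{X, Y, Z} \<subseteq> W" by blast
    have gc: "x \<otimes> y = y \<otimes> x" if "x \<in> W" "y \<in> W" for x y
    proof (rule generate_commute)
      show "x \<in> generate G {X, Y, Z}" "y \<in> generate G {X, Y, Z}"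
        using that \<open>W \<subseteq> generate G {X, Y, Z}\<close> by auto
    qed (use XY YZ ZX in auto)
    show "subgroup W G"
    proof
      show "W \<subseteq> carrier G" by fact
      show "\<one> \<in> W" using WI[of 0 0 0] by simp
      show mult: "x \<otimes> y \<in> W" if "x \<in> W" "y \<in> W" for x y
      proof -
        obtain i k j i' k' j' where x: "x = N i k j" "q dvd int i" "q dvd int k" "q dvd int j"
          and y: "y = N i' k' j'" "q dvd int i'" "q dvd int k'" "q dvd int j'"
          using \<open>x \<in> W\<close> \<open>y \<in> W\<close> by (auto simp: W_def)
        obtain I K J where M: "N i k j \<otimes> N i' k' j' = N I K J" "[int I = int i + int i'] (mod q)"
          "[int K = int k + int k' + int j * int i'] (mod q)" "[int J = int j + int j'] (mod q)"
          by (rule N_mult)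
        have "q dvd int I" "q dvd int K" "q dvd int J"
          using M(2-4) x y by (simp_all add: cong_dvd_iff)
        then show ?thesis using M(1) x y by (simp add: N_in_W_iff)
      qed
      show "inv x \<in> W" if xW: "x \<in> W" for x
      proof -
        have xc: "x \<in> carrier G" using xW \<open>W \<subseteq> carrier G\<close> by blast
        obtain i k j where x: "x = N i k j" using xW by (auto simp: W_def)
        have "x [^] n \<in> W" for n :: nat
        proof (induction n)
          case 0 show ?case using WI[of 0 0 0] by simp
        next
          case (Suc n) then show ?case using mult xW by simp
        qed
        \<comment> \<open>W is already closed under products, so it suffices to write the inverse as
          a positive power. The exponent q^3 kills x because x is a product of commuting powers of
          X, Z and Y.\<close>
        moreover have "inv x = x [^] (nat (q^3) - 1)"
        proof (rule inv_equality)
          have xx: "x \<in> generate G {X, Y, Z}" using xW \<open>W \<subseteq> generate G {X, Y, Z}\<close> by blast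
          obtain i k j :: nat where x: "x = X [^] i \<otimes> (Z [^] k \<otimes> Y [^] j)" using xW unfolding W_eq by blast
          have ZY: "Z [^] k \<otimes> Y [^] j = Y [^] j \<otimes> Z [^] k"
            by (rule gc) (use WI[of 0 k 0] WI[of 0 0 j] in auto)
          have XZY: "X [^] i \<otimes> (Z [^] k \<otimes> Y [^] j) = (Z [^] k \<otimes> Y [^] j) \<otimes> X [^] i"
            by (rule gc) (use WI[of i 0 0] WI[of 0 k j] in auto)
          have swap: "(y [^] l) [^] nat (q^3) = (y [^] nat (q^3)) [^] l" if "y \<in> carrier G" for y and l :: nat
            using that by (simp add: nat_pow_pow mult.commute)
          have "x [^] nat (q^3) = (X [^] i) [^] nat (q^3) \<otimes> ((Z [^] k) [^] nat (q^3) \<otimes> (Y [^] j) [^] nat (q^3))"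
            unfolding x by (subst pow_mult_distrib[OF XZY]) (auto simp: pow_mult_distrib[OF ZY])
          also have "\<dots> = \<one>" using ord[of X] ord[of Y] ord[of Z] by (simp only: swap nat_pow_closed closed) simp
          finally have "x [^] nat (q^3) = \<one>" .
          moreover have "nat (q^3) = Suc (nat (q^3) - 1)" using q_pos by simp
          ultimately show "x [^] (nat (q^3) - 1) \<otimes> x = \<one>" by (metis nat_pow_Suc)
        qed (use xc in auto)
        ultimately show ?thesis by simp
      qed
    qed
  qed
qed

lemma W_subgroup: "subgroup W G" unfolding W_generate by (rule generate_is_subgroup) auto

lemma W_commute: "x \<in> W \<Longrightarrow> y \<in> W \<Longrightarrow> x \<otimes> y = y \<otimes> x"
  unfolding W_generate by (rule generate_commute[of "{X, Y, Z}"]) (use XY YZ ZX in auto)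

lemma W_comm_group: "comm_group (G\<lparr>carrier := W\<rparr>)"
proof -
  interpret S: group "G\<lparr>carrier := W\<rparr>" by (rule subgroup_imp_group[OF W_subgroup])
  show ?thesis by unfold_locales (simp add: W_commute)
qed

text \<open>The mixed term of \<open>N_pow\<close> carries the factor C(q, 2), which q divides
  because q is odd.\<close>

lemma pow_Q_in_W:
  assumes "t \<in> carrier G"
  shows "t [^] Q \<in> W"
proof -
  obtain i k j where t: "t = N i k j" using assms by (rule obtain_N)
  obtain I K J where P: "N i k j [^] Q = N I K J" "[int I = int Q * int i] (mod q)"
    "[int K = int Q * int k + int (Q choose 2) * (int i * int j)] (mod q)" "[int J = int Q * int j] (mod q)"
    by (rule N_pow)
  have "q dvd int I" "q dvd int K" "q dvd int J"
    using P(2-4) q_dvd_Q_choose by (simp_all add: cong_dvd_iff int_Q)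
  then show ?thesis using P(1) by (simp add: t N_in_W_iff)
qed

lemma power_subgroup_Q: "power_subgroup G (int p ^ m) = W"
proof -
  have eq: "{t [^] (int p ^ m) | t. t \<in> carrier G} = {t [^] Q | t. t \<in> carrier G}"
  proof -
    have "int p ^ m = int Q" by (simp add: Q_def)
    then show ?thesis by (simp only: int_pow_int)
  qed
  show ?thesis unfolding power_subgroup_def eq
  proof
    show "generate G {t [^] Q | t. t \<in> carrier G} \<subseteq> W"
      using pow_Q_in_W by (intro generate_subgroup_incl W_subgroup) blast
    show "W \<subseteq> generate G {t [^] Q | t. t \<in> carrier G}"
      unfolding W_generate by (rule mono_generate) auto
  qed
qed

text \<open>Natural exponents already give a subgroup, since A has finite order.\<close>

definition ZC :: "'a set" where "ZC = {A [^] (Q^2 * n) | n. True}"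

lemma A_Q2: "A [^] (Q^2) = A [^] (q^2)" and B_Q2: "B [^] (Q^2) = B [^] (q^2)"
  using int_pow_int[of G A "Q^2"] int_pow_int[of G B "Q^2"] by simp_all

lemma W_pow_Q:
  assumes "w \<in> W"
  shows "w [^] Q \<in> ZC"
proof -
  obtain i k j :: nat where w: "w = X [^] i \<otimes> (Z [^] k \<otimes> Y [^] j)" using assms unfolding W_eq by blast
  \<comment> \<open>c = q - 1 stands for -1: B^(q^2 j) = A^(-q^2 j) is to be written with a natural
    exponent, and A^(q^3) = 1.\<close>
  obtain c where "Q = Suc c" using Q_pos by (auto simp: gr0_conv_Suc)
  then have c: "int c = q - 1" using int_Q by simp
  have inW: "X [^] i \<in> W" "Z [^] k \<in> W" "Y [^] j \<in> W" for i k j :: nat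
    unfolding W_eq by (force intro: exI[of _ i] exI[of _ "0::nat"] exI[of _ k] exI[of _ j])+
  have ZY: "Z [^] k \<otimes> Y [^] j = Y [^] j \<otimes> Z [^] k" by (intro W_commute inW)
  have XZY: "X [^] i \<otimes> (Z [^] k \<otimes> Y [^] j) = (Z [^] k \<otimes> Y [^] j) \<otimes> X [^] i"
    by (intro W_commute inW subgroup.m_closed[OF W_subgroup])
  have "w [^] Q = (X [^] i) [^] Q \<otimes> ((Z [^] k) [^] Q \<otimes> (Y [^] j) [^] Q)"
    unfolding w by (subst pow_mult_distrib[OF XZY]) (auto simp: pow_mult_distrib[OF ZY])
  also have "\<dots> = N (Q * (Q * i)) (Q * (Q * k)) (Q * (Q * j))"
    by (simp add: N_W nat_pow_pow mult.commute)
  also have "\<dots> = N (Q^2 * (i + c * j)) 0 0"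
  proof (rule N_eqI)
    show "[int (Q * (Q * k)) = int 0] (mod q^2)" "[int (Q * (Q * j)) = int 0] (mod q^2)"
      by (simp_all add: cong_0_iff power2_eq_square mult.assoc)
    then have "int (Q * (Q * i)) - int (Q * (Q * j)) - (int (Q^2 * (i + c * j)) - int 0) = q^3 * (- int j)"
      by (simp add: c power2_eq_square power3_eq_cube algebra_simps)
    then show "[int (Q * (Q * i)) - int (Q * (Q * j)) = int (Q^2 * (i + c * j)) - int 0] (mod q^3)"
      unfolding cong_iff_dvd_diff by simp
  qed
  finally show ?thesis by (auto simp: ZC_def N_def)
qed

lemma ZC_subset_center: "ZC \<subseteq> center G"
proof
  fix z assume "z \<in> ZC"
  then obtain n where z: "z = A [^] (Q^2 * n)" by (auto simp: ZC_def)
  have zA: "z \<otimes> A = A \<otimes> z" using pow_commute[of A A "Q^2 * n"] by (simp add: z)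
  have "(A [^] (Q^2)) [^] n \<otimes> B = B \<otimes> (A [^] (Q^2)) [^] n"
    using commute_A_q2 A_Q2 pow_commute[of B "A [^] (Q^2)" n] by simp
  then have zB: "z \<otimes> B = B \<otimes> z" by (simp add: z nat_pow_pow)
  have "z \<otimes> y = y \<otimes> z" if "y \<in> generate G {A, B}" for y
    by (rule commute_generate[OF _ _ _ that]) (use zA zB z in auto)
  then show "z \<in> center G" unfolding center_def gen[symmetric] by (simp add: z)
qed

text \<open>Converse of \<open>power_cong_1\<close>. Cancelling \<open>e\<close>, of valuation
  exactly m, in e * geo a k = a (a^k - 1) leaves q^2 dividing \<open>geo a k\<close>. As
  \<open>geo a k\<close> agrees with k modulo q, first q divides k; then the linear correction C(k +
  1, 2) e vanishes modulo q^2.\<close>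

lemma power_dvd_Q2:
  assumes "[int a ^ k = 1] (mod q^3)"
  shows "q^2 dvd int k"
proof -
  obtain u where u: "e = q * u" "\<not> int p dvd u" by (rule obtain_unit)
  have "q^3 dvd e * int (geo a k)"
    using assms geo_mult_pred[of a k] by (simp add: e_def cong_iff_dvd_diff)
  then have "q^2 dvd u * int (geo a k)" using q_pos by (simp add: u power2_eq_square power3_eq_cube mult.assoc)
  moreover have "coprime (q^2) u" using coprime_pI[OF u(2), of m] by (simp add: q_def coprime_commute)
  ultimately have g: "q^2 dvd int (geo a k)" by (simp add: coprime_dvd_mult_right_iff)
  then have "q dvd int (geo a k)" by (rule dvd_trans[rotated]) (simp add: power2_eq_square)
  then have "q dvd int k" using geo_cong_q[of k] by (simp add: cong_dvd_iff)
  then have "q dvd int (Suc k choose 2)" using C2_dvd[of 1 k] by simp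
  then have "q^2 dvd int (Suc k choose 2) * e" using q_dvd_e by (simp add: power2_eq_square mult_dvd_mono)
  moreover have "q^2 dvd int k + int (Suc k choose 2) * e" using geo_cong2[of k] g by (simp add: cong_dvd_iff)
  ultimately show ?thesis by (simp add: dvd_add_left_iff)
qed

lemma power_dvd_Q:
  assumes "[int a ^ k = 1] (mod q^2)"
  shows "q dvd int k"
proof -
  obtain u where u: "e = q * u" "\<not> int p dvd u" by (rule obtain_unit)
  have "[1 + int k * e = 1] (mod q^2)" using cong_trans[OF cong_sym[OF power_cong2] assms] .
  then have "q dvd int k * u" using q_pos by (simp add: cong_iff_dvd_diff u power2_eq_square mult.left_commute)
  moreover have "coprime q u" using coprime_pI[OF u(2), of m] by (simp add: q_def coprime_commute)
  ultimately show ?thesis by (simp add: coprime_dvd_mult_left_iff)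
qed

lemma center_subset_ZC: "center G \<subseteq> ZC"
proof
  fix z assume z: "z \<in> center G"
  then have zc: "z \<in> carrier G" and comm: "\<And>x. x \<in> carrier G \<Longrightarrow> z \<otimes> x = x \<otimes> z" by (auto simp: center_def)
  obtain i k j where zN: "z = N i k j" using zc by (rule obtain_N)
  have "A \<otimes> N i k j = N (Suc i) k j"
    unfolding N_def nat_pow_Suc2[OF closed(1)] by (simp add: m_assoc)
  then have "N (i + a ^ k) (k + j) (geo a j) = N (Suc i) k j" using comm[OF closed(1)] by (simp add: zN N_A)
  note D = N_eqD[OF this]
  \<comment> \<open>The exponents of D in z A and A z differ by j.\<close>
  have "[int k + int j - int k = int k - int k] (mod q^2)" using D(1) by (intro cong_diff cong_refl) simp
  then have j: "q^2 dvd int j" by (simp add: cong_0_iff)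
  have "[int (i + a ^ k) - int (geo a j) + int (geo a j) - int i = int (Suc i) - int j + int j - int i] (mod q^3)"
    by (intro cong_diff cong_add cong_refl D(3) geo_cong_self[OF j])
  then have "[int a ^ k = 1] (mod q^3)" by simp
  then have k: "q^2 dvd int k" by (rule power_dvd_Q2)
  \<comment> \<open>As q^2 divides j, the factor B^j is absorbed into the power of A; the new
    exponent is i - j reduced to a natural number.\<close>
  define n where "n = nat ((int i - int j) mod q^3)"
  have n: "int n = (int i - int j) mod q^3" using q_pos by (simp add: n_def)
  have zn: "z = N n 0 0" unfolding zN
    by (rule N_eqI) (use j k in \<open>auto simp: cong_0_iff n cong_def\<close>)
  \<comment> \<open>Moving A^n past a single B produces D with exponent \<open>its n 1\<close>,
    which has to vanish modulo q^2.\<close>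
  have "N 0 0 1 \<otimes> A [^] n = N n 0 1"
    using comm[OF closed(2)] by (simp add: zn N_def)
  then have "N (0 + a ^ 0 * (\<Sum>l<n. a ^ its l 1)) (0 + its n 1) (it n 1) = N n 0 1" unfolding N_Apow .
  from N_eqD(1)[OF this] have "q^2 dvd int (its n 1)" by (simp add: cong_0_iff)
  then have "q^2 dvd int n * int 1 + int (n choose 2) * (e * int (Suc 1 choose 2))"
    using its_cong2[of n 1] by (simp add: cong_dvd_iff del: One_nat_def)
  then have s: "q^2 dvd int n + int (n choose 2) * e" by (simp add: numeral_2_eq_2)
  \<comment> \<open>Two rounds: first q divides n, then q divides C(n, 2) and the correction drops
    out modulo q^2.\<close>
  have "q dvd q^2" by (simp add: power2_eq_square)
  from dvd_trans[OF this s] have "q dvd int n + int (n choose 2) * e" .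
  then have "q dvd int n" using q_dvd_e by (simp add: dvd_add_left_iff)
  then have "q dvd int (n choose 2)" by (rule dvd_choose_two')
  then have "q^2 dvd int (n choose 2) * e" using q_dvd_e by (simp add: power2_eq_square mult_dvd_mono)
  then have "q^2 dvd int n" using s by (simp add: dvd_add_left_iff)
  then have "int (Q^2) dvd int n" by simp
  then have "Q^2 dvd n" by (simp only: of_nat_dvd_iff)
  then show "z \<in> ZC" by (auto simp: zn N_def ZC_def elim!: dvdE)
qed

lemma center_eq: "center G = ZC"
  using ZC_subset_center center_subset_ZC by blast

lemma power_subgroup_Q2: "power_subgroup G (int p ^ (2 * m)) = ZC"
proof -
  have Q2: "Q * Q = p ^ (2 * m)" by (simp add: Q_def power_add mult_2)
  have eq: "{t [^] (int p ^ (2 * m)) | t. t \<in> carrier G} = {t [^] (Q * Q) | t. t \<in> carrier G}"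
  proof -
    have "int p ^ (2 * m) = int (Q * Q)" unfolding Q2 by simp
    then show ?thesis by (simp only: int_pow_int)
  qed
  have sub: "subgroup ZC G" using subgroup_center by (simp add: center_eq)
  show ?thesis unfolding power_subgroup_def eq
  proof
    have "t [^] (Q * Q) \<in> ZC" if "t \<in> carrier G" for t
      using W_pow_Q[OF pow_Q_in_W[OF that]] that by (simp add: nat_pow_pow)
    then show "generate G {t [^] (Q * Q) | t. t \<in> carrier G} \<subseteq> ZC"
      by (intro generate_subgroup_incl sub) blast
    show "ZC \<subseteq> generate G {t [^] (Q * Q) | t. t \<in> carrier G}"
    proof
      fix z assume "z \<in> ZC"
      then obtain n where "z = A [^] (Q^2 * n)" by (auto simp: ZC_def)
      then have "z = (A [^] n) [^] (Q * Q)" by (simp add: nat_pow_pow power2_eq_square mult.commute)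
      then show "z \<in> generate G {t [^] (Q * Q) | t. t \<in> carrier G}" by (intro generate.incl) auto
    qed
  qed
qed

lemma pow_Q3: "t \<in> carrier G \<Longrightarrow> t [^] (Q * Q * Q) = \<one>"
proof -
  assume t: "t \<in> carrier G"
  obtain n where n: "(t [^] Q) [^] Q = A [^] (Q^2 * n)"
    using W_pow_Q[OF pow_Q_in_W[OF t]] unfolding ZC_def by blast
  have "t [^] (Q * Q * Q) = ((t [^] Q) [^] Q) [^] Q" using t by (simp add: nat_pow_pow)
  also have "\<dots> = (A [^] (Q^2 * n)) [^] Q" by (simp only: n)
  also have "\<dots> = (A [^] nat (q^3)) [^] n"
  proof -
    have "q^3 = int (Q^2 * Q)" by (simp add: power2_eq_square power3_eq_cube)
    then have "nat (q^3) = Q^2 * Q" by (simp only: nat_int)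
    then show ?thesis by (simp add: nat_pow_pow mult_ac)
  qed
  finally show ?thesis by (simp add: A_order)
qed

lemma group_exponent_eq: "group_exponent G = p ^ (3 * m)"
proof -
  have "3 * m = m + m + m" by simp
  then have Q3: "p ^ (3 * m) = Q * Q * Q" unfolding Q_def power_add[symmetric] by (simp only:)
  have "local.ord t dvd Q * Q * Q" if "t \<in> carrier G" for t
    using pow_Q3[OF that] that by (simp add: pow_eq_id)
  then have 1: "group_exponent G dvd Q * Q * Q" unfolding group_exponent_def by (intro Lcm_least) auto
  have "N (local.ord A) 0 0 = N 0 0 0" by (simp add: N_def)
  from N_eqD(3)[OF this] have "int (Q * Q * Q) dvd int (local.ord A)"
    by (simp add: cong_0_iff power3_eq_cube)
  then have "Q * Q * Q dvd local.ord A" by (simp only: of_nat_dvd_iff)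
  also have "local.ord A dvd group_exponent G" unfolding group_exponent_def by (intro dvd_Lcm) auto
  finally show ?thesis using 1 unfolding Q3 by (intro dvd_antisym)
qed

end


section \<open>The quotient and the third centre\<close>

definition heis_matrix :: "int \<Rightarrow> int \<Rightarrow> int \<Rightarrow> nat \<times> nat \<Rightarrow> int" where
  "heis_matrix x y z = (\<lambda>(i, j) \<in> {..<3} \<times> {..<3}.
     if i = j then 1 else if (i, j) = (0, 1) then x else if (i, j) = (1, 2) then y
     else if (i, j) = (0, 2) then z else 0)"

lemma lessThan_3: "{..<3} = {0, 1, 2 :: nat}" by auto

lemma heis_matrix_mult:
  assumes q: "q > 1" and "{x, y, z, x', y', z'} \<subseteq> {0..q - 1}"
  shows "heis_matrix x y z \<otimes>\<^bsub>heisenberg_group (residue_ring q)\<^esub> heis_matrix x' y' z' =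
    heis_matrix ((x + x') mod q) ((y + y') mod q) ((z + z' + x * y') mod q)"
proof -
  interpret residues q "residue_ring q" by unfold_locales (use q in auto)
  have sum: "(\<Oplus>\<^bsub>residue_ring q\<^esub>k\<in>{..<3}. f k) = (f 0 + f 1 + f 2) mod q"
    if "f 0 \<in> {0..q-1}" "f 1 \<in> {0..q-1}" "f 2 \<in> {0..q-1}" for f :: "nat \<Rightarrow> int"
  proof -
    have f: "f 0 \<in> carrier (residue_ring q)" "f 1 \<in> carrier (residue_ring q)" "f 2 \<in> carrier (residue_ring q)"
      using that by (auto simp: residue_ring_def)
    have "(\<Oplus>\<^bsub>residue_ring q\<^esub>k\<in>{..<3}. f k) = f 0 \<oplus>\<^bsub>residue_ring q\<^esub> (f 1 \<oplus>\<^bsub>residue_ring q\<^esub> f 2)"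
      unfolding lessThan_3 using f by (simp add: finsum_insert)
    also have "\<dots> = (f 0 + f 1 + f 2) mod q"
      by (simp add: residue_ring_def mod_add_right_eq add.assoc)
    finally show ?thesis .
  qed
  have b: "x mod q = x" "y mod q = y" "z mod q = z" "x' mod q = x'" "y' mod q = y'" "z' mod q = z'"
    using assms by auto
  have m: "a \<otimes>\<^bsub>residue_ring q\<^esub> b = (a * b) mod q" for a b by (simp add: residue_ring_def)
  have mq: "v mod q \<in> {0..q - 1}" for v using q by simp
  show ?thesis
  proof
    fix ij :: "nat \<times> nat"
    obtain i j where ij: "ij = (i, j)" by force
    show "(heis_matrix x y z \<otimes>\<^bsub>heisenberg_group (residue_ring q)\<^esub> heis_matrix x' y' z') ij =
        heis_matrix ((x + x') mod q) ((y + y') mod q) ((z + z' + x * y') mod q) ij"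
    proof (cases "i < 3 \<and> j < 3")
      case True
      then have "i \<in> {0, 1, 2}" "j \<in> {0, 1, 2}" by auto
      moreover have "(heis_matrix x y z \<otimes>\<^bsub>heisenberg_group (residue_ring q)\<^esub> heis_matrix x' y' z') ij =
          (heis_matrix x y z (i, 0) * heis_matrix x' y' z' (0, j) mod q
           + heis_matrix x y z (i, 1) * heis_matrix x' y' z' (1, j) mod q
           + heis_matrix x y z (i, 2) * heis_matrix x' y' z' (2, j) mod q) mod q"
        using True by (simp add: heisenberg_group_def ij m) (subst sum, use mq in auto)
      moreover have "(z' + x * y' mod q + z) mod q = (z + z' + x * y') mod q"
      proof -
        have "[z' + x * y' mod q + z = z' + x * y' + z] (mod q)"
          by (intro cong_add cong_refl) (simp add: cong_def)
        then show ?thesis by (simp only: cong_def add_ac)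
      qed
      moreover have "(1 mod q) = 1" using q by simp
      ultimately show ?thesis
        by (elim insertE emptyE) (simp_all add: heis_matrix_def ij b add.commute)
    qed (auto simp: heisenberg_group_def heis_matrix_def ij)
  qed
qed

lemma carrier_heisenberg:
  "carrier (heisenberg_group (residue_ring q)) =
    {heis_matrix x y z | x y z. x \<in> {0..q - 1} \<and> y \<in> {0..q - 1} \<and> z \<in> {0..q - 1}}" if q: "q > 1"
proof (intro equalityI subsetI)
  fix M assume M: "M \<in> carrier (heisenberg_group (residue_ring q))"
  then have ext: "M \<in> extensional ({..<3} \<times> {..<3})"
    and mem: "\<And>i j. i < 3 \<Longrightarrow> j < 3 \<Longrightarrow> M (i, j) \<in> {0..q - 1}"
    and diag: "\<And>i. i < 3 \<Longrightarrow> M (i, i) = 1" and low: "\<And>i j. i < 3 \<Longrightarrow> j < i \<Longrightarrow> M (i, j) = 0"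
    by (auto simp: heisenberg_group_def residue_ring_def PiE_def)
  have "M = heis_matrix (M (0, 1)) (M (1, 2)) (M (0, 2))"
  proof
    fix ij :: "nat \<times> nat"
    obtain i j where ij: "ij = (i, j)" by force
    show "M ij = heis_matrix (M (0, 1)) (M (1, 2)) (M (0, 2)) ij"
    proof (cases "i < 3 \<and> j < 3")
      case True
      then have "i \<in> {0, 1, 2}" "j \<in> {0, 1, 2}" by auto
      then show ?thesis using diag low by (auto simp: heis_matrix_def ij)
    qed (use ext in \<open>auto simp: heis_matrix_def ij extensional_def\<close>)
  qed
  moreover have "M (0, 1) \<in> {0..q - 1}" "M (1, 2) \<in> {0..q - 1}" "M (0, 2) \<in> {0..q - 1}"
    using mem by auto
  ultimately show "M \<in> {heis_matrix x y z | x y z. x \<in> {0..q - 1} \<and> y \<in> {0..q - 1} \<and> z \<in> {0..q - 1}}"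
    by blast
next
  fix M assume "M \<in> {heis_matrix x y z | x y z. x \<in> {0..q - 1} \<and> y \<in> {0..q - 1} \<and> z \<in> {0..q - 1}}"
  then show "M \<in> carrier (heisenberg_group (residue_ring q))"
    using q by (auto simp: heisenberg_group_def residue_ring_def heis_matrix_def PiE_def)
qed

lemma one_heisenberg: "\<one>\<^bsub>heisenberg_group (residue_ring q)\<^esub> = heis_matrix 0 0 0"
proof
  fix ij :: "nat \<times> nat"
  obtain i j where ij: "ij = (i, j)" by force
  show "\<one>\<^bsub>heisenberg_group (residue_ring q)\<^esub> ij = heis_matrix 0 0 0 ij"
    by (simp add: heisenberg_group_def residue_ring_def heis_matrix_def ij)
qed

lemma heis_matrix_eq_iff: "heis_matrix x y z = heis_matrix x' y' z' \<longleftrightarrow> x = x' \<and> y = y' \<and> z = z'"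
proof
  assume h: "heis_matrix x y z = heis_matrix x' y' z'"
  show "x = x' \<and> y = y' \<and> z = z'"
    using fun_cong[OF h, of "(0, 1)"] fun_cong[OF h, of "(1, 2)"] fun_cong[OF h, of "(0, 2)"]
    by (simp add: heis_matrix_def)
qed simp

context mac_p_group
begin

text \<open>j goes to position (0, 1) and i to (1, 2), because the mixed term of
  \<open>N_mult\<close> is j i' and that of the matrix product is x y'.\<close>

definition heis :: "'a \<Rightarrow> nat \<times> nat \<Rightarrow> int" where
  "heis x = (case SOME (i, k, j). x = N i k j of (i, k, j) \<Rightarrow>
     heis_matrix (int j mod q) (int i mod q) (int k mod q))"

lemma heis_N: "heis (N i k j) = heis_matrix (int j mod q) (int i mod q) (int k mod q)"
proof -
  define t where "t = (SOME (i', k', j'). N i k j = N i' k' j')"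
  obtain i' k' j' where t: "t = (i', k', j')" by (rule prod_cases3)
  have "case t of (i', k', j') \<Rightarrow> N i k j = N i' k' j'"
    unfolding t_def by (rule someI[of _ "(i, k, j)"]) simp
  then have "N i k j = N i' k' j'" by (simp add: t)
  from N_eqD_q[OF this] have "int j mod q = int j' mod q" "int i mod q = int i' mod q" "int k mod q = int k' mod q"
    by (auto simp: cong_def)
  then show ?thesis unfolding heis_def t_def[symmetric] t by simp
qed

abbreviation "H \<equiv> heisenberg_group (residue_ring q)"

lemma q_gt1: "q > 1" using q_gt2 by simp

lemma mod_q_range: "v mod q \<in> {0..q - 1}" using q_pos by simp

lemma heis_hom: "heis \<in> hom G H"
proof (rule homI)
  fix x assume "x \<in> carrier G"
  then obtain i k j where "x = N i k j" by (rule obtain_N)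
  then have "heis x = heis_matrix (int j mod q) (int i mod q) (int k mod q)" by (simp only: heis_N)
  then show "heis x \<in> carrier H" unfolding carrier_heisenberg[OF q_gt1] using mod_q_range by blast
next
  fix x y assume "x \<in> carrier G" "y \<in> carrier G"
  obtain i k j where x: "x = N i k j" using \<open>x \<in> carrier G\<close> by (rule obtain_N)
  obtain i' k' j' where y: "y = N i' k' j'" using \<open>y \<in> carrier G\<close> by (rule obtain_N)
  obtain I K J where M: "N i k j \<otimes> N i' k' j' = N I K J" "[int I = int i + int i'] (mod q)"
    "[int K = int k + int k' + int j * int i'] (mod q)" "[int J = int j + int j'] (mod q)"
    by (rule N_mult)
  have "heis (x \<otimes> y) = heis_matrix ((int j + int j') mod q) ((int i + int i') mod q) ((int k + int k' + int j * int i') mod q)"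
    using M(2-4) by (simp add: x y M(1) heis_N cong_def)
  moreover have "(int j mod q + int j' mod q) mod q = (int j + int j') mod q"
    "(int i mod q + int i' mod q) mod q = (int i + int i') mod q"
    "(int k mod q + int k' mod q + (int j mod q) * (int i' mod q)) mod q = (int k + int k' + int j * int i') mod q"
  proof -
    have "[int k mod q + int k' mod q + (int j mod q) * (int i' mod q) = int k + int k' + int j * int i'] (mod q)"
      by (intro cong_add cong_mult) (simp_all add: cong_def)
    then show "(int k mod q + int k' mod q + (int j mod q) * (int i' mod q)) mod q = (int k + int k' + int j * int i') mod q"
      by (simp only: cong_def)
  qed (simp_all only: mod_add_eq)
  moreover have "heis x \<otimes>\<^bsub>H\<^esub> heis y = heis_matrix ((int j mod q + int j' mod q) mod q) ((int i mod q + int i' mod q) mod q)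
     ((int k mod q + int k' mod q + (int j mod q) * (int i' mod q)) mod q)"
    unfolding x y heis_N by (intro heis_matrix_mult q_gt1) (use mod_q_range in auto)
  ultimately show "heis (x \<otimes> y) = heis x \<otimes>\<^bsub>H\<^esub> heis y" by (simp only:)
qed

lemma heis_surj: "heis ` carrier G = carrier H"
proof
  show "heis ` carrier G \<subseteq> carrier H" using heis_hom by (auto simp: hom_def)
  show "carrier H \<subseteq> heis ` carrier G"
  proof
    fix M assume "M \<in> carrier H"
    then obtain x y z where M: "M = heis_matrix x y z" "x \<in> {0..q - 1}" "y \<in> {0..q - 1}" "z \<in> {0..q - 1}"
      unfolding carrier_heisenberg[OF q_gt1] by blast
    then have "M = heis (N (nat y) (nat z) (nat x))" by (simp add: heis_N)
    then show "M \<in> heis ` carrier G" by (rule image_eqI) (rule N_closed)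
  qed
qed

lemma heis_one: "heis \<one> = \<one>\<^bsub>H\<^esub>"
  using heis_N[of 0 0 0] by (simp add: one_heisenberg)

text \<open>A homomorphic image of a group is a group, which replaces a verification of the axioms
  for matrices.\<close>

lemma group_heisenberg: "group H"
proof -
  have "group (H\<lparr>carrier := heis ` carrier G, one := heis \<one>\<rparr>)"
    using heis_hom by (rule hom_imp_img_group)
  then show ?thesis by (simp add: heis_surj heis_one)
qed

lemma kernel_heis: "kernel G H heis = W"
proof -
  have eq: "N i k j \<in> kernel G H heis \<longleftrightarrow> N i k j \<in> W" for i k j
    unfolding N_in_W_iff
    by (auto simp: kernel_def heis_N one_heisenberg heis_matrix_eq_iff dvd_eq_mod_eq_0)
  show ?thesis
  proof
    show "W \<subseteq> kernel G H heis"
    proof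
      fix x assume x: "x \<in> W"
      then have "x \<in> carrier G" using subgroup.mem_carrier[OF W_subgroup] by blast
      then obtain i k j where "x = N i k j" by (rule obtain_N)
      then show "x \<in> kernel G H heis" using eq x by simp
    qed
    show "kernel G H heis \<subseteq> W"
    proof
      fix x assume x: "x \<in> kernel G H heis"
      then have "x \<in> carrier G" by (simp add: kernel_def)
      then obtain i k j where "x = N i k j" by (rule obtain_N)
      then show "x \<in> W" using eq x by simp
    qed
  qed
qed

theorem Mod_W_iso: "G Mod W \<cong> H"
proof -
  interpret h: group_hom G H heis
    by (intro group_hom.intro group_hom_axioms.intro is_group group_heisenberg heis_hom)
  show ?thesis using h.FactGroup_iso_set[OF heis_surj] unfolding kernel_heis is_iso_def by blast
qed

text \<open>X has order q^2, whereas Z^q = 1 and Y^q = X^(-q). So exponents below q^2 for X and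
  below q for Z and Y represent each element of W once.\<close>

theorem card_W: "card W = p ^ (4 * m)"
proof -
  let ?f = "\<lambda>(i, k, j). N (Q * i) (Q * k) (Q * j)"
  let ?D = "{..<Q * Q} \<times> {..<Q} \<times> {..<Q}"
  have inj: "inj_on ?f ?D"
  proof (rule inj_onI)
    fix s t assume s: "s \<in> ?D" and t: "t \<in> ?D" and eq: "?f s = ?f t"
    obtain i k j where s': "s = (i, k, j)" by (rule prod_cases3)
    obtain i' k' j' where t': "t = (i', k', j')" by (rule prod_cases3)
    have "N (Q * i) (Q * k) (Q * j) = N (Q * i') (Q * k') (Q * j')" using eq by (simp add: s' t')
    note D = N_eqD[OF this]
    have canc: "x = x'" if "[int (Q * x) = int (Q * x')] (mod q^2)" "x < Q" "x' < Q" for x x'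
    proof -
      have "q * q dvd q * (int x - int x')" using that(1) by (simp add: cong_iff_dvd_diff power2_eq_square algebra_simps)
      then have "[int x = int x'] (mod int Q)" using q_pos by (simp add: cong_iff_dvd_diff)
      then have "[x = x'] (mod Q)" unfolding cong_int_iff .
      then show ?thesis using that(2,3) by (simp add: cong_def)
    qed
    have k: "k = k'" and j: "j = j'" using canc[OF D(1)] canc[OF D(2)] s t by (auto simp: s' t')
    have "q * (q * q) dvd q * (int i - int i')" using D(3) by (simp add: j cong_iff_dvd_diff power3_eq_cube algebra_simps)
    then have "[int i = int i'] (mod int (Q * Q))" using q_pos by (simp add: cong_iff_dvd_diff)
    then have "[i = i'] (mod (Q * Q))" unfolding cong_int_iff .
    then have "i = i'" using s t by (simp add: s' t' cong_def)
    then show "s = t" by (simp add: s' t' k j)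
  qed
  have img: "?f ` ?D = W"
  proof
    show "?f ` ?D \<subseteq> W" unfolding W_eq N_W[symmetric] by auto
    show "W \<subseteq> ?f ` ?D"
    proof
      fix w assume "w \<in> W"
      then obtain i k j where w: "w = N (Q * i) (Q * k) (Q * j)" unfolding W_eq N_W[symmetric] by blast
      \<comment> \<open>By Y^q = X^(-q), the quotient of j by q is carried over into the exponent of
        X.\<close>
      define i' where "i' = nat ((int i - q * int (j div Q)) mod (q * q))"
      have i': "int i' = (int i - q * int (j div Q)) mod (q * q)" using q_pos by (simp add: i'_def)
      have j: "int j = q * int (j div Q) + int (j mod Q)"
        by (metis int_Q of_nat_add of_nat_mult mult_div_mod_eq)
      have k: "int k = q * int (k div Q) + int (k mod Q)"
        by (metis int_Q of_nat_add of_nat_mult mult_div_mod_eq)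
      obtain s where s: "int i - q * int (j div Q) = int i' + q * q * s"
        unfolding i' by (metis mod_mult_div_eq)
      have "w = N (Q * i') (Q * (k mod Q)) (Q * (j mod Q))" unfolding w
      proof (rule N_eqI)
        show "[int (Q * k) = int (Q * (k mod Q))] (mod q\<^sup>2)"
          using k by (simp add: cong_iff_dvd_diff power2_eq_square flip: right_diff_distrib)
        show "[int (Q * j) = int (Q * (j mod Q))] (mod q\<^sup>2)"
          using j by (simp add: cong_iff_dvd_diff power2_eq_square flip: right_diff_distrib)
        have "int (Q * i) - int (Q * j) - (int (Q * i') - int (Q * (j mod Q))) =
            q * ((int i - q * int (j div Q) - int i') - (int j - (q * int (j div Q) + int (j mod Q))))"
          by (simp add: algebra_simps)
        also have "\<dots> = q^3 * s" using s j by (simp add: power3_eq_cube)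
        finally show "[int (Q * i) - int (Q * j) = int (Q * i') - int (Q * (j mod Q))] (mod q ^ 3)"
          by (simp add: cong_iff_dvd_diff)
      qed
      moreover have "i' < Q * Q"
      proof -
        have "int i' < int (Q * Q)" unfolding i' using q_pos by simp
        then show ?thesis by (simp only: of_nat_less_iff)
      qed
      ultimately show "w \<in> ?f ` ?D" using Q_pos by (intro image_eqI[of _ _ "(i', k mod Q, j mod Q)"]) auto
    qed
  qed
  have "card W = card ?D" using card_image[OF inj] unfolding img .
  also have "\<dots> = Q * Q * (Q * Q)" by (simp add: card_cartesian_product)
  also have "\<dots> = p ^ (m + m + (m + m))" by (simp add: Q_def power_add)
  also have "m + m + (m + m) = 4 * m" by simp
  finally show ?thesis .
qed

lemma upper_central_1_eq: "upper_central G 1 = ZC"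
  by (simp only: upper_central_1 center_eq)

lemma ZC_subgroup: "subgroup ZC G" using subgroup_center by (simp only: center_eq)

lemma ZC_upper: "ZC \<subseteq> upper_central G i" if "i \<ge> 1"
proof -
  have "upper_central G 1 \<subseteq> upper_central G i"
    using that by (induction i rule: dec_induct) (use upper_central_mono in blast)+
  then show ?thesis unfolding upper_central_1_eq .
qed

lemma ZC_commute: "c \<in> ZC \<Longrightarrow> x \<in> carrier G \<Longrightarrow> c \<otimes> x = x \<otimes> c"
  unfolding center_eq[symmetric] center_def by blast

lemma A_ZC: "A [^] (Q^2 * n) \<in> ZC" by (auto simp: ZC_def)

lemma B_ZC: "B [^] (Q^2 * n) \<in> ZC"
proof -
  have "B [^] (Q^2) = inv (A [^] (Q^2))"
    unfolding A_Q2 B_Q2 using A_q2_B_q2 by (metis closed(1,2) int_pow_closed inv_comm inv_equality)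
  moreover have "A [^] (Q^2) \<in> ZC" using A_ZC[of 1] by simp
  ultimately have b: "B [^] (Q^2) \<in> ZC" by (simp add: subgroup.m_inv_closed[OF ZC_subgroup])
  have "(B [^] (Q^2)) [^] n \<in> ZC"
    by (induction n) (auto intro: subgroup.one_closed subgroup.m_closed ZC_subgroup b)
  then show ?thesis by (simp add: nat_pow_pow)
qed

lemma obtain_aQ: obtains n where "a ^ Q = 1 + Q^2 * n"
proof -
  have "[1 + int Q * e = 1 + 0] (mod q^2)"
    using q2_dvd_nq[of q] by (intro cong_add cong_refl) (simp add: cong_0_iff)
  then have "[int a ^ Q = 1] (mod q^2)" using cong_trans[OF power_cong2[of Q]] by simp
  then have "[int (a ^ Q) = int 1] (mod int (Q^2))" by simp
  then have "[1 = a ^ Q] (mod Q^2)" unfolding cong_int_iff by (rule cong_sym)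
  moreover have "1 \<le> a ^ Q" using a by simp
  ultimately obtain n where "a ^ Q = n * Q^2 + 1" using cong_le_nat[of 1 "a ^ Q" "Q^2"] by (metis cong_sym)
  then show thesis by (intro that[of n]) simp
qed

lemma obtain_geoQ: obtains n where "geo a Q = Q + Q^2 * n"
proof -
  have "q dvd int (Suc Q choose 2)" using C2_dvd[of 1 Q] by simp
  then have "[int Q + int (Suc Q choose 2) * e = int Q + 0] (mod q^2)"
    using q_dvd_e by (intro cong_add cong_refl) (simp add: cong_0_iff power2_eq_square mult_dvd_mono)
  then have "[int (geo a Q) = int Q] (mod q^2)" using cong_trans[OF geo_cong2[of Q]] by simp
  then have "[int (geo a Q) = int Q] (mod int (Q^2))" by simp
  then have "[geo a Q = Q] (mod Q^2)" unfolding cong_int_iff .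
  moreover have "n \<le> geo a n" for n
  proof (induction n)
    case (Suc n)
    have "1 * (1 + n) \<le> a * (1 + geo a n)" using a Suc by (intro mult_le_mono) auto
    then show ?case by simp
  qed simp
  ultimately obtain n where "geo a Q = n * Q^2 + Q" using cong_le_nat[of Q "geo a Q" "Q^2"] by metis
  then show thesis by (intro that[of n]) simp
qed

text \<open>Conjugation by D^q raises A to the power a^q = 1 + q^2 n. So moving Z past A or B costs
  only a power of A^(q^2) or B^(q^2), which is central.\<close>

lemma Z_upper: "Z \<in> upper_central G 2"
proof -
  obtain n where n: "a ^ Q = 1 + Q^2 * n" by (rule obtain_aQ)
  have "Z \<in> upper_central G (Suc 1)"
  proof (rule upper_central_SucI[OF gen])
    fix s assume "s \<in> {A, B}"
    then consider "s = A" | "s = B" by blast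
    then show "\<exists>w\<in>upper_central G 1. Z \<otimes> s = s \<otimes> Z \<otimes> w"
    proof cases
      case 1
      let ?w = "A [^] (Q^2 * n)"
      have "Z \<otimes> A = A [^] (1 + Q^2 * n) \<otimes> Z" using Dpow_Apow_nat[of Q 1] n by simp
      also have "A [^] (1 + Q^2 * n) = A \<otimes> ?w" using nat_pow_mult[of A 1 "Q^2 * n"] by simp
      also have "A \<otimes> ?w \<otimes> Z = A \<otimes> Z \<otimes> ?w" using ZC_commute[OF A_ZC[of n], of Z] by (simp add: m_assoc)
      finally show ?thesis using A_ZC[of n] 1 unfolding upper_central_1_eq by blast
    next
      case 2
      let ?w = "inv (B [^] (Q^2 * n))"
      have "B \<otimes> Z = Z \<otimes> B [^] (1 + Q^2 * n)" using Bpow_Dpow_nat[of 1 Q] n by simp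
      also have "B [^] (1 + Q^2 * n) = B \<otimes> B [^] (Q^2 * n)" using nat_pow_mult[of B 1 "Q^2 * n"] by simp
      finally have "Z \<otimes> B = B \<otimes> Z \<otimes> ?w" by (simp add: m_assoc)
      moreover have "?w \<in> ZC" using B_ZC subgroup.m_inv_closed[OF ZC_subgroup] by blast
      ultimately show ?thesis using 2 unfolding upper_central_1_eq by blast
    qed
  qed auto
  then show ?thesis by (simp only: Suc_1)
qed

text \<open>\<open>geo a q\<close> is q modulo q^2, so moving B^q past A leaves D^q and a power of
  B^(q^2), both in Z_2. The case of A^q is symmetric.\<close>

lemma XY_upper: "X \<in> upper_central G 3" "Y \<in> upper_central G 3"
proof -
  interpret S: macdonald_nat G B A "inv D" a by (rule swap_nat)
  interpret U: subgroup "upper_central G 2" G by (rule upper_central_subgroup)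
  obtain n where n: "geo a Q = Q + Q^2 * n" by (rule obtain_geoQ)
  have one: "\<one> \<in> upper_central G 2" by simp
  have c: "A [^] (Q^2 * n) \<in> upper_central G 2" "B [^] (Q^2 * n) \<in> upper_central G 2"
    using ZC_upper[of 2] A_ZC B_ZC by auto
  have "X \<in> upper_central G (Suc 2)"
  proof (rule upper_central_SucI[OF gen])
    fix s assume "s \<in> {A, B}"
    then consider "s = A" | "s = B" by blast
    then show "\<exists>w\<in>upper_central G 2. X \<otimes> s = s \<otimes> X \<otimes> w"
    proof cases
      case 1
      then show ?thesis using pow_commute[of A A Q] one by (intro bexI[of _ \<one>]) auto
    next
      case 2
      let ?c = "A [^] (Q^2 * n)"
      have iZ: "inv D [^] Q = inv Z" by (simp add: nat_pow_inv)
      have "X \<otimes> B = B \<otimes> (inv Z \<otimes> (X \<otimes> ?c))"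
        using S.Bpow_A_nat[of Q] by (simp add: iZ n nat_pow_mult)
      also have "inv Z \<otimes> (X \<otimes> ?c) = X \<otimes> (inv Z \<otimes> ?c)"
      proof (rule commute_left)
        have "inv Z \<otimes> (Z \<otimes> X) \<otimes> inv Z = inv Z \<otimes> (X \<otimes> Z) \<otimes> inv Z" by (simp only: ZX)
        then show "inv Z \<otimes> X = X \<otimes> inv Z" by (simp add: m_assoc)
      qed auto
      finally have "X \<otimes> B = B \<otimes> X \<otimes> (inv Z \<otimes> ?c)" by (simp add: m_assoc)
      moreover have "inv Z \<otimes> ?c \<in> upper_central G 2" by (intro U.m_closed U.m_inv_closed Z_upper c)
      ultimately show ?thesis using 2 by blast
    qed
  qed auto
  then show "X \<in> upper_central G 3" by (simp only: Suc_numeral semiring_norm)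
  have "Y \<in> upper_central G (Suc 2)"
  proof (rule upper_central_SucI[OF gen])
    fix s assume "s \<in> {A, B}"
    then consider "s = A" | "s = B" by blast
    then show "\<exists>w\<in>upper_central G 2. Y \<otimes> s = s \<otimes> Y \<otimes> w"
    proof cases
      case 1
      let ?c = "B [^] (Q^2 * n)"
      have "Y \<otimes> A = A \<otimes> (Z \<otimes> (Y \<otimes> ?c))"
        using Bpow_A_nat[of Q] by (simp add: n nat_pow_mult)
      also have "Z \<otimes> (Y \<otimes> ?c) = Y \<otimes> (Z \<otimes> ?c)" by (rule commute_left[OF YZ[symmetric]]) auto
      finally have "Y \<otimes> A = A \<otimes> Y \<otimes> (Z \<otimes> ?c)" by (simp add: m_assoc)
      moreover have "Z \<otimes> ?c \<in> upper_central G 2" by (intro U.m_closed Z_upper c)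
      ultimately show ?thesis using 1 by blast
    next
      case 2
      then show ?thesis using pow_commute[of B B Q] one by (intro bexI[of _ \<one>]) auto
    qed
  qed auto
  then show "Y \<in> upper_central G 3" by (simp only: Suc_numeral semiring_norm)
qed

text \<open>A^(a-1) is A^(q u) with u prime to p, so X is one of its powers, and
  \<open>upper_central_3_Apow\<close> applies; likewise for Y.\<close>

lemma upper_central_3_commute:
  assumes x: "x \<in> upper_central G 3"
  shows "x \<otimes> X = X \<otimes> x" "x \<otimes> Y = Y \<otimes> x"
proof -
  have xc: "x \<in> carrier G" using x by (rule upper_central_closed)
  obtain u where u: "e = q * u" "\<not> int p dvd u" by (rule obtain_unit)
  have "coprime u (q^2)" using coprime_pI[OF u(2), of m] by (simp add: q_def)
  then obtain s v where "u * s + q^2 * v = 1" using bezout_int[of u "q^2"] by (auto simp: mult.commute)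
  then have "q * (u * s + q^2 * v) = q" by simp
  then have "[int Q = (int a - 1) * s] (mod q^3)"
    unfolding e_def[symmetric] u(1) cong_iff_dvd_diff
    by (intro dvdI[of _ _ v]) (simp add: power2_eq_square power3_eq_cube algebra_simps)
  then have eq: "X = (A [^] (int a - 1)) [^] s" "Y = (B [^] (int a - 1)) [^] s"
    using Apow_mod Bpow_mod by (auto simp: int_pow_pow simp del: int_Q simp flip: int_pow_int)
  show "x \<otimes> X = X \<otimes> x" unfolding eq(1)
    by (rule conj_int_pow) (use xc upper_central_3_Apow[OF x] in auto)
  show "x \<otimes> Y = Y \<otimes> x" unfolding eq(2)
    by (rule conj_int_pow) (use xc upper_central_3_Bpow[OF x] in auto)
qed

theorem upper_central_3_eq: "upper_central G 3 = W"
proof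
  have "{X, Y, Z} \<subseteq> upper_central G 3"
  proof -
    have "upper_central G 2 \<subseteq> upper_central G (Suc 2)" by (rule upper_central_mono)
    then have "Z \<in> upper_central G (Suc 2)" using Z_upper by (rule subsetD)
    then have "Z \<in> upper_central G 3" by (simp only: Suc_numeral semiring_norm)
    then show ?thesis using XY_upper by simp
  qed
  then show "W \<subseteq> upper_central G 3"
    unfolding W_generate by (intro generate_subgroup_incl upper_central_subgroup)
  show "upper_central G 3 \<subseteq> W"
  proof
    fix x assume x: "x \<in> upper_central G 3"
    note comm = upper_central_3_commute[OF x]
    have "x \<in> carrier G" using x by (rule upper_central_closed)
    then obtain i k j where xN: "x = N i k j" by (rule obtain_N)
    have XN: "X \<otimes> N i k j = N (Q + i) k j" by (simp add: N_def flip: m_assoc nat_pow_mult)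
    have "N (i + a ^ k * (\<Sum>l<Q. a ^ its l j)) (k + its Q j) (it Q j) = N (Q + i) k j"
      using comm(1) unfolding xN XN N_Apow .
    \<comment> \<open>The exponents of D in x X and X x differ by \<open>its Q j\<close>, which is q
      j modulo q^2. So q divides j, and then \<open>N_X\<close> allows the exponents of A to be
      compared.\<close>
    from N_eqD(1)[OF this] have "[int k + int (its Q j) - int k = int k - int k] (mod q^2)"
      by (intro cong_diff cong_refl) simp
    then have "q^2 dvd int (its Q j)" by (simp add: cong_0_iff)
    then have "q^2 dvd int Q * int j" using its_cong2'[OF q_dvd_Q_choose, of j] cong_dvd_iff by blast
    then have j: "q dvd int j" using q_pos by (simp add: power2_eq_square)
    have "N (i + a ^ k * Q) k j = N (Q + i) k j" using comm(1) unfolding xN XN N_X[OF j] .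
    from N_eqD(3)[OF this] have "q * q^2 dvd q * (int a ^ k - 1)"
      by (simp add: cong_iff_dvd_diff power3_eq_cube power2_eq_square algebra_simps)
    then have "[int a ^ k = 1] (mod q^2)" using q_pos by (simp add: cong_iff_dvd_diff)
    then have k: "q dvd int k" by (rule power_dvd_Q)
    \<comment> \<open>The factor D^k B^j now lies in the abelian subgroup W, which contains Y; so Y
      commutes with A^i alone, and this restricts i.\<close>
    have w: "N 0 k j \<in> W" using k j by (simp add: N_in_W_iff)
    have "Y \<in> W" using N_in_W_iff[of 0 0 Q] by (simp add: N_def)
    then have wY: "N 0 k j \<otimes> Y = Y \<otimes> N 0 k j" by (intro W_commute w)
    have x2: "x = A [^] i \<otimes> N 0 k j" by (simp add: xN N_def)
    have "(A [^] i \<otimes> Y) \<otimes> N 0 k j = A [^] i \<otimes> (N 0 k j \<otimes> Y)" by (simp add: m_assoc wY)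
    also have "\<dots> = x \<otimes> Y" by (simp add: x2 m_assoc)
    also have "\<dots> = (Y \<otimes> A [^] i) \<otimes> N 0 k j" unfolding comm(2) by (simp add: x2 m_assoc)
    finally have "Y \<otimes> A [^] i = A [^] i \<otimes> Y" by simp
    then have "N 0 0 Q \<otimes> A [^] i = N i 0 Q" by (simp add: N_def)
    then have "N (0 + a ^ 0 * (\<Sum>l<i. a ^ its l Q)) (0 + its i Q) (it i Q) = N i 0 Q" unfolding N_Apow .
    from N_eqD(1)[OF this] have "q^2 dvd int (its i Q)" by (simp add: cong_0_iff)
    then have 1: "q^2 dvd int i * int Q + int (i choose 2) * (e * int (Suc Q choose 2))"
      using its_cong2[of i Q] cong_dvd_iff by blast
    have "q dvd int (Suc Q choose 2)" using C2_dvd[of 1 Q] by simp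
    then have "q^2 dvd e * int (Suc Q choose 2)" using q_dvd_e by (simp add: power2_eq_square mult_dvd_mono)
    then have "q^2 dvd int (i choose 2) * (e * int (Suc Q choose 2))" by (rule dvd_mult)
    then have "q^2 dvd int i * int Q" using 1 by (simp only: dvd_add_left_iff)
    then have "q dvd int i" using q_pos by (simp add: power2_eq_square)
    then show "x \<in> W" using k j by (simp add: xN N_in_W_iff)
  qed
qed

end

section \<open>The presentation of the third center\<close>

lemma (in comm_group) generate_three:
  assumes c: "x \<in> carrier G" "y \<in> carrier G" "z \<in> carrier G"
    and n: "n > 0" "x [^] (n::nat) = \<one>" "y [^] n = \<one>" "z [^] n = \<one>"
    and u: "u \<in> generate G {x, y, z}"
  shows "\<exists>(i::nat) (k::nat) (j::nat). u = x [^] i \<otimes> (z [^] k \<otimes> y [^] j)"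
  using u
proof (induction rule: generate.induct)
  case one
  show ?case by (rule exI[of _ 0])+ (simp add: c)
next
  case (incl h)
  have "x = x [^] (1::nat) \<otimes> (z [^] (0::nat) \<otimes> y [^] (0::nat))"
    "y = x [^] (0::nat) \<otimes> (z [^] (0::nat) \<otimes> y [^] (1::nat))"
    "z = x [^] (0::nat) \<otimes> (z [^] (1::nat) \<otimes> y [^] (0::nat))" using c by auto
  with incl show ?case by blast
next
  case (inv h)
  have inv: "inv t = t [^] (n - 1)" if "t \<in> carrier G" "t [^] n = \<one>" for t
  proof (rule inv_equality)
    show "t [^] (n - 1) \<otimes> t = \<one>" using that n(1) nat_pow_Suc[of t "n - 1"] by simp
  qed (use that in auto)
  have "inv x = x [^] (n - 1) \<otimes> (z [^] (0::nat) \<otimes> y [^] (0::nat))"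
    "inv y = x [^] (0::nat) \<otimes> (z [^] (0::nat) \<otimes> y [^] (n - 1))"
    "inv z = x [^] (0::nat) \<otimes> (z [^] (n - 1) \<otimes> y [^] (0::nat))"
    using inv c n by auto
  with inv.hyps show ?case by blast
next
  case (eng h1 h2)
  obtain i :: nat and k :: nat and j :: nat and i' :: nat and k' :: nat and j' :: nat where h: "h1 = x [^] i \<otimes> (z [^] k \<otimes> y [^] j)"
    "h2 = x [^] i' \<otimes> (z [^] k' \<otimes> y [^] j')" using eng.IH by blast
  have "h1 \<otimes> h2 = x [^] (i + i') \<otimes> (z [^] (k + k') \<otimes> y [^] (j + j'))"
    unfolding h using c by (simp add: m_ac flip: nat_pow_mult)
  then show ?case by blast
qed

context mac_p_group
begin

text \<open>X, Y and Z satisfy the relations, and every element of the presented group is of the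
  form x^i z^k y^j. If its image is trivial, \<open>N_eqD\<close> shows that q divides k and j and
  that q^2 divides i - j; the torsion relations then make it trivial.\<close>

theorem W_iso: "G\<lparr>carrier := W\<rparr> \<cong> abelian_xyz_group p m"
proof -
  define rels :: "(xyz_gen word set \<times> xyz_gen word set) set" where
    "rels = (let F = free_group; x = free_gen gen_X; y = free_gen gen_Y; z = free_gen gen_Z in
        {(x \<otimes>\<^bsub>F\<^esub> y, y \<otimes>\<^bsub>F\<^esub> x), (y \<otimes>\<^bsub>F\<^esub> z, z \<otimes>\<^bsub>F\<^esub> y),
         (x \<otimes>\<^bsub>F\<^esub> z, z \<otimes>\<^bsub>F\<^esub> x), (x [^]\<^bsub>F\<^esub> (p ^ (2 * m)), \<one>\<^bsub>F\<^esub>),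
         (x [^]\<^bsub>F\<^esub> (p ^ m) \<otimes>\<^bsub>F\<^esub> y [^]\<^bsub>F\<^esub> (p ^ m), \<one>\<^bsub>F\<^esub>),
         (z [^]\<^bsub>F\<^esub> (p ^ m), \<one>\<^bsub>F\<^esub>)})"
  let ?H = "presented_group rels"
  have H: "abelian_xyz_group p m = ?H" by (simp add: abelian_xyz_group_def rels_def Let_def)
  have Q2: "p ^ (2 * m) = Q * Q" by (simp add: Q_def power_add mult_2)
  interpret F: group "free_group :: xyz_gen word set monoid" by (rule group_free_group)
  interpret P: presentation rels
    by unfold_locales (simp add: rels_def Let_def)
  define x where "x = P.proj (free_gen gen_X)"
  define y where "y = P.proj (free_gen gen_Y)"
  define z where "z = P.proj (free_gen gen_Z)"
  have c [simp]: "x \<in> carrier ?H" "y \<in> carrier ?H" "z \<in> carrier ?H"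
    by (simp_all add: x_def y_def z_def)
  let ?F = "free_group :: xyz_gen word set monoid"
  let ?x = "free_gen gen_X" and ?y = "free_gen gen_Y" and ?z = "free_gen gen_Z"
  have "(?x \<otimes>\<^bsub>?F\<^esub> ?y, ?y \<otimes>\<^bsub>?F\<^esub> ?x) \<in> rels" "(?y \<otimes>\<^bsub>?F\<^esub> ?z, ?z \<otimes>\<^bsub>?F\<^esub> ?y) \<in> rels"
    "(?x \<otimes>\<^bsub>?F\<^esub> ?z, ?z \<otimes>\<^bsub>?F\<^esub> ?x) \<in> rels" "(?x [^]\<^bsub>?F\<^esub> (Q * Q), \<one>\<^bsub>?F\<^esub>) \<in> rels"
    "(?x [^]\<^bsub>?F\<^esub> Q \<otimes>\<^bsub>?F\<^esub> ?y [^]\<^bsub>?F\<^esub> Q, \<one>\<^bsub>?F\<^esub>) \<in> rels" "(?z [^]\<^bsub>?F\<^esub> Q, \<one>\<^bsub>?F\<^esub>) \<in> rels"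
    unfolding rels_def Let_def Q2 Q_def[symmetric] by simp_all
  note this[THEN P.proj_rel]
  then have rel: "x \<otimes>\<^bsub>?H\<^esub> y = y \<otimes>\<^bsub>?H\<^esub> x" "y \<otimes>\<^bsub>?H\<^esub> z = z \<otimes>\<^bsub>?H\<^esub> y" "x \<otimes>\<^bsub>?H\<^esub> z = z \<otimes>\<^bsub>?H\<^esub> x"
    "x [^]\<^bsub>?H\<^esub> (Q * Q) = \<one>\<^bsub>?H\<^esub>" "x [^]\<^bsub>?H\<^esub> Q \<otimes>\<^bsub>?H\<^esub> y [^]\<^bsub>?H\<^esub> Q = \<one>\<^bsub>?H\<^esub>" "z [^]\<^bsub>?H\<^esub> Q = \<one>\<^bsub>?H\<^esub>"
    unfolding x_def y_def z_def by (simp_all add: P.proj.hom_nat_pow)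
  have "(UNIV :: xyz_gen set) = {gen_X, gen_Y, gen_Z}" by (auto intro: xyz_gen.exhaust)
  then have "range (\<lambda>t. P.proj (free_gen t)) = (\<lambda>t. P.proj (free_gen t)) ` {gen_X, gen_Y, gen_Z}"
    by (rule arg_cong)
  then have "range (\<lambda>t. P.proj (free_gen t)) = {x, y, z}" by (simp add: x_def y_def z_def)
  then have genH: "carrier ?H = generate ?H {x, y, z}" using P.carrier_presented by simp
  interpret H: comm_group ?H
  proof
    fix u v assume "u \<in> carrier ?H" "v \<in> carrier ?H"
    then have uv: "u \<in> generate ?H {x, y, z}" "v \<in> generate ?H {x, y, z}" using genH by blast+
    have "s \<otimes>\<^bsub>?H\<^esub> t = t \<otimes>\<^bsub>?H\<^esub> s" if "s \<in> {x, y, z}" "t \<in> {x, y, z}" for s t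
      using that by (elim insertE emptyE; simp only: rel)
    with _ show "u \<otimes>\<^bsub>?H\<^esub> v = v \<otimes>\<^bsub>?H\<^esub> u"
      by (rule P.presented.generate_commute[OF _ _ uv]) simp
  qed
  have yQ: "y [^]\<^bsub>?H\<^esub> Q = inv\<^bsub>?H\<^esub> (x [^]\<^bsub>?H\<^esub> Q)"
    by (metis P.presented.inv_equality P.presented.nat_pow_closed P.presented.inv_comm c(1,2) rel(5))
  have y2: "y [^]\<^bsub>?H\<^esub> (Q * Q) = \<one>\<^bsub>?H\<^esub>"
    using rel(4) yQ by (simp add: P.presented.nat_pow_inv flip: P.presented.nat_pow_pow)
  have z2: "z [^]\<^bsub>?H\<^esub> (Q * Q) = \<one>\<^bsub>?H\<^esub>" using rel(6) by (simp flip: P.presented.nat_pow_pow)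
  define g where "g = case_xyz_gen X Y Z"
  have g: "range g \<subseteq> carrier G" by (auto simp: g_def split: xyz_gen.split)
  interpret L: group_hom free_group G "free_lift G g"
    by (intro group_hom.intro group_hom_axioms.intro F.is_group is_group free_lift_hom g)
  have "Q * (Q * Q) = nat (q ^ 3)" 
    by (simp add: power3_eq_cube nat_mult_distrib flip: int_Q)
  then have X1: "X [^] (Q * Q) = \<one>" by (simp add: nat_pow_pow A_order)
  have Z1: "Z [^] Q = \<one>"
    using D_q2 int_pow_int[of G D "Q * Q"] by (simp add: nat_pow_pow power2_eq_square)
  have XY1: "X [^] Q \<otimes> Y [^] Q = \<one>"
    using A_q2_B_q2 int_pow_int[of G A "Q * Q"] int_pow_int[of G B "Q * Q"]
    by (simp add: nat_pow_pow power2_eq_square)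
  have lift: "free_lift G g u = free_lift G g v" if "(u, v) \<in> rels" for u v
    using that XY YZ ZX X1 Z1 XY1 unfolding rels_def Let_def Q2 Q_def[symmetric]
    by (auto simp: g L.hom_nat_pow) (simp_all add: g_def)
  obtain h where hom: "h \<in> hom ?H G" and hg: "\<And>t. h (P.proj (free_gen t)) = g t"
    using P.presented_lift[OF is_group g lift] by blast
  have hx: "h x = X" "h y = Y" "h z = Z" by (simp_all add: x_def y_def z_def hg) (simp_all add: g_def)
  interpret h: group_hom ?H G h
    by (intro group_hom.intro group_hom_axioms.intro P.presented.is_group is_group hom)
  have img: "h ` carrier ?H = W"
    unfolding W_generate genH using h.generate_img[of "{x, y, z}"] by (simp add: hx)
  have inj: "inj_on h (carrier ?H)"
  proof (rule h.inj_on_one_iff[THEN iffD2], intro allI impI)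
    fix u assume "u \<in> carrier ?H" and hu: "h u = \<one>"
    then have ug: "u \<in> generate ?H {x, y, z}" using genH by blast
    have "Q * Q > 0" using Q_pos by simp
    then obtain i :: nat and k :: nat and j :: nat where u: "u = x [^]\<^bsub>?H\<^esub> i \<otimes>\<^bsub>?H\<^esub> (z [^]\<^bsub>?H\<^esub> k \<otimes>\<^bsub>?H\<^esub> y [^]\<^bsub>?H\<^esub> j)"
      using H.generate_three[OF c _ rel(4) y2 z2 ug] by blast
    have "N (Q * i) (Q * k) (Q * j) = N 0 0 0"
      using hu unfolding u N_W by (simp add: hx h.hom_nat_pow)
    note D = N_eqD[OF this]
    have "q * q dvd q * int k" "q * q dvd q * int j" "q * (q * q) dvd q * (int i - int j)"
      using D by (simp_all add: cong_0_iff power2_eq_square power3_eq_cube algebra_simps)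
    then have d: "q dvd int k" "q dvd int j" "q * q dvd int i - int j" using q_pos by auto
    have "int Q dvd int k" "int Q dvd int j" using d by auto
    then obtain k' j' where k: "k = Q * k'" and j: "j = Q * j'" unfolding of_nat_dvd_iff by (elim dvdE)
    have zk: "z [^]\<^bsub>?H\<^esub> k = \<one>\<^bsub>?H\<^esub>" unfolding k using rel(6) by (simp flip: P.presented.nat_pow_pow)
    \<comment> \<open>x^i may be replaced by x^j, and with j = q j' the product becomes a power of
      x^q y^q.\<close>
    have "[int i = int j] (mod int (Q * Q))" using d(3) by (simp add: cong_iff_dvd_diff)
    then have "x [^]\<^bsub>?H\<^esub> int i = x [^]\<^bsub>?H\<^esub> int j" using rel(4)
      by (intro P.presented.int_pow_eq_mod[of x "int (Q * Q)"]) (simp_all only: int_pow_int c)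
    then have "x [^]\<^bsub>?H\<^esub> i \<otimes>\<^bsub>?H\<^esub> y [^]\<^bsub>?H\<^esub> j = x [^]\<^bsub>?H\<^esub> j \<otimes>\<^bsub>?H\<^esub> y [^]\<^bsub>?H\<^esub> j"
      by (simp only: int_pow_int)
    also have "\<dots> = (x [^]\<^bsub>?H\<^esub> Q \<otimes>\<^bsub>?H\<^esub> y [^]\<^bsub>?H\<^esub> Q) [^]\<^bsub>?H\<^esub> j'"
      unfolding j by (simp add: H.nat_pow_distrib P.presented.nat_pow_pow)
    finally show "u = \<one>\<^bsub>?H\<^esub>" unfolding u zk by (simp add: rel(5))
  qed
  have "h \<in> iso ?H (G\<lparr>carrier := W\<rparr>)"
    using h.homh img inj unfolding iso_def bij_betw_def hom_def by auto
  then have "?H \<cong> G\<lparr>carrier := W\<rparr>" unfolding is_iso_def by blast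
  then show ?thesis unfolding H by (rule P.presented.iso_sym)
qed

end


section \<open>Sylow subgroups of the Macdonald group\<close>

context macdonald_int
begin

text \<open>Multiplication by \<alpha> - 1 sums the geometric series. For negative \<alpha> the
  result is \<alpha> (\<alpha>^n + \<alpha> - 2) with n = |\<alpha>|, which vanishes at \<alpha> =
  -2; hence the bound on \<alpha>.\<close>

lemma excess_nonzero:
  assumes "\<alpha> \<ge> 3 \<or> \<alpha> \<le> -3"
  shows "excess \<noteq> 0"
proof -
  have "(\<alpha> - 1) * excess \<noteq> 0"
  proof (cases "\<alpha> \<ge> 0")
    case True
    then have "\<alpha> \<ge> 3" using assms by simp
    have "(\<alpha> - 1) * excess = (\<alpha> - 1) * \<alpha> ^ (nat \<alpha> + 1) - (\<alpha> - 1) * geoi \<alpha> (nat \<alpha>)"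
      using True by (simp add: excess_def right_diff_distrib)
    also have "\<dots> = \<alpha> * (\<alpha> ^ nat \<alpha> * (\<alpha> - 2) + 1)"
      unfolding geoi_mult_pred by (simp add: algebra_simps)
    also have "\<dots> > 0"
      using \<open>\<alpha> \<ge> 3\<close> by (intro mult_pos_pos add_nonneg_pos mult_nonneg_nonneg) auto
    finally show ?thesis by (rule less_imp_neq[THEN not_sym])
  next
    case False
    then have \<alpha>: "\<alpha> \<le> -3" using assms by simp
    have "(\<alpha> - 1) * excess = (\<alpha> - 1) * geoi \<alpha> (nat (- \<alpha>)) + (\<alpha> - 1) * \<alpha>"
      using False by (simp add: excess_def distrib_left)
    also have "\<dots> = \<alpha> * (\<alpha> ^ nat (- \<alpha>) + \<alpha> - 2)"
      unfolding geoi_mult_pred by (simp add: algebra_simps)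
    also have "\<dots> \<noteq> 0"
    proof -
      have "\<bar>\<alpha>\<bar> ^ 2 \<le> \<bar>\<alpha>\<bar> ^ nat (- \<alpha>)" using \<alpha> by (intro power_increasing) auto
      then have "\<bar>\<alpha>\<bar> * \<bar>\<alpha>\<bar> \<le> \<bar>\<alpha> ^ nat (- \<alpha>)\<bar>" by (simp add: power_abs power2_eq_square)
      moreover have "3 * \<bar>\<alpha>\<bar> \<le> \<bar>\<alpha>\<bar> * \<bar>\<alpha>\<bar>" using \<alpha> by (intro mult_right_mono) auto
      ultimately show ?thesis using \<alpha> by auto
    qed
    finally show ?thesis .
  qed
  then show ?thesis by simp
qed

lemma finite_order:
  assumes \<alpha>: "\<alpha> \<ge> 3 \<or> \<alpha> \<le> -3"
  obtains n :: nat where "n > 0" "A [^] n = \<one>" "B [^] n = \<one>"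
proof -
  interpret S: macdonald_int G B A "inv D" \<alpha> by (rule swap)
  define N where "N = (\<alpha> - 1) * (excess * \<alpha> ^ (nat \<bar>\<alpha>\<bar> + 1))"
  have "N \<noteq> 0" using \<alpha> excess_nonzero[OF \<alpha>] by (auto simp: N_def)
  have one: "A [^] N = \<one>" "B [^] N = \<one>"
    using excess_order S.excess_order unfolding N_def by (auto simp: excess_def S.excess_def)
  have nat: "x [^] nat \<bar>N\<bar> = \<one>" if "x \<in> carrier G" "x [^] N = \<one>" for x
  proof -
    have "x [^] int (nat \<bar>N\<bar>) = \<one>" using that by (auto simp: abs_if int_pow_neg)
    then show ?thesis by (simp only: int_pow_int)
  qed
  show thesis
    using \<open>N \<noteq> 0\<close> nat one by (intro that[of "nat \<bar>N\<bar>"]) auto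
qed

end

text \<open>Passage between the relations of the presentation and their positive form. The relation
  B A = A B D forces D to be [B, A].\<close>

lemma (in group) macdonald_int_iff:
  assumes [simp]: "A \<in> carrier G" "B \<in> carrier G"
  shows "macdonald_int G A B D \<alpha> \<longleftrightarrow>
    D = commutator G B A \<and> conjugate_by G A (commutator G A B) = A [^] \<alpha> \<and>
    conjugate_by G B (commutator G B A) = B [^] \<alpha>"
proof -
  have D: "D \<in> carrier G \<and> B \<otimes> A = A \<otimes> (B \<otimes> D) \<longleftrightarrow> D = commutator G B A"
  proof
    assume "D \<in> carrier G \<and> B \<otimes> A = A \<otimes> (B \<otimes> D)"
    then show "D = commutator G B A" by (simp add: commutator_def m_assoc)
  qed (simp add: commutator_def m_assoc)
  have inv: "commutator G A B = inv (commutator G B A)"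
    by (simp add: commutator_def inv_mult_group m_assoc)
  have "D \<otimes> A = A [^] \<alpha> \<otimes> D \<longleftrightarrow> conjugate_by G A (inv D) = A [^] \<alpha>"
    and "B \<otimes> D = D \<otimes> B [^] \<alpha> \<longleftrightarrow> conjugate_by G B D = B [^] \<alpha>" if "D \<in> carrier G"
  proof -
    show "D \<otimes> A = A [^] \<alpha> \<otimes> D \<longleftrightarrow> conjugate_by G A (inv D) = A [^] \<alpha>"
    proof
      assume "D \<otimes> A = A [^] \<alpha> \<otimes> D"
      then have "(D \<otimes> A) \<otimes> inv D = (A [^] \<alpha> \<otimes> D) \<otimes> inv D" by simp
      then show "conjugate_by G A (inv D) = A [^] \<alpha>" using that by (simp add: conjugate_by_def m_assoc)
    next
      assume "conjugate_by G A (inv D) = A [^] \<alpha>"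
      then have "A [^] \<alpha> = D \<otimes> (A \<otimes> inv D)" using that by (simp add: conjugate_by_def m_assoc)
      then show "D \<otimes> A = A [^] \<alpha> \<otimes> D" using that by (simp add: m_assoc)
    qed
    show "B \<otimes> D = D \<otimes> B [^] \<alpha> \<longleftrightarrow> conjugate_by G B D = B [^] \<alpha>"
    proof
      assume "conjugate_by G B D = B [^] \<alpha>"
      then have "B [^] \<alpha> = inv D \<otimes> (B \<otimes> D)" using that by (simp add: conjugate_by_def m_assoc)
      then show "B \<otimes> D = D \<otimes> B [^] \<alpha>" using that by simp
    qed (use that in \<open>simp add: conjugate_by_def m_assoc\<close>)
  qed
  then show ?thesis
    unfolding macdonald_int_def macdonald_int_axioms_def inv using D is_group by auto
qed

definition macdonald_rels :: "int \<Rightarrow> (macdonald_gen word set \<times> macdonald_gen word set) set" where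
  "macdonald_rels \<alpha> =
     (let F = free_group; A = free_gen gen_A; B = free_gen gen_B in
        {(conjugate_by F A (commutator F A B), A [^]\<^bsub>F\<^esub> \<alpha>),
         (conjugate_by F B (commutator F B A), B [^]\<^bsub>F\<^esub> \<alpha>)})"

lemma macdonald_group_eq: "macdonald_group \<alpha> = presented_group (macdonald_rels \<alpha>)"
  by (simp add: macdonald_group_def macdonald_rels_def Let_def)

lemma presentation_macdonald: "presentation (macdonald_rels \<alpha>)"
proof -
  interpret group "free_group :: macdonald_gen word set monoid" by (rule group_free_group)
  show ?thesis
    by unfold_locales (auto simp: macdonald_rels_def Let_def commutator_def conjugate_by_def)
qed

definition "macdonald_A \<alpha> = presentation.proj (macdonald_rels \<alpha>) (free_gen gen_A)"
definition "macdonald_B \<alpha> = presentation.proj (macdonald_rels \<alpha>) (free_gen gen_B)"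

lemma (in group_hom) hom_commutator:
  "x \<in> carrier G \<Longrightarrow> y \<in> carrier G \<Longrightarrow> h (commutator G x y) = commutator H (h x) (h y)"
  by (simp add: commutator_def)

lemma (in group_hom) hom_conjugate_by:
  "x \<in> carrier G \<Longrightarrow> y \<in> carrier G \<Longrightarrow> h (conjugate_by G x y) = conjugate_by H (h x) (h y)"
  by (simp add: conjugate_by_def)

lemma (in group) commutator_closed [simp]:
  "x \<in> carrier G \<Longrightarrow> y \<in> carrier G \<Longrightarrow> commutator G x y \<in> carrier G"
  by (simp add: commutator_def)

lemma macdonald_group_int:
  "macdonald_int (macdonald_group \<alpha>) (macdonald_A \<alpha>) (macdonald_B \<alpha>)
     (commutator (macdonald_group \<alpha>) (macdonald_B \<alpha>) (macdonald_A \<alpha>)) \<alpha>"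
proof -
  interpret F: group "free_group :: macdonald_gen word set monoid" by (rule group_free_group)
  interpret P: presentation "macdonald_rels \<alpha>" by (rule presentation_macdonald)
  let ?F = "free_group :: macdonald_gen word set monoid" and ?A = "free_gen gen_A" and ?B = "free_gen gen_B"
  have "(conjugate_by ?F ?A (commutator ?F ?A ?B), ?A [^]\<^bsub>?F\<^esub> \<alpha>) \<in> macdonald_rels \<alpha>"
    "(conjugate_by ?F ?B (commutator ?F ?B ?A), ?B [^]\<^bsub>?F\<^esub> \<alpha>) \<in> macdonald_rels \<alpha>"
    by (simp_all add: macdonald_rels_def Let_def)
  note rel = this[THEN P.proj_rel]
  show ?thesis
    unfolding macdonald_group_eq macdonald_A_def macdonald_B_def
    using rel
    by (subst P.presented.macdonald_int_iff)
      (simp_all add: P.proj.hom_commutator P.proj.hom_conjugate_by P.proj.hom_int_pow)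
qed

lemma macdonald_group_generate:
  "carrier (macdonald_group \<alpha>) = generate (macdonald_group \<alpha>) {macdonald_A \<alpha>, macdonald_B \<alpha>}"
proof -
  interpret P: presentation "macdonald_rels \<alpha>" by (rule presentation_macdonald)
  have "(UNIV :: macdonald_gen set) = {gen_A, gen_B}" by (auto intro: macdonald_gen.exhaust)
  then have "range (\<lambda>t. P.proj (free_gen t)) = (\<lambda>t. P.proj (free_gen t)) ` {gen_A, gen_B}"
    by (rule arg_cong)
  then have "range (\<lambda>t. P.proj (free_gen t)) = {macdonald_A \<alpha>, macdonald_B \<alpha>}"
    by (simp add: macdonald_A_def macdonald_B_def)
  then show ?thesis unfolding macdonald_group_eq using P.carrier_presented by simp
qed

lemma macdonald_group_universal:
  assumes "macdonald_int H A B D \<alpha>"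
  obtains h where "h \<in> hom (macdonald_group \<alpha>) H" "h (macdonald_A \<alpha>) = A" "h (macdonald_B \<alpha>) = B"
proof -
  interpret H: macdonald_int H A B D \<alpha> by (rule assms)
  interpret F: group "free_group :: macdonald_gen word set monoid" by (rule group_free_group)
  interpret P: presentation "macdonald_rels \<alpha>" by (rule presentation_macdonald)
  define g where "g = case_macdonald_gen A B"
  have g: "range g \<subseteq> carrier H" by (auto simp: g_def split: macdonald_gen.split)
  interpret L: group_hom free_group H "free_lift H g"
    by (intro group_hom.intro group_hom_axioms.intro F.is_group H.is_group H.free_lift_hom g)
  have AB: "free_lift H g (free_gen gen_A) = A" "free_lift H g (free_gen gen_B) = B"
    using H.free_lift_gen[OF g] by (simp_all add: g_def)
  have "conjugate_by H A (commutator H A B) = A [^]\<^bsub>H\<^esub> \<alpha>" "conjugate_by H B (commutator H B A) = B [^]\<^bsub>H\<^esub> \<alpha>"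
    using assms H.macdonald_int_iff[of A B D \<alpha>] by auto
  then have lift: "free_lift H g u = free_lift H g v" if "(u, v) \<in> macdonald_rels \<alpha>" for u v
    using that unfolding macdonald_rels_def Let_def
    by (auto simp: AB L.hom_commutator L.hom_conjugate_by L.hom_int_pow)
  obtain h where "h \<in> hom (presented_group (macdonald_rels \<alpha>)) H" "\<And>t. h (P.proj (free_gen t)) = g t"
    using P.presented_lift[OF H.is_group g lift] by blast
  then show thesis
    by (intro that[of h]) (simp_all add: macdonald_group_eq macdonald_A_def macdonald_B_def g_def)
qed

section \<open>Splitting into coprime parts\<close>

context macdonald_nat
begin

lemma AD_pow: "\<exists>r. (A [^] (i::nat) \<otimes> D [^] (k::nat)) [^] (n::nat) = A [^] (r::nat) \<otimes> D [^] (k * n)"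
proof (induction n)
  case (Suc n)
  then obtain r :: nat where r: "(A [^] i \<otimes> D [^] k) [^] n = A [^] r \<otimes> D [^] (k * n)" by blast
  have "(A [^] i \<otimes> D [^] k) [^] Suc n = A [^] r \<otimes> (D [^] (k * n) \<otimes> A [^] i) \<otimes> D [^] k"
    by (simp add: r m_assoc)
  also have "\<dots> = (A [^] r \<otimes> A [^] (a ^ (k * n) * i)) \<otimes> (D [^] (k * n) \<otimes> D [^] k)"
    unfolding Dpow_Apow_nat by (simp add: m_assoc)
  also have "\<dots> = A [^] (r + a ^ (k * n) * i) \<otimes> D [^] (k * Suc n)"
    by (simp add: nat_pow_mult add.commute)
  finally show ?case by blast
qed (auto intro: exI[of _ "0::nat"])

text \<open>By nilpotency v commutes with A and B. So v B^(-j) = A^i D^k has t-th power v^t, which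
  by \<open>AD_pow\<close> is a power A^r' times D^(k t). Hence D^(k t) = v^t A^(-r'), and its t-th
  power is v^(t^2) on one side and trivial by \<open>Dpow_order\<close> on the other, while the
  order of v is prime to t.\<close>

lemma coprime_order_trivial:
  assumes nilp: "upper_central G c = carrier G"
    and t: "t > 0" "A [^] (t::nat) = \<one>" "B [^] t = \<one>"
    and v: "v \<in> generate G {A, B}" "v [^] (r::nat) = \<one>" and cop: "coprime r t"
  shows "v = \<one>"
proof -
  have vc: "v \<in> carrier G" using v(1) generate_in_carrier[of "{A, B}"] by auto
  have comm: "v \<otimes> A = A \<otimes> v" "v \<otimes> B = B \<otimes> v"
    using coprime_orders_commute[OF nilp vc v(2) _ _ cop] t by auto
  obtain i k j where vN: "v = N i k j" using generate_N[OF t v(1)] .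
  let ?x = "A [^] i \<otimes> D [^] k"
  have "v = ?x \<otimes> B [^] j" by (simp add: vN N_def m_assoc)
  then have x: "?x = v \<otimes> inv (B [^] j)" by (simp add: m_assoc)
  have vB: "v \<otimes> inv (B [^] j) = inv (B [^] j) \<otimes> v"
  proof -
    have "v \<otimes> B [^] j = B [^] j \<otimes> v" using pow_commute[OF vc _ comm(2)] by simp
    then have "inv (B [^] j) \<otimes> (v \<otimes> B [^] j) \<otimes> inv (B [^] j) = v \<otimes> inv (B [^] j)" using vc by simp
    then show ?thesis using vc by (simp add: m_assoc)
  qed
  have swap: "(x [^] (j::nat)) [^] t = (x [^] t) [^] j" if "x \<in> carrier G" for x j
    using that by (simp add: nat_pow_pow mult.commute)
  have Bj: "inv (B [^] j) [^] t = \<one>" using t(3) by (simp add: nat_pow_inv swap)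
  have "?x [^] t = v [^] t" unfolding x using pow_mult_distrib[OF vB vc] Bj vc by simp
  then obtain r' :: nat where r': "v [^] t = A [^] r' \<otimes> D [^] (k * t)" using AD_pow[of i k t] by metis
  have vA: "v [^] t \<otimes> inv (A [^] r') = inv (A [^] r') \<otimes> v [^] t"
  proof -
    have "A \<otimes> v [^] t = v [^] t \<otimes> A" using pow_commute[OF _ vc comm(1)[symmetric]] by simp
    then have "v [^] t \<otimes> A [^] r' = A [^] r' \<otimes> v [^] t" using pow_commute[of "v [^] t" A r'] vc by simp
    then have "inv (A [^] r') \<otimes> (v [^] t \<otimes> A [^] r') \<otimes> inv (A [^] r') = v [^] t \<otimes> inv (A [^] r')" using vc by simp
    then show ?thesis using vc by (simp add: m_assoc)
  qed
  have "D [^] (k * t) = inv (A [^] r') \<otimes> v [^] t" unfolding r' by simp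
  then have "D [^] (k * t) = v [^] t \<otimes> inv (A [^] r')" unfolding vA .
  then have "(D [^] (k * t)) [^] t = (v [^] t) [^] t \<otimes> inv (A [^] r') [^] t"
    using pow_mult_distrib[OF vA] vc by simp
  moreover have "(D [^] (k * t)) [^] t = (D [^] (t * t)) [^] k" by (simp add: nat_pow_pow mult_ac)
  moreover have "inv (A [^] r') [^] t = \<one>"
    using t(2) by (simp add: nat_pow_inv swap)
  ultimately have "v [^] (t * t) = \<one>" using Dpow_order[OF t(3)] vc by (simp add: nat_pow_pow)
  moreover have "coprime r (t * t)" using cop by simp
  ultimately have "local.ord v dvd r" "local.ord v dvd t * t" using v(2) vc by (auto simp: pow_eq_id)
  then have "local.ord v = 1" using \<open>coprime r (t * t)\<close> by (metis coprime_common_divisor_nat dvd_1_iff_1 nat_dvd_1_iff_1)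
  then show ?thesis using pow_ord_eq_1[OF vc] vc by simp
qed

end

text \<open>f and f' are the idempotents modulo s t belonging to s and t, so the powers with
  exponents f and f' are the s-part and the t-part of A and B.\<close>

locale macdonald_split = macdonald_nat +
  fixes s t f f' :: nat
  assumes gen: "carrier G = generate G {A, B}"
    and cop: "coprime s t" and pos: "s > 0" "t > 0"
    and order: "A [^] (s * t) = \<one>" "B [^] (s * t) = \<one>"
    and f: "[f = 1] (mod s)" "[f = 0] (mod t)"
    and f': "[f' = 0] (mod s)" "[f' = 1] (mod t)"
begin

lemma swap_split: "macdonald_split G A B D a t s f' f"
  using gen cop pos order f f' macdonald_nat_axioms
  by (simp add: macdonald_split_def macdonald_split_axioms_def coprime_commute mult.commute)

lemma obtain_nilpotent: obtains c where "upper_central G c = carrier G"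
  using nilpotent[OF gen _ order] pos by auto

lemma cross_commute:
  assumes "g \<in> carrier G" "g [^] s = \<one>" "h \<in> carrier G" "h [^] t = \<one>"
  shows "g \<otimes> h = h \<otimes> g"
proof -
  obtain c where c: "upper_central G c = carrier G" by (rule obtain_nilpotent)
  show ?thesis by (rule coprime_orders_commute[OF c assms cop])
qed

lemma part_order:
  assumes "x \<in> carrier G" "x [^] (s * t) = \<one>"
  shows "(x [^] f) [^] s = \<one>"
proof -
  have "t dvd f" using f(2) by (simp add: cong_0_iff)
  then obtain d where d: "f = t * d" by blast
  have "(x [^] f) [^] s = (x [^] (s * t)) [^] d" using assms(1) by (simp add: nat_pow_pow d mult_ac)
  then show ?thesis using assms by simp
qed

lemma part_split:
  assumes "x \<in> carrier G" "x [^] (s * t) = \<one>"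
  shows "x = x [^] f \<otimes> x [^] f'"
proof -
  have "[f + f' = 1] (mod s)" using cong_add[OF f(1) f'(1)] by simp
  moreover have "[f + f' = 1] (mod t)" using cong_add[OF f(2) f'(2)] by simp
  ultimately have "[f + f' = 1] (mod s * t)" using cop by (intro coprime_cong_mult_nat)
  then have "(f + f') mod (s * t) = 1 mod (s * t)" by (simp add: cong_def)
  then have "x [^] (f + f') = x [^] (1::nat)" using pow_mod_nat[OF assms] by metis
  then show ?thesis using assms(1) by (simp add: nat_pow_mult)
qed

abbreviation "A1 \<equiv> A [^] f"
abbreviation "B1 \<equiv> B [^] f"
abbreviation "D1 \<equiv> commutator G B1 A1"

end

context macdonald_split
begin

interpretation T: macdonald_split G A B D a t s f' f by (rule swap_split)

lemma orders: "A1 [^] s = \<one>" "B1 [^] s = \<one>" "T.A1 [^] t = \<one>" "T.B1 [^] t = \<one>"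
  using part_order T.part_order order by (auto simp: mult.commute)

lemma cross: "A1 \<otimes> T.A1 = T.A1 \<otimes> A1" "A1 \<otimes> T.B1 = T.B1 \<otimes> A1"
  "B1 \<otimes> T.A1 = T.A1 \<otimes> B1" "B1 \<otimes> T.B1 = T.B1 \<otimes> B1"
  by (intro cross_commute orders; simp)+

lemma commute_D1:
  assumes "x \<in> carrier G" "x \<otimes> A1 = A1 \<otimes> x" "x \<otimes> B1 = B1 \<otimes> x"
  shows "x \<otimes> D1 = D1 \<otimes> x"
proof (rule commute_generate[of "{A1, B1}"])
  show "D1 \<in> generate G {A1, B1}"
    unfolding commutator_def by (auto intro: generate.intros)
qed (use assms in auto)

text \<open>Elements of the two parts commute, so the commutator of the products is the product of
  the commutators.\<close>

lemma D_split: "D = D1 \<otimes> T.D1"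
proof -
  have c: "T.A1 \<otimes> D1 = D1 \<otimes> T.A1" "T.B1 \<otimes> D1 = D1 \<otimes> T.B1"
    using commute_D1 cross by (simp_all add: HOL.eq_commute)
  have BA: "B1 \<otimes> A1 = A1 \<otimes> (B1 \<otimes> D1)" "T.B1 \<otimes> T.A1 = T.A1 \<otimes> (T.B1 \<otimes> T.D1)"
    by (simp_all add: commutator_def m_assoc)
  have AB: "A = A1 \<otimes> T.A1" "B = B1 \<otimes> T.B1" using part_split order by auto
  have "B \<otimes> A = (B1 \<otimes> T.B1) \<otimes> (A1 \<otimes> T.A1)" using AB by simp
  also have "\<dots> = B1 \<otimes> (T.B1 \<otimes> A1) \<otimes> T.A1" by (simp add: m_assoc)
  also have "\<dots> = (B1 \<otimes> A1) \<otimes> (T.B1 \<otimes> T.A1)" unfolding cross(2)[symmetric] by (simp add: m_assoc)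
  also have "\<dots> = A1 \<otimes> B1 \<otimes> (D1 \<otimes> T.A1) \<otimes> T.B1 \<otimes> T.D1" unfolding BA by (simp add: m_assoc)
  also have "\<dots> = A1 \<otimes> (B1 \<otimes> T.A1) \<otimes> (D1 \<otimes> T.B1) \<otimes> T.D1" unfolding c(1)[symmetric] by (simp add: m_assoc)
  also have "\<dots> = (A1 \<otimes> T.A1) \<otimes> ((B1 \<otimes> T.B1) \<otimes> (D1 \<otimes> T.D1))"
    unfolding c(2)[symmetric] cross(3) by (simp add: m_assoc)
  also have "\<dots> = A \<otimes> (B \<otimes> (D1 \<otimes> T.D1))" using AB by simp
  finally have "A \<otimes> (B \<otimes> D) = A \<otimes> (B \<otimes> (D1 \<otimes> T.D1))" unfolding B_A .
  then show ?thesis by simp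
qed

end

context macdonald_split
begin

interpretation T: macdonald_split G A B D a t s f' f by (rule swap_split)

text \<open>The t-part of D commutes with A1 and B1. So on these powers of A and B conjugation by D
  and by D1 agree, and the relations for D carry over.\<close>

theorem part_macdonald: "macdonald_nat G A1 B1 D1 a"
proof
  have c: "A1 \<otimes> T.D1 = T.D1 \<otimes> A1" "B1 \<otimes> T.D1 = T.D1 \<otimes> B1"
    using T.commute_D1 cross by auto
  have "D1 \<otimes> A1 \<otimes> T.D1 = D \<otimes> A1" unfolding D_split using c(1) by (simp add: m_assoc)
  also have "\<dots> = A1 [^] int a \<otimes> D"
    using Dpow_Apow_nat[of 1 f] by (simp add: int_pow_int nat_pow_pow mult.commute)
  also have "\<dots> = (A1 [^] int a \<otimes> D1) \<otimes> T.D1" unfolding D_split by (simp add: m_assoc)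
  finally show "D1 \<otimes> A1 = A1 [^] int a \<otimes> D1" by simp
  have "T.D1 \<otimes> (B1 \<otimes> D1) = (T.D1 \<otimes> B1) \<otimes> D1" by (simp add: m_assoc)
  also have "\<dots> = B1 \<otimes> (T.D1 \<otimes> D1)" unfolding c(2)[symmetric] by (simp add: m_assoc)
  also have "T.D1 \<otimes> D1 = D" using T.D_split ..
  also have "B1 \<otimes> D = D \<otimes> B1 [^] int a"
    using Bpow_Dpow_nat[of f 1] by (simp add: int_pow_int nat_pow_pow mult.commute)
  also have "\<dots> = T.D1 \<otimes> (D1 \<otimes> B1 [^] int a)" unfolding T.D_split by (simp add: m_assoc)
  finally show "B1 \<otimes> D1 = D1 \<otimes> B1 [^] int a" by simp
  show "B1 \<otimes> A1 = A1 \<otimes> (B1 \<otimes> D1)" by (simp add: commutator_def m_assoc)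
qed (simp_all add: a_pos)

end

context macdonald_split
begin

interpretation T: macdonald_split G A B D a t s f' f by (rule swap_split)

sublocale part: macdonald_nat G A1 B1 D1 a by (rule part_macdonald)

lemma parts_commute:
  assumes g: "g \<in> generate G {A1, B1}" and h: "h \<in> generate G {T.A1, T.B1}"
  shows "g \<otimes> h = h \<otimes> g"
proof (rule commute_generate[OF _ _ _ h])
  show gc: "g \<in> carrier G" using g generate_in_carrier[of "{A1, B1}"] by auto
  fix w assume "w \<in> {T.A1, T.B1}"
  then have w: "w \<in> carrier G" "w \<otimes> A1 = A1 \<otimes> w" "w \<otimes> B1 = B1 \<otimes> w" using cross by auto
  have "w \<otimes> g = g \<otimes> w" by (rule commute_generate[OF _ w(1) _ g]) (use w in auto)
  then show "g \<otimes> w = w \<otimes> g" ..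
qed auto

lemma D1_part: "D1 \<in> generate G {A1, B1}"
  unfolding commutator_def by (auto intro: generate.intros)

lemma pow_part: "x \<in> generate G {A1, B1} \<Longrightarrow> x [^] (n::nat) \<in> generate G {A1, B1}"
  by (induction n) (auto intro: generate.intros)

end

context macdonald_split
begin

interpretation T: macdonald_split G A B D a t s f' f by (rule swap_split)

text \<open>Splitting the three factors of a normal form gives x = u v with u in the s-part and v in
  the t-part. The power of v with exponent r r', which is prime to t, is trivial; so v = 1 by
  \<open>coprime_order_trivial\<close>.\<close>

theorem coprime_torsion_subset:
  assumes x: "x \<in> carrier G" "x [^] (r::nat) = \<one>" and r: "coprime r t"
    and r': "\<And>u. u \<in> generate G {A1, B1} \<Longrightarrow> u [^] (r'::nat) = \<one>" "coprime r' t"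
  shows "x \<in> generate G {A1, B1}"
proof -
  have "s * t > 0" using pos by simp
  then obtain i k j where xN: "x = N i k j" using generate_N order x(1) gen by metis
  define a1 d1 b1 where "a1 = A1 [^] i" and "d1 = D1 [^] k" and "b1 = B1 [^] j"
  define a2 d2 b2 where "a2 = T.A1 [^] i" and "d2 = T.D1 [^] k" and "b2 = T.B1 [^] j"
  have in1: "a1 \<in> generate G {A1, B1}" "d1 \<in> generate G {A1, B1}" "b1 \<in> generate G {A1, B1}"
    unfolding a1_def d1_def b1_def using pow_part D1_part generate.incl[of _ "{A1, B1}" G] by auto
  have in2: "a2 \<in> generate G {T.A1, T.B1}" "d2 \<in> generate G {T.A1, T.B1}" "b2 \<in> generate G {T.A1, T.B1}"
    unfolding a2_def d2_def b2_def using T.pow_part T.D1_part generate.incl[of _ "{T.A1, T.B1}" G] by auto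
  have [simp]: "a1 \<in> carrier G" "d1 \<in> carrier G" "b1 \<in> carrier G" "a2 \<in> carrier G" "d2 \<in> carrier G" "b2 \<in> carrier G"
    by (simp_all add: a1_def d1_def b1_def a2_def d2_def b2_def)
  define u where "u = a1 \<otimes> (d1 \<otimes> b1)"
  define v where "v = a2 \<otimes> (d2 \<otimes> b2)"
  have u: "u \<in> generate G {A1, B1}" unfolding u_def by (intro generate.eng in1)
  have v: "v \<in> generate G {T.A1, T.B1}" unfolding v_def by (intro generate.eng in2)
  have [simp]: "u \<in> carrier G" "v \<in> carrier G" by (simp_all add: u_def v_def)
  have AB: "A = A1 \<otimes> T.A1" "B = B1 \<otimes> T.B1" using part_split order by auto
  have "A [^] i = a1 \<otimes> a2" unfolding a1_def a2_def
    using pow_mult_distrib[OF cross(1), of i] AB(1) by simp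
  moreover have "B [^] j = b1 \<otimes> b2" unfolding b1_def b2_def
    using pow_mult_distrib[OF cross(4), of j] AB(2) by simp
  moreover have "D [^] k = d1 \<otimes> d2" unfolding d1_def d2_def
    using pow_mult_distrib[OF parts_commute[OF D1_part T.D1_part], of k] D_split by simp
  ultimately have "x = a1 \<otimes> (a2 \<otimes> d1) \<otimes> (d2 \<otimes> b1) \<otimes> b2" unfolding xN N_def by (simp add: m_assoc)
  also have "\<dots> = a1 \<otimes> d1 \<otimes> (a2 \<otimes> b1) \<otimes> d2 \<otimes> b2"
    unfolding parts_commute[OF in1(2) in2(1), symmetric] parts_commute[OF in1(3) in2(2), symmetric]
    by (simp add: m_assoc)
  also have "\<dots> = u \<otimes> v"
    unfolding parts_commute[OF in1(3) in2(1), symmetric] u_def v_def by (simp add: m_assoc)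
  finally have xuv: "x = u \<otimes> v" .
  have "x [^] (r * r') = u [^] (r * r') \<otimes> v [^] (r * r')"
    unfolding xuv by (intro pow_mult_distrib parts_commute[OF u v]) auto
  moreover have "x [^] (r * r') = \<one>" using x by (simp flip: nat_pow_pow)
  moreover have "u [^] (r * r') = \<one>" using r'(1)[OF u] by (simp add: mult.commute[of r] flip: nat_pow_pow)
  ultimately have "v [^] (r * r') = \<one>" by simp
  moreover obtain c where c: "upper_central G c = carrier G" by (rule obtain_nilpotent)
  ultimately have "v = \<one>"
    using T.part.coprime_order_trivial[OF c pos(2) orders(3,4) v, of "r * r'"] r r'(2) by simp
  then show ?thesis using u by (simp add: xuv)
qed

end

text \<open>D is a word in A and B, so relations and normal forms can be read inside any subgroup
  containing A and B.\<close>

lemma (in macdonald_nat) macdonald_nat_subgroup: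
  assumes H: "subgroup H G" and A: "A \<in> H" and B: "B \<in> H"
  shows "macdonald_nat (G\<lparr>carrier := H\<rparr>) A B D a"
    and "macdonald_nat.N (G\<lparr>carrier := H\<rparr>) A B D i k j = N i k j"
proof -
  interpret H: subgroup H G by (rule H)
  interpret K: group "G\<lparr>carrier := H\<rparr>" by (rule H.subgroup_is_group[OF is_group])
  have "D = inv B \<otimes> (inv A \<otimes> (B \<otimes> A))" by (simp add: B_A)
  then have D: "D \<in> H" using A B by (simp only: H.m_closed H.m_inv_closed)
  show K: "macdonald_nat (G\<lparr>carrier := H\<rparr>) A B D a"
    by unfold_locales
      (use A B D D_A B_D B_A a_pos in \<open>simp_all flip: int_pow_consistent[OF H]\<close>)
  show "macdonald_nat.N (G\<lparr>carrier := H\<rparr>) A B D i k j = N i k j"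
    unfolding macdonald_nat.N_def[OF K] N_def by (simp flip: nat_pow_consistent)
qed

text \<open>6 C(a + 1, 3) = (a + 1) a (a - 1). For p > 3 the binomial is divisible by p, and 1 is
  left. For p = 3 and a = 3u + 1 the 6 consumes the factor 3 of a - 1, and u + 1 modulo 3 is
  left.\<close>

lemma choose_three_not_dvd:
  fixes p a :: nat
  assumes p: "prime p" "int p dvd int a - 1"
    and cond: "p > 3 \<or> (p = 3 \<and> \<not> 3 dvd (int a - 1) div 3 + 1)"
  shows "\<not> int p dvd 1 - 2 * int (Suc a choose 3)"
proof
  assume dvd: "int p dvd 1 - 2 * int (Suc a choose 3)"
  have six: "6 * int (Suc a choose 3) = (int a + 1) * int a * (int a - 1)"
    using six_choose_three[of "Suc a"] by simp
  show False
  proof (cases "p > 3")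
    case True
    have "int p dvd 6 * int (Suc a choose 3)" unfolding six using p(2) by (rule dvd_mult)
    moreover have "\<not> int p dvd 6"
    proof
      assume "int p dvd 6"
      then have "int p dvd 2 * 3" by simp
      then have "int p dvd 2 \<or> int p dvd 3" using p(1) by (simp only: prime_dvd_mult_iff prime_nat_int_transfer)
      then show False using True by (auto dest: zdvd_imp_le)
    qed
    ultimately have "int p dvd int (Suc a choose 3)" using p(1) by (simp only: prime_dvd_mult_iff prime_nat_int_transfer) blast
    then have "int p dvd 2 * int (Suc a choose 3)" by (rule dvd_mult)
    with dvd have "int p dvd (1 - 2 * int (Suc a choose 3)) + 2 * int (Suc a choose 3)" by (rule dvd_add)
    then show False using p(1) by simp
  next
    case False
    then have p3: "p = 3" and c: "\<not> 3 dvd (int a - 1) div 3 + 1" using cond by auto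
    define u where "u = (int a - 1) div 3"
    have a: "int a = 3 * u + 1" using p(2) by (simp add: u_def p3)
    have "6 * int (Suc a choose 3) = 3 * ((3 * u + 2) * (3 * u + 1) * u)" unfolding six a by (simp add: algebra_simps)
    then have "1 - 2 * int (Suc a choose 3) = (u + 1) - 3 * (3 * u^3 + 3 * u^2 + u)"
      by (simp add: algebra_simps power2_eq_square power3_eq_cube)
    with dvd have "3 dvd (u + 1) - 3 * (3 * u^3 + 3 * u^2 + u)" by (simp add: p3)
    then have "3 dvd u + 1" by (simp only: dvd_diff_left_iff dvd_triv_left)
    then show False using c by (simp add: u_def)
  qed
qed

lemma sylow_macdonald:
  fixes \<alpha> :: int and p m :: nat
  assumes p: "prime p" "p > 2" "int p dvd \<alpha> - 1" and \<alpha>: "\<alpha> \<ge> 3 \<or> \<alpha> \<le> -3"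
    and m: "m = multiplicity (int p) (\<alpha> - 1)"
    and cond: "p > 3 \<or> (p = 3 \<and> \<not> 3 dvd (\<alpha> - 1) div 3 + 1)"
    and P: "sylow_subgroup p (macdonald_group \<alpha>) P"
  obtains A B D a q e where "mac_p_group ((macdonald_group \<alpha>)\<lparr>carrier := P\<rparr>) A B D a p m q e"
proof -
  define G where "G = macdonald_group \<alpha>"
  define A where "A = macdonald_A \<alpha>"
  define B where "B = macdonald_B \<alpha>"
  define D where "D = commutator G B A"
  interpret M: macdonald_int G A B D \<alpha>
    unfolding G_def A_def B_def D_def by (rule macdonald_group_int)
  have gen: "carrier G = generate G {A, B}"
    unfolding G_def A_def B_def by (rule macdonald_group_generate)
  have prime_p: "prime (int p)" using p(1) by simp
  have m_pos: "m > 0"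
    using p(3) \<alpha> prime_p unfolding m by (subst multiplicity_gt_zero_iff) auto
  obtain n :: nat where n: "n > 0" "A [^]\<^bsub>G\<^esub> n = \<one>\<^bsub>G\<^esub>" "B [^]\<^bsub>G\<^esub> n = \<one>\<^bsub>G\<^esub>"
    using M.finite_order[OF \<alpha>] .
  \<comment> \<open>The factor p^(3m) guarantees that q^3 divides s. Then a and \<alpha> agree
    modulo q^3, as the model requires, and a - 1 has the same p-adic valuation as \<alpha> -
    1.\<close>
  define L where "L = multiplicity p (n * p ^ (3 * m))"
  define s where "s = p ^ L"
  have nz: "n * p ^ (3 * m) \<noteq> 0" using n(1) p(2) by simp
  obtain t where t: "n * p ^ (3 * m) = s * t" "\<not> p dvd t"
    using multiplicity_decompose'[OF nz, of p] p(1) by (metis L_def s_def mult.commute not_prime_unit)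
  have order: "A [^]\<^bsub>G\<^esub> (s * t) = \<one>\<^bsub>G\<^esub>" "B [^]\<^bsub>G\<^esub> (s * t) = \<one>\<^bsub>G\<^esub>"
    unfolding t(1)[symmetric] using n by (simp_all flip: M.nat_pow_pow)
  have pos: "s > 0" "t > 0" using nz t(1) by (metis mult_eq_0_iff neq0_conv)+
  have cop: "coprime s t" using t(2) p(1) unfolding s_def by (simp add: prime_imp_coprime)
  have L: "3 * m \<le> L" unfolding L_def using nz p(1) by (intro multiplicity_geI) auto
  \<comment> \<open>Adding s t to the residue makes a positive; powers of A and B with exponents a
    and \<alpha> agree.\<close>
  define a where "a = nat (\<alpha> mod int (s * t) + int (s * t))"
  have a_pos: "a > 0" and a: "int a = \<alpha> mod int (s * t) + int (s * t)"
    using pos pos_mod_sign[of "int (s * t)" \<alpha>] unfolding a_def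
    by (simp_all add: add_nonneg_pos)
  have a_cong: "[\<alpha> = int a] (mod int (s * t))" by (simp add: a cong_def)
  have a_cong_s: "[\<alpha> = int a] (mod int s)" using a_cong by (rule cong_dvd_modulus) simp
  have pow_a: "x [^]\<^bsub>G\<^esub> \<alpha> = x [^]\<^bsub>G\<^esub> int a" if "x \<in> carrier G" "x [^]\<^bsub>G\<^esub> (s * t) = \<one>\<^bsub>G\<^esub>" for x
    using that by (intro M.int_pow_eq_mod[OF _ _ a_cong]) (simp_all only: int_pow_int)
  obtain f where f: "[f = 1] (mod s)" "[f = 0] (mod t)" using binary_chinese_remainder_nat[OF cop] by blast
  obtain f' where f': "[f' = 0] (mod s)" "[f' = 1] (mod t)" using binary_chinese_remainder_nat[OF cop] by blast
  have "macdonald_nat G A B D a"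
    by unfold_locales
      (use M.D_A M.B_D M.B_A pow_a[OF M.closed(1) order(1)] pow_a[OF M.closed(2) order(2)] a_pos in simp_all)
  then interpret S: macdonald_split G A B D a s t f f'
    by (intro macdonald_split.intro macdonald_split_axioms.intro gen cop pos order f f')
  define P0 where "P0 = generate G {S.A1, S.B1}"
  have P0: "subgroup P0 G" unfolding P0_def by (rule M.generate_is_subgroup) simp
  have inP0: "S.A1 \<in> P0" "S.B1 \<in> P0" unfolding P0_def by (auto intro: generate.incl)
  let ?J = "G\<lparr>carrier := P0\<rparr>"
  note J = S.part.macdonald_nat_subgroup[OF P0 inP0]
  define q where "q = int p ^ m"
  define e where "e = int a - 1"
  have dvd_e: "int p ^ i dvd e \<longleftrightarrow> int p ^ i dvd \<alpha> - 1" if "i \<le> L" for i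
  proof -
    have "[\<alpha> - 1 = e] (mod int p ^ i)"
      unfolding e_def using that a_cong_s
      by (intro cong_diff cong_refl cong_dvd_modulus[OF a_cong_s]) (simp add: s_def le_imp_power_dvd)
    then show ?thesis by (simp add: cong_dvd_iff)
  qed
  interpret R: mac_arith p m a q e
  proof
    show "q dvd e" unfolding q_def using dvd_e[of m] L by (simp add: m multiplicity_dvd)
  qed (use p a_pos m_pos in \<open>simp_all add: q_def e_def\<close>)
  have val: "\<not> int p * q dvd e"
  proof
    assume "int p * q dvd e"
    then have "int p ^ Suc m dvd \<alpha> - 1" using dvd_e[of "Suc m"] L m_pos by (simp add: q_def)
    then have "Suc m \<le> m" unfolding m using \<alpha> prime_p by (intro multiplicity_geI) auto
    then show False by simp
  qed
  have "\<not> 3 dvd (int a - 1) div 3 + 1" if "p = 3"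
  proof -
    \<comment> \<open>Congruence modulo 27 survives the division by 3, so (a - 1) / 3 and (\<alpha>
      - 1) / 3 have the same residue modulo 3.\<close>
    have "p ^ 3 dvd s" unfolding s_def using L m_pos by (intro le_imp_power_dvd) simp
    then have "int 27 dvd int s" using that by (simp only: of_nat_dvd_iff) simp
    then have "[\<alpha> = int a] (mod 27)" using cong_dvd_modulus[OF a_cong_s] by simp
    then obtain k where "int a = \<alpha> + 27 * k" by (metis cong_iff_lin)
    moreover have "\<not> 3 dvd (\<alpha> - 1) div 3 + 1" using cond that by simp
    ultimately show ?thesis by presburger
  qed
  then have cond': "\<not> int p dvd 1 - 2 * int (Suc a choose 3)"
    using cond p(1) R.q_dvd_e dvd_e[of 1] L m_pos p(3) by (intro choose_three_not_dvd) (auto simp: e_def)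
  interpret K: mac_p_group ?J S.A1 S.B1 S.D1 a p m q e
  proof (intro mac_p_group.intro mac_p_group_axioms.intro J(1) R.mac_arith_axioms val cond')
    show "carrier ?J = generate ?J {S.A1, S.B1}"
      using M.generate_consistent[of "{S.A1, S.B1}" P0] P0 inP0 by (simp add: P0_def)
    show "\<exists>L. S.A1 [^]\<^bsub>?J\<^esub> p ^ L = \<one>\<^bsub>?J\<^esub> \<and> S.B1 [^]\<^bsub>?J\<^esub> p ^ L = \<one>\<^bsub>?J\<^esub>"
      using S.part_order order by (intro exI[of _ L]) (simp add: s_def flip: M.nat_pow_consistent)
    fix i k j i' k' j'
    assume "macdonald_nat.N ?J S.A1 S.B1 S.D1 i k j = macdonald_nat.N ?J S.A1 S.B1 S.D1 i' k' j'"
    then have eq: "S.part.N i k j = S.part.N i' k' j'" unfolding J(2) .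
    \<comment> \<open>The generators of the model are killed by q^3, so they satisfy the relations
      for \<alpha> as well as for a. The resulting homomorphism on the whole group sends A^f to A',
      because f is 1 modulo q^3, and so separates the normal forms in \<open>P0\<close>.\<close>
    obtain A' B' D' where mod: "macdonald_nat R.model A' B' D' a"
      "A' [^]\<^bsub>R.model\<^esub> nat (q^3) = \<one>\<^bsub>R.model\<^esub>" "B' [^]\<^bsub>R.model\<^esub> nat (q^3) = \<one>\<^bsub>R.model\<^esub>"
      "\<And>i k j i' k' j'. macdonald_nat.N R.model A' B' D' i k j = macdonald_nat.N R.model A' B' D' i' k' j' \<Longrightarrow>
        R.nf_class (i, k, j) = R.nf_class (i', k', j')"
      using R.model_exists by blast
    interpret O: macdonald_nat R.model A' B' D' a by (rule mod(1))
    have q3: "nat (q^3) = p ^ (3 * m)"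
      by (simp add: q_def mult.commute flip: power_mult of_nat_power)
    then have q3_dvd: "nat (q^3) dvd s" unfolding s_def using L by (simp add: le_imp_power_dvd)
    have pow_\<alpha>: "x [^]\<^bsub>R.model\<^esub> \<alpha> = x [^]\<^bsub>R.model\<^esub> int a" and pow_f: "x [^]\<^bsub>R.model\<^esub> f = x"
      if x: "x \<in> carrier R.model" "x [^]\<^bsub>R.model\<^esub> nat (q^3) = \<one>\<^bsub>R.model\<^esub>" for x
    proof -
      have "[\<alpha> = int a] (mod int (nat (q^3)))"
        using a_cong_s by (rule cong_dvd_modulus) (simp only: of_nat_dvd_iff q3_dvd)
      then show "x [^]\<^bsub>R.model\<^esub> \<alpha> = x [^]\<^bsub>R.model\<^esub> int a"
        using x by (intro O.int_pow_eq_mod[of x "int (nat (q^3))"]) (simp_all only: int_pow_int)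
      have "[f = 1] (mod nat (q^3))" using f(1) q3_dvd by (rule cong_dvd_modulus_nat)
      then have "x [^]\<^bsub>R.model\<^esub> f = x [^]\<^bsub>R.model\<^esub> (1::nat)"
        using O.pow_mod_nat[OF x] by (metis cong_def)
      then show "x [^]\<^bsub>R.model\<^esub> f = x" using x(1) by simp
    qed
    have "macdonald_int R.model A' B' D' \<alpha>"
      by unfold_locales (use O.D_A O.B_D O.B_A pow_\<alpha> mod(2,3) in simp_all)
    then obtain h where h: "h \<in> hom G R.model" "h A = A'" "h B = B'"
      unfolding G_def A_def B_def by (rule macdonald_group_universal)
    interpret h: group_hom G R.model h
      by (intro group_hom.intro group_hom_axioms.intro M.is_group O.is_group h(1))
    have hA: "h S.A1 = A'" and hB: "h S.B1 = B'"
      using pow_f mod(2,3) by (simp_all add: h.hom_nat_pow h(2,3))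
    have "D' = commutator R.model B' A'"
      using O.macdonald_int_iff[of A' B' D' "int a"] O.macdonald_int_axioms by simp
    then have hD: "h S.D1 = D'" by (simp add: h.hom_commutator hA hB)
    have "h (S.part.N i k j) = O.N i k j" for i k j
      by (simp add: S.part.N_def O.N_def h.hom_nat_pow hA hB hD)
    then show "R.nf_class (i, k, j) = R.nf_class (i', k', j')" using eq mod(4) by metis
  qed
  have exp: "u [^]\<^bsub>G\<^esub> (K.Q * K.Q * K.Q) = \<one>\<^bsub>G\<^esub>" if "u \<in> P0" for u
    using K.pow_Q3[of u] that by (simp flip: M.nat_pow_consistent)
  have Q3: "K.Q * K.Q * K.Q = p ^ (3 * m)"
    unfolding K.Q_def power_add[symmetric] by (rule arg_cong) simp
  have ordP: "u \<in> carrier G \<and> (\<exists>k. M.ord u = p ^ k)" if "u \<in> P0" for u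
  proof -
    have uc: "u \<in> carrier G" using that P0 by (simp add: subgroup.mem_carrier)
    then have "M.ord u dvd p ^ (3 * m)" using exp[OF that] by (simp add: M.pow_eq_id Q3)
    then show ?thesis using uc divides_primepow_nat[OF p(1)] by blast
  qed
  \<comment> \<open>Elements of P have p-power order, which is prime to t, so they lie in
    \<open>P0\<close>. As \<open>P0\<close> is itself a p-subgroup, maximality of P gives
    equality.\<close>
  have "P \<subseteq> P0"
  proof
    fix x assume x: "x \<in> P"
    have psub: "p_subgroup p G P" using P by (simp add: sylow_subgroup_def G_def)
    then have xc: "x \<in> carrier G" using x by (auto simp: p_subgroup_def subgroup.mem_carrier)
    obtain k where k: "M.ord x = p ^ k" using psub x by (auto simp: p_subgroup_def)
    have "x [^]\<^bsub>G\<^esub> (p ^ k) = \<one>\<^bsub>G\<^esub>" using M.pow_ord_eq_1[OF xc] by (simp add: k)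
    moreover have "coprime (p ^ i) t" for i using t(2) p(1) by (simp add: prime_imp_coprime)
    ultimately show "x \<in> P0" unfolding P0_def
      by (intro S.coprime_torsion_subset[OF xc, of "p ^ k" "p ^ (3 * m)"]) (use exp in \<open>simp_all add: P0_def Q3\<close>)
  qed
  moreover have "p_subgroup p G P0" using P0 ordP by (auto simp: p_subgroup_def)
  ultimately have "P = P0" using P unfolding sylow_subgroup_def G_def by blast
  then show thesis using that K.mac_p_group_axioms unfolding G_def by blast
qed

theorem proposition9p1:
  fixes \<alpha> :: int and p m :: nat
    and P :: "macdonald_gen word set set set"
    and J :: "macdonald_gen word set set monoid"
  assumes "\<alpha> \<notin> {0, 1, 2}"
    and "prime p" and "int p dvd \<alpha> - 1"
    and "m = multiplicity (int p) (\<alpha> - 1)"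
    and "sylow_subgroup p (macdonald_group \<alpha>) P"
    and "J = (macdonald_group \<alpha>)\<lparr>carrier := P\<rparr>"
    and "p > 3 \<or> (p = 3 \<and> (m > 1 \<or> [(\<alpha> - 1) div 3 = 1] (mod 3)))"
  shows "center J = power_subgroup J (int p ^ (2 * m))
    \<and> upper_central J 3 = power_subgroup J (int p ^ m)
    \<and> comm_group (J\<lparr>carrier := upper_central J 3\<rparr>)
    \<and> card (upper_central J 3) = p ^ (4 * m)
    \<and> J\<lparr>carrier := upper_central J 3\<rparr> \<cong> abelian_xyz_group p m
    \<and> J Mod upper_central J 3 \<cong> heisenberg_group (residue_ring (int p ^ m))
    \<and> group_exponent J = p ^ (3 * m)"
proof -
  \<comment> \<open>For p = 3 both alternatives exclude the residue 2 of (\<alpha> - 1) / 3 modulo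
    3: it is 0 when m > 1 and 1 otherwise.\<close>
  have cond: "p > 3 \<or> (p = 3 \<and> \<not> 3 dvd (\<alpha> - 1) div 3 + 1)"
  proof (cases "p > 3")
    case False
    then have p3: "p = 3" and c: "m > 1 \<or> [(\<alpha> - 1) div 3 = 1] (mod 3)" using assms(7) by auto
    show ?thesis
    proof (cases "m > 1")
      case True
      then have "int p ^ 2 dvd \<alpha> - 1" unfolding assms(4) by (intro multiplicity_dvd') simp
      then have "9 dvd \<alpha> - 1" by (simp add: p3)
      then have "\<not> 3 dvd (\<alpha> - 1) div 3 + 1" by presburger
      then show ?thesis using p3 by simp
    next
      case False
      then have "(\<alpha> - 1) div 3 mod 3 = 1" using c by (simp add: cong_def)
      then have "\<not> 3 dvd (\<alpha> - 1) div 3 + 1" by presburger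
      then show ?thesis using p3 by simp
    qed
  qed simp
  have "\<alpha> \<noteq> -1"
  proof
    assume "\<alpha> = -1"
    then have "int p dvd 2" using assms(3) by simp
    then show False using cond by (auto dest: zdvd_imp_le)
  qed
  \<comment> \<open>At \<alpha> = -2 the integer \<open>excess\<close> is 0 and gives no bound on
    the orders. There \<alpha> - 1 = -3 leaves only p = 3, and (\<alpha> - 1) / 3 = -1 has the
    excluded residue 2.\<close>
  moreover have "\<alpha> \<noteq> -2"
  proof
    assume \<alpha>: "\<alpha> = -2"
    then have "int p dvd 3" using assms(3) by simp
    then have "p = 3" using cond by (auto dest: zdvd_imp_le)
    then show False using cond by (simp add: \<alpha>)
  qed
  ultimately have "\<alpha> \<ge> 3 \<or> \<alpha> \<le> -3" using assms(1) by auto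
  moreover have "p > 2" using cond by auto
  ultimately obtain A B D a q e where "mac_p_group J A B D a p m q e"
    using sylow_macdonald[of p \<alpha> m P] assms cond by metis
  then interpret mac_p_group J A B D a p m q e .
  show ?thesis
    unfolding upper_central_3_eq power_subgroup_Q power_subgroup_Q2 center_eq
    using W_comm_group card_W W_iso Mod_W_iso group_exponent_eq by (simp add: q_def)
qed

end
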